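(* Let $\tau:=(\sqrt5-1)/2$, let $b_0(z):=\dfrac{\tau z}{1-\tau^2z}$, let $w_n:=1-4^{-n}$ for $n\ge1$, let $B$ be the Blaschke product with (simple) zeros at the points $w_n$ $(n\ge1)$, and let $b:=b_0B^2$. Let \[ f(z):=\sum_{n\ge1}\frac{2^{-n}}{1-w_nz}\qquad(z\in\mathbb{D}). \] Then the Taylor partial sums $s_n(f)$ of $f$ (about $0$) and their Cesàro means $\sigma_n(f)$ satisfy \[ \limsup_{n\to\infty}\|s_n(f)\|_{\mathcal{H}(b)}=\infty \quad\text{and}\quad \limsup_{n\to\infty}\|\sigma_n(f)\|_{\mathcal{H}(b)}=\infty. \]
   Context: $\mathbb{D}$ is the open unit disk, $\mathbb{T}$ the unit circle, $H^2$ and $H^\infty$ the usual Hardy spaces on $\mathbb{D}$. For $\psi\in L^\infty(\mathbb{T})$, the Toeplitz operator $T_\psi:H^2\to H^2$ is $T_\psi g:=P_+(\psi g)$, where $P_+:L^2(\mathbb{T})\to H^2$ is the orthogonal projection. For $b\in H^\infty$ with $\|b\|_{H^\infty}\le1$, the de Branges--Rovnyak space $\mathcal{H}(b)$ is the image of $H^2$ under $(I-T_bT_{\overline b})^{1/2}$, with the norm making this operator a partial isometry of $H^2$ onto $\mathcal{H}(b)$: $\|(I-T_bT_{\overline b})^{1/2}g\|_{\mathcal{H}(b)}:=\|g\|_{H^2}$ for $g\in H^2\ominus\ker(I-T_bT_{\overline b})^{1/2}$. The function $b$ in the claim is a non-extreme point of the closed unit ball of $H^\infty$ (i.e. $\log(1-|b|^2)\in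 L^1(\mathbb{T})$), and for non-extreme $b$ the space $\mathcal{H}(b)$ contains all polynomials. Notation: if $f(z)=\sum_{k\ge0}\hat f(k)z^k$, then $s_n(f)(z):=\sum_{k=0}^n\hat f(k)z^k$ and $\sigma_n(f):=\frac1{n+1}\sum_{k=0}^ns_k(f)$. The Blaschke product is $B(z)=\prod_{n\ge1}\frac{w_n-z}{1-w_nz}$. *)

theory Defs
  imports "HOL-Complex_Analysis.Complex_Analysis" "HOL-Library.Nonpos_Ints"
begin

section \<open>The Hardy space on the disk\<close>

definition taylor_coeff :: "(complex \<Rightarrow> complex) \<Rightarrow> nat \<Rightarrow> complex" where
  "taylor_coeff f n = fps_nth (fps_expansion f 0) n"

text \<open>
  An element of \<open>H2\<close> is a function on the unit disk. It is represented by its extension by zero to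
  all of \<open>complex\<close>, so that equality of elements of \<open>H2\<close> is equality of functions.
\<close>

definition H2 :: "(complex \<Rightarrow> complex) set" where
  "H2 = {f. f holomorphic_on ball 0 1 \<and> (\<forall>z. z \<notin> ball 0 1 \<longrightarrow> f z = 0) \<and>
            summable (\<lambda>n. (norm (taylor_coeff f n))\<^sup>2)}"

definition H2_inner :: "(complex \<Rightarrow> complex) \<Rightarrow> (complex \<Rightarrow> complex) \<Rightarrow> complex" where
  "H2_inner f g = (\<Sum>n. taylor_coeff f n * cnj (taylor_coeff g n))"

definition H2_norm :: "(complex \<Rightarrow> complex) \<Rightarrow> real" where
  "H2_norm f = sqrt (\<Sum>n. (norm (taylor_coeff f n))\<^sup>2)"


section \<open>The space L2 of the circle, boundary functions and Toeplitz operators\<close>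

definition circle_measure :: "complex measure" where
  "circle_measure =
     distr (uniform_measure lborel {0..2 * pi}) (restrict_space borel (sphere 0 1)) cis"

text \<open>The members of \<open>L2_circle\<close> are representatives of the usual classes modulo null sets.\<close>

definition L2_circle :: "(complex \<Rightarrow> complex) set" where
  "L2_circle = {F \<in> borel_measurable circle_measure.
                  integrable circle_measure (\<lambda>\<zeta>. (norm (F \<zeta>))\<^sup>2)}"

definition L2_inner :: "(complex \<Rightarrow> complex) \<Rightarrow> (complex \<Rightarrow> complex) \<Rightarrow> complex" where
  "L2_inner F G = (LINT \<zeta>|circle_measure. F \<zeta> * cnj (G \<zeta>))"

text \<open>
  The boundary function of \<open>g\<close>: the limit in L2 of the dilates \<open>\<zeta> \<mapsto> g (r \<zeta>)\<close> as \<open>r\<close> increases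
  to 1. For \<open>g\<close> in H2 (in particular for bounded holomorphic \<open>g\<close>) it exists and is unique up to
  null sets; only the values of \<open>g\<close> in the disk matter. This is the usual embedding of H2 as a
  closed subspace of L2.
\<close>

definition boundary_fun :: "(complex \<Rightarrow> complex) \<Rightarrow> complex \<Rightarrow> complex" where
  "boundary_fun g = (SOME G. G \<in> L2_circle \<and>
     ((\<lambda>r::real. LINT \<zeta>|circle_measure. (norm (g (of_real r * \<zeta>) - G \<zeta>))\<^sup>2) \<longlongrightarrow> 0) (at_left 1))"

text \<open>The orthogonal projection of L2 onto the embedded copy of H2.\<close>

definition P_plus :: "(complex \<Rightarrow> complex) \<Rightarrow> complex \<Rightarrow> complex" where
  "P_plus F = (THE h. h \<in> H2 \<and>
     (\<forall>k\<in>H2. L2_inner (\<lambda>\<zeta>. F \<zeta> - boundary_fun h \<zeta>) (boundary_fun k) = 0))"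

definition toeplitz :: "(complex \<Rightarrow> complex) \<Rightarrow> (complex \<Rightarrow> complex) \<Rightarrow> complex \<Rightarrow> complex" where
  "toeplitz \<psi> g = P_plus (\<lambda>\<zeta>. \<psi> \<zeta> * boundary_fun g \<zeta>)"


section \<open>De Branges--Rovnyak spaces\<close>

definition is_positive_sqrt ::
  "((complex \<Rightarrow> complex) \<Rightarrow> complex \<Rightarrow> complex) \<Rightarrow>
   ((complex \<Rightarrow> complex) \<Rightarrow> complex \<Rightarrow> complex) \<Rightarrow> bool" where
  "is_positive_sqrt A S \<longleftrightarrow>
     (\<forall>g\<in>H2. S g \<in> H2) \<and>
     (\<forall>g\<in>H2. \<forall>h\<in>H2. \<forall>c d. S (\<lambda>z. c * g z + d * h z) = (\<lambda>z. c * S g z + d * S h z)) \<and>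
     (\<exists>C. \<forall>g\<in>H2. H2_norm (S g) \<le> C * H2_norm g) \<and>
     (\<forall>g\<in>H2. H2_inner (S g) g \<in> \<real>\<^sub>\<ge>\<^sub>0) \<and>
     (\<forall>g\<in>H2. S (S g) = A g)"

text \<open>
  A positive bounded operator on H2 has exactly one positive square root, so the choice below is
  unique on \<open>H2\<close>; outside \<open>H2\<close> it is arbitrary and never used.
\<close>

definition positive_sqrt ::
  "((complex \<Rightarrow> complex) \<Rightarrow> complex \<Rightarrow> complex) \<Rightarrow>
   (complex \<Rightarrow> complex) \<Rightarrow> complex \<Rightarrow> complex" where
  "positive_sqrt A = (SOME S. is_positive_sqrt A S)"

definition dBR_op :: "(complex \<Rightarrow> complex) \<Rightarrow> (complex \<Rightarrow> complex) \<Rightarrow> complex \<Rightarrow> complex" where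
  "dBR_op b = positive_sqrt
     (\<lambda>g z. g z - toeplitz (boundary_fun b) (toeplitz (\<lambda>\<zeta>. cnj (boundary_fun b \<zeta>)) g) z)"

definition dBR_space :: "(complex \<Rightarrow> complex) \<Rightarrow> (complex \<Rightarrow> complex) set" where
  "dBR_space b = dBR_op b ` H2"

text \<open>
  The norm making \<open>dBR_op b\<close> a partial isometry of \<open>H2\<close> onto \<open>dBR_space b\<close>; it is meaningful
  only at members of \<open>dBR_space b\<close>.
\<close>

definition dBR_norm :: "(complex \<Rightarrow> complex) \<Rightarrow> (complex \<Rightarrow> complex) \<Rightarrow> real" where
  "dBR_norm b f = (THE r. \<exists>g\<in>H2.
     (\<forall>k\<in>H2. dBR_op b k = (\<lambda>z. 0) \<longrightarrow> H2_inner g k = 0) \<and> dBR_op b g = f \<and> r = H2_norm g)"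


section \<open>Taylor partial sums and their Cesaro means\<close>

text \<open>As for \<open>H2\<close>, these polynomials are regarded as functions on the disk, extended by zero.\<close>

definition partial_sum :: "nat \<Rightarrow> (complex \<Rightarrow> complex) \<Rightarrow> complex \<Rightarrow> complex" where
  "partial_sum n f z = (if z \<in> ball 0 1 then \<Sum>k\<le>n. taylor_coeff f k * z ^ k else 0)"

definition cesaro_mean :: "nat \<Rightarrow> (complex \<Rightarrow> complex) \<Rightarrow> complex \<Rightarrow> complex" where
  "cesaro_mean n f z = (\<Sum>k\<le>n. partial_sum k f z) / of_nat (n + 1)"

end

theory Submission
  imports Defs
begin

text \<open>
  The Taylor coefficients of \<open>f\<close> are of size \<open>k powr (- 1/2)\<close>, so \<open>f\<close> does not belong to \<open>H2\<close>, and
  the \<open>H2\<close> norms of the partial sums and of their Cesaro means tend to infinity. They are dominated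
  by the norms in the de Branges--Rovnyak space, because the operator \<open>S\<close> with
  \<open>S\<^sup>2 = I - T\<^sub>b T\<^sub>b\<^sup>*\<close> is a contraction.

  For this one needs that polynomials lie in the space at all. A polynomial \<open>p\<close> is in the range of
  \<open>S\<close> if \<open>\<bar>\<langle>g, p\<rangle>\<bar>\<^sup>2\<close> is at most a constant times \<open>\<parallel>g\<parallel>\<^sup>2 - \<parallel>T\<^sub>b\<^sup>* g\<parallel>\<^sup>2\<close>. As \<open>B\<^sup>2\<close> is
  bounded by 1, one may replace \<open>b\<close> by \<open>b\<^sub>0\<close>, and then the defect is computed explicitly: with
  \<open>y = T\<^sub>c\<^sup>* g\<close> for \<open>c z = 1 / (1 - \<tau>\<^sup>2 z)\<close> and the backward shift \<open>L\<close> it is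
  \<open>\<tau>\<^sup>2 \<parallel>y - L y\<parallel>\<^sup>2 + \<tau> \<bar>y\<^sub>0\<bar>\<^sup>2\<close>, which controls every Taylor coefficient of \<open>g = y - \<tau>\<^sup>2 L y\<close>.
\<close>

text \<open>The norm is a definite description and says nothing outside the range of
  \<open>S\<close>: a polynomial outside the space would not count as having infinite norm, so
  membership must precede any lower bound. The constant \<open>\<tau>\<close> is made for this. By
  \<open>\<tau>^2 + \<tau> = 1\<close>, one has
  \<open>|1 - \<tau>^2 z|^2 - |\<tau> z|^2 = \<tau>^2 |1 - z|^2\<close> on the unit circle, so the
  Pythagorean mate of \<open>b0\<close> is \<open>\<tau> (1 - z) / (1 - \<tau>^2 z)\<close>; its
  numerator is what appears as \<open>y - L y\<close> in the defect. As \<open>1 - z\<close>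
  vanishes at 1, the defect of \<open>b0\<close> does not dominate a multiple of the squared norm.
  Only single coordinates can be recovered, by starting from \<open>y_0\<close> and adding up
  increments, with constants that grow with the index; for polynomials this suffices. Toeplitz
  operators are given through boundary functions that are determined only almost everywhere. They
  are therefore transported to square-summable sequences, where real Hilbert space arguments apply
  and complex linearity becomes commutation with multiplication by the imaginary unit.\<close>

section \<open>Riesz representation, adjoints and square roots\<close>

text \<open>
  The vector \<open>h\<close> is the limit of \<open>S g\<^sub>n\<close> along a minimizing sequence of \<open>(norm (S x))\<^sup>2 - 2 * \<Lambda> x\<close>.
  The identity for \<open>S\<close> gives the Riesz representation theorem; for general symmetric \<open>S\<close> one
  gets a criterion for membership in the range of \<open>S\<close>, even if this range is not closed.
\<close>

lemma riesz_range:
  fixes S :: "'a::real_vector \<Rightarrow> 'b::{real_inner,banach}" and \<Lambda> :: "'a \<Rightarrow> real"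
  assumes S: "linear S" and \<Lambda>: "linear \<Lambda>" and le: "\<And>x. \<bar>\<Lambda> x\<bar> \<le> C * norm (S x)"
  shows "\<exists>h. \<forall>x. inner (S x) h = \<Lambda> x"
proof -
  interpret S: linear S by fact
  interpret L: linear \<Lambda> by fact
  define \<Phi> where "\<Phi> x = (norm (S x))\<^sup>2 - 2 * \<Lambda> x" for x
  have lower: "- C\<^sup>2 \<le> \<Phi> x" for x
  proof -
    have "0 \<le> (norm (S x) - C)\<^sup>2" by simp
    then show ?thesis using le[of x] unfolding \<Phi>_def power2_diff by (simp add: abs_le_iff mult.commute)
  qed
  then have bdd: "bdd_below (range \<Phi>)" by (auto intro!: bdd_belowI)
  define m where "m = Inf (range \<Phi>)"
  have m: "m \<le> \<Phi> x" for x unfolding m_def by (rule cInf_lower) (use bdd in auto)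
  have "\<exists>x. \<Phi> x < m + inverse (real (Suc n))" for n
  proof -
    have "Inf (range \<Phi>) < m + inverse (real (Suc n))" unfolding m_def by simp
    from cInf_lessD[OF _ this] show ?thesis by auto
  qed
  then obtain g where g: "\<And>n. \<Phi> (g n) < m + inverse (real (Suc n))" by metis
  \<comment> \<open>The parallelogram law, with \<open>\<Lambda>\<close> cancelling at the midpoint.
    It makes the images \<open>S (g n)\<close> Cauchy although \<open>g n\<close> itself need not
    converge.\<close>
  have par: "(norm (S x - S y))\<^sup>2 = 2 * \<Phi> x + 2 * \<Phi> y - 4 * \<Phi> ((1/2) *\<^sub>R (x + y))" for x y
    by (simp add: \<Phi>_def S.add S.scaleR L.add L.scaleR power_mult_distrib power2_norm_eq_inner
        inner_add_left inner_add_right inner_diff_left inner_diff_right inner_commute algebra_simps)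
  have dist: "(norm (S (g i) - S (g j)))\<^sup>2 \<le> 2 * inverse (real (Suc i)) + 2 * inverse (real (Suc j))" for i j
    using par[of "g i" "g j"] g[of i] g[of j] m[of "(1/2) *\<^sub>R (g i + g j)"] by linarith
  have "Cauchy (\<lambda>n. S (g n))"
  proof (rule metric_CauchyI)
    fix e :: real assume e: "0 < e"
    obtain M where M: "inverse (real (Suc M)) < e\<^sup>2 / 4"
      using reals_Archimedean[of "e\<^sup>2 / 4"] e by auto
    show "\<exists>M. \<forall>i\<ge>M. \<forall>j\<ge>M. dist (S (g i)) (S (g j)) < e"
    proof (intro exI allI impI)
      fix i j assume ij: "M \<le> i" "M \<le> j"
      have "inverse (real (Suc i)) \<le> inverse (real (Suc M))" "inverse (real (Suc j)) \<le> inverse (real (Suc M))"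
        using ij by (auto intro!: le_imp_inverse_le)
      then have "(norm (S (g i) - S (g j)))\<^sup>2 < e\<^sup>2" using dist[of i j] M by linarith
      then show "dist (S (g i)) (S (g j)) < e"
        using e by (simp add: dist_norm power_less_imp_less_base)
    qed
  qed
  then obtain h where h: "(\<lambda>n. S (g n)) \<longlonglongrightarrow> h"
    using Cauchy_convergent_iff convergent_def by blast
  \<comment> \<open>First variation: the infimum need not be attained, so \<open>g n + t x\<close>
    is compared with \<open>m\<close> up to \<open>1 / (n + 1)\<close> before the limit in
    \<open>n\<close> is taken.\<close>
  have var: "0 \<le> t * (2 * (inner h (S x) - \<Lambda> x)) + t\<^sup>2 * (norm (S x))\<^sup>2" for t x
  proof -
    have nn: "0 \<le> inverse (real (Suc n)) + (t * (2 * (inner (S (g n)) (S x) - \<Lambda> x)) + t\<^sup>2 * (norm (S x))\<^sup>2)" for n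
    proof -
      have "\<Phi> (g n + t *\<^sub>R x) = \<Phi> (g n) + (t * (2 * (inner (S (g n)) (S x) - \<Lambda> x)) + t\<^sup>2 * (norm (S x))\<^sup>2)"
        by (simp add: \<Phi>_def S.add S.scaleR L.add L.scaleR power_mult_distrib power2_norm_eq_inner power2_eq_square[of t]
        inner_add_left inner_add_right inner_diff_left inner_diff_right inner_commute algebra_simps)
      then show ?thesis using g[of n] m[of "g n + t *\<^sub>R x"] by linarith
    qed
    have "(\<lambda>n. inverse (real (Suc n)) + (t * (2 * (inner (S (g n)) (S x) - \<Lambda> x)) + t\<^sup>2 * (norm (S x))\<^sup>2))
        \<longlonglongrightarrow> 0 + (t * (2 * (inner h (S x) - \<Lambda> x)) + t\<^sup>2 * (norm (S x))\<^sup>2)"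
      by (intro tendsto_intros h LIMSEQ_inverse_real_of_nat)
    from LIMSEQ_le_const[OF this, of 0] nn show ?thesis by auto
  qed
  have "inner (S x) h = \<Lambda> x" for x
  proof (rule ccontr)
    define a where "a = inner h (S x) - \<Lambda> x"
    assume "inner (S x) h \<noteq> \<Lambda> x"
    then have a: "a \<noteq> 0" by (simp add: a_def inner_commute)
    \<comment> \<open>The choice \<open>t = - a / q\<close> nearly minimizes the quadratic; the
      summand 1 keeps \<open>q\<close> positive when \<open>S x = 0\<close>.\<close>
    define q where "q = (norm (S x))\<^sup>2 + 1"
    have q: "q > 0" "(norm (S x))\<^sup>2 < q" by (auto simp: q_def add_nonneg_pos)
    have "0 \<le> (- a / q) * (2 * a) + (- a / q)\<^sup>2 * (norm (S x))\<^sup>2" using var[of "- a / q" x] by (simp add: a_def)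
    also have "\<dots> \<le> (- a / q) * (2 * a) + (- a / q)\<^sup>2 * q" using q by (intro add_left_mono mult_left_mono) auto
    also have "\<dots> = - a\<^sup>2 / q" using q by (simp add: power2_eq_square field_simps)
    also have "\<dots> < 0" using a q by simp
    finally show False by simp
  qed
  then show ?thesis by blast
qed

text \<open>Riesz representation, with the identity as \<open>S\<close>, of the functionals
  \<open>x \<mapsto> inner (V x) y\<close>. The bound on \<open>W\<close> follows from
  \<open>norm (W y)^2 = inner (V (W y)) y\<close>.\<close>

lemma adjoint_exists:
  fixes V :: "'a::{real_inner,banach} \<Rightarrow> 'b::real_inner"
  assumes V: "bounded_linear V"
  shows "\<exists>W. bounded_linear W \<and> (\<forall>x y. inner (V x) y = inner x (W y))"
proof -
  interpret V: bounded_linear V by fact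
  obtain K where K: "\<And>x. norm (V x) \<le> norm x * K" and K0: "K \<ge> 0" using V.nonneg_bounded by blast
  have "\<exists>h. \<forall>x. inner x h = inner (V x) y" for y
  proof (rule riesz_range[of "\<lambda>x. x" "\<lambda>x. inner (V x) y" "K * norm y"])
    show "linear (\<lambda>x. inner (V x) y)"
      by (rule linearI) (simp_all add: V.add V.scaleR inner_add_left)
    show "\<bar>inner (V x) y\<bar> \<le> K * norm y * norm x" for x
      using Cauchy_Schwarz_ineq2[of "V x" y] mult_right_mono[OF K[of x] norm_ge_zero[of y]]
      by (simp add: mult_ac)
  qed (simp add: linear_id[unfolded id_def])
  then obtain W where W: "\<And>x y. inner x (W y) = inner (V x) y" by metis
  have "norm (W y) \<le> norm y * K" for y
  proof (cases "norm (W y) = 0")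
    case False
    have "(norm (W y))\<^sup>2 = inner (V (W y)) y" by (simp add: power2_norm_eq_inner W)
    also have "\<dots> \<le> norm (W y) * K * norm y"
      using Cauchy_Schwarz_ineq2[of "V (W y)" y] mult_right_mono[OF K[of "W y"] norm_ge_zero[of y]] by linarith
    finally show ?thesis using False by (simp add: power2_eq_square mult_ac)
  qed (use K0 in simp)
  moreover have "W (y + z) = W y + W z" for y z
    by (rule vector_eq_ldot[THEN iffD1]) (simp add: W inner_add_right)
  moreover have "W (r *\<^sub>R y) = r *\<^sub>R W y" for r y
    by (rule vector_eq_ldot[THEN iffD1]) (simp add: W)
  ultimately have "bounded_linear W" by (intro bounded_linear_intro[where K=K])
  then show ?thesis using W by metis
qed

text \<open>
  The Taylor coefficients of \<open>sqrt (1 - x)\<close>. Their partial sums are nonnegative and all but the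
  first are nonpositive, so the series converges absolutely at 1 and can be evaluated at a
  contraction.
\<close>

definition sqrt_coeff :: "nat \<Rightarrow> real" where
  "sqrt_coeff k = (- 1) ^ k * ((1 / 2) gchoose k)"

lemma sqrt_coeff_0 [simp]: "sqrt_coeff 0 = 1"
  by (simp add: sqrt_coeff_def)

lemma sqrt_coeff_Suc: "sqrt_coeff (Suc k) = sqrt_coeff k * ((real k - 1/2) / (real k + 1))"
proof -
  have "((1 / 2) gchoose Suc k) = ((1 / 2) gchoose k) * ((1 / 2 - real k) / (real k + 1))"
    using gbinomial_mult_1[of "1/2::real" k] by (simp add: divide_simps) (simp add: algebra_simps)
  then show ?thesis by (simp add: sqrt_coeff_def minus_divide_left mult.assoc flip: mult_minus_right)
qed

text \<open>The factor \<open>(k - 1/2) / (k + 1)\<close> of the recursion is negative for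
  \<open>k = 0\<close> only, so the sign changes just once, right after the leading coefficient
  1.\<close>

lemma sqrt_coeff_nonpos: "sqrt_coeff (Suc k) \<le> 0"
proof (induction k)
  case (Suc k)
  have "0 \<le> (real (Suc k) - 1/2) / (real (Suc k) + 1)" by (simp add: field_simps)
  then show ?case using Suc by (subst sqrt_coeff_Suc) (rule mult_nonpos_nonneg)
qed (simp add: sqrt_coeff_Suc)

text \<open>Summing coefficients means dividing the series by \<open>1 - x\<close>: the partial sums
  are the coefficients of \<open>(1 - x) powr (- 1/2)\<close>, which are nonnegative.\<close>

lemma sum_sqrt_coeff_nonneg: "0 \<le> (\<Sum>k\<le>n. sqrt_coeff k)"
proof -
  have "(\<Sum>k\<le>n. sqrt_coeff k) = (- 1) ^ n * ((- 1 / 2) gchoose n)"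
    using gbinomial_sum_lower_neg[of "1/2::real" n] by (simp add: sqrt_coeff_def mult.commute)
  also have "\<dots> = pochhammer (1 / 2) n / fact n"
    by (simp add: gbinomial_pochhammer power_mult_distrib[symmetric] flip: mult.assoc power_add)
  also have "\<dots> \<ge> 0" by (intro divide_nonneg_nonneg pochhammer_nonneg) auto
  finally show ?thesis .
qed

text \<open>The leading 1 outweighs all later terms, which share one sign. The exact bound 1, beyond
  mere summability, is what makes the root positive.\<close>

lemma sum_abs_sqrt_coeff: "(\<Sum>k<n. \<bar>sqrt_coeff (Suc k)\<bar>) \<le> 1"
proof -
  have "(\<Sum>k\<le>n. sqrt_coeff k) = 1 + (\<Sum>k<n. sqrt_coeff (Suc k))"
    by (simp add: sum.atMost_shift)
  moreover have "(\<Sum>k<n. \<bar>sqrt_coeff (Suc k)\<bar>) = - (\<Sum>k<n. sqrt_coeff (Suc k))"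
    using sqrt_coeff_nonpos by (simp add: sum_negf[symmetric] abs_of_nonpos)
  ultimately show ?thesis using sum_sqrt_coeff_nonneg[of n] by simp
qed

lemma summable_abs_sqrt_coeff: "summable (\<lambda>k. \<bar>sqrt_coeff k\<bar>)"
proof -
  have "summable (\<lambda>k. \<bar>sqrt_coeff (Suc k)\<bar>)"
    by (rule bounded_imp_summable[where B=1])
      (use sum_abs_sqrt_coeff[of "Suc _"] in \<open>auto simp: lessThan_Suc_atMost\<close>)
  then show ?thesis by (subst (asm) summable_Suc_iff)
qed

text \<open>The Cauchy square of the series of \<open>sqrt (1 - x)\<close> is \<open>1 - x\<close>:
  Vandermonde's identity with \<open>1/2 + 1/2 = 1\<close>.\<close>

lemma sqrt_coeff_convolution:
  "(\<Sum>i\<le>n. sqrt_coeff i * sqrt_coeff (n - i)) = (if n = 0 then 1 else if n = 1 then - 1 else 0)"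
proof -
  have "(\<Sum>i\<le>n. sqrt_coeff i * sqrt_coeff (n - i)) =
      (- 1) ^ n * (\<Sum>i\<le>n. ((1 / 2) gchoose i) * ((1 / 2) gchoose (n - i)))"
    unfolding sum_distrib_left sqrt_coeff_def
    by (intro sum.cong) (auto simp: mult_ac simp flip: power_add)
  also have "\<dots> = (- 1) ^ n * (1 gchoose n)"
    using gbinomial_Vandermonde[of "1/2::real" "1/2" n] by (simp add: atLeast0AtMost)
  also have "\<dots> = (if n = 0 then 1 else if n = 1 then - 1 else 0)"
    using binomial_gbinomial[of 1 n, where 'a=real] by (cases "n \<le> 1") (auto simp: le_Suc_eq binomial_eq_0)
  finally show ?thesis .
qed

text \<open>
  The last clause, applied to the multiplication by \<open>\<i>\<close>, makes the root of a complex linear operator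
  complex linear.
\<close>

lemma positive_sqrt_exists:
  fixes T :: "'a::{real_inner,banach} \<Rightarrow> 'a"
  assumes T: "bounded_linear T" and contr: "\<And>x. norm (T x) \<le> norm x"
    and symm: "\<And>x y. inner (T x) y = inner x (T y)"
  obtains S where "bounded_linear S" "\<And>x. S (S x) = x - T x" "\<And>x. 0 \<le> inner (S x) x"
    "\<And>x y. inner (S x) y = inner x (S y)"
    "\<And>R x. bounded_linear R \<Longrightarrow> \<forall>x. R (T x) = T (R x) \<Longrightarrow> R (S x) = S (R x)"
proof -
  interpret T: bounded_linear T by fact
  define P where "P k x = (T ^^ k) x" for k x
  have P0: "P 0 x = x" and PS: "P (Suc k) x = T (P k x)" for k x by (auto simp: P_def)
  have PP: "P j (P k x) = P (j + k) x" for j k x by (simp add: P_def funpow_add)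
  have Pn: "norm (P k x) \<le> norm x" for k x
    by (induction k) (auto simp: P0 PS intro: order_trans contr)
  have Padd: "P k (x + y) = P k x + P k y" and Psc: "P k (c *\<^sub>R x) = c *\<^sub>R P k x" for k x y c
    by (induction k) (auto simp: P0 PS T.add T.scaleR)
  have Pbl: "bounded_linear (P k)" for k
    by (rule bounded_linear_intro[where K=1]) (auto simp: Padd Psc Pn)
  have Psym: "inner (P k x) y = inner x (P k y)" for k x y
  proof (induction k arbitrary: x y)
    case (Suc k)
    have "P k (T y) = T (P k y)" by (simp add: P_def funpow_swap1)
    then show ?case by (simp add: PS symm Suc)
  qed (simp add: P0)
  define D where "D = (\<Sum>k. \<bar>sqrt_coeff k\<bar>)"
  have sumn: "summable (\<lambda>k. norm (sqrt_coeff k *\<^sub>R P k x))" for x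
  proof (rule summable_comparison_test')
    show "summable (\<lambda>k. \<bar>sqrt_coeff k\<bar> * norm x)" by (intro summable_mult2 summable_abs_sqrt_coeff)
  qed (auto intro!: mult_left_mono Pn)
  then have sumP: "summable (\<lambda>k. sqrt_coeff k *\<^sub>R P k x)" for x by (rule summable_norm_cancel)
  define S where "S x = (\<Sum>k. sqrt_coeff k *\<^sub>R P k x)" for x
  have Sbl: "bounded_linear S"
  proof (rule bounded_linear_intro[where K=D])
    show "S (x + y) = S x + S y" for x y
      by (simp add: S_def Padd scaleR_add_right suminf_add sumP)
    show "S (r *\<^sub>R x) = r *\<^sub>R S x" for r x
    proof -
      have "S (r *\<^sub>R x) = (\<Sum>k. r *\<^sub>R (sqrt_coeff k *\<^sub>R P k x))"
        unfolding S_def Psc by (simp add: mult.commute)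
      also have "\<dots> = r *\<^sub>R S x" unfolding S_def by (rule suminf_scaleR_right[symmetric]) (rule sumP)
      finally show ?thesis .
    qed
    show "norm (S x) \<le> norm x * D" for x
    proof -
      have "norm (S x) \<le> (\<Sum>k. norm (sqrt_coeff k *\<^sub>R P k x))" unfolding S_def by (rule summable_norm) (rule sumn)
      also have "\<dots> \<le> (\<Sum>k. \<bar>sqrt_coeff k\<bar> * norm x)"
        by (rule suminf_le) (auto intro!: mult_left_mono Pn sumn[simplified] summable_mult2 summable_abs_sqrt_coeff)
      also have "\<dots> = norm x * D" unfolding D_def using suminf_mult2[OF summable_abs_sqrt_coeff, of "norm x"] by (simp add: mult.commute)
      finally show ?thesis .
    qed
  qed
  interpret S: bounded_linear S by fact
  have comm: "R (S x) = S (R x)" if R: "bounded_linear R" and RT: "\<forall>x. R (T x) = T (R x)" for R x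
  proof -
    interpret R: bounded_linear R by fact
    have "R (P k x) = P k (R x)" for k by (induction k) (auto simp: P0 PS RT)
    then show ?thesis unfolding S_def by (subst R.suminf[OF sumP]) (simp add: R.scaleR)
  qed
  have Ssym: "inner (S x) y = inner x (S y)" for x y
  proof -
    have "inner (S x) y = (\<Sum>k. inner (sqrt_coeff k *\<^sub>R P k x) y)"
      unfolding S_def by (rule bounded_linear.suminf[OF bounded_linear_inner_left sumP])
    also have "\<dots> = (\<Sum>k. inner x (sqrt_coeff k *\<^sub>R P k y))" by (simp add: Psym)
    also have "\<dots> = inner x (S y)"
      unfolding S_def by (rule bounded_linear.suminf[OF bounded_linear_inner_right sumP, symmetric])
    finally show ?thesis .
  qed
  \<comment> \<open>The term \<open>k = 0\<close> equals the squared norm of \<open>x\<close>; the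
    others add up to at most that in modulus, by \<open>sum_abs_sqrt_coeff\<close> and
    contractivity.\<close>
  have Spos: "0 \<le> inner (S x) x" for x
  proof -
    have s: "(\<lambda>k. sqrt_coeff k * inner (P k x) x) sums inner (S x) x"
      using bounded_linear.sums[OF bounded_linear_inner_left summable_sums[OF sumP]]
      by (simp add: S_def)
    have "0 \<le> (\<Sum>k<Suc n. sqrt_coeff k * inner (P k x) x)" for n
    proof -
      have "\<bar>\<Sum>k<n. sqrt_coeff (Suc k) * inner (P (Suc k) x) x\<bar> \<le> (\<Sum>k<n. \<bar>sqrt_coeff (Suc k)\<bar> * (norm x)\<^sup>2)"
      proof (rule order_trans[OF sum_abs sum_mono])
        fix k
        have "\<bar>inner (P (Suc k) x) x\<bar> \<le> norm x * norm x"
          using Cauchy_Schwarz_ineq2[of "P (Suc k) x" x] mult_right_mono[OF Pn[of "Suc k" x] norm_ge_zero[of x]]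
          by linarith
        then show "\<bar>sqrt_coeff (Suc k) * inner (P (Suc k) x) x\<bar> \<le> \<bar>sqrt_coeff (Suc k)\<bar> * (norm x)\<^sup>2"
          by (simp add: abs_mult power2_eq_square mult_left_mono)
      qed
      also have "\<dots> \<le> (norm x)\<^sup>2"
        using mult_right_mono[OF sum_abs_sqrt_coeff[of n], of "(norm x)\<^sup>2"] by (simp add: sum_distrib_right)
      finally show ?thesis by (simp add: sum.lessThan_Suc_shift P0 power2_norm_eq_inner del: sum.lessThan_Suc)
    qed
    moreover have "(\<lambda>n. \<Sum>k<Suc n. sqrt_coeff k * inner (P k x) x) \<longlonglongrightarrow> inner (S x) x"
      using s unfolding sums_def by (rule LIMSEQ_Suc)
    ultimately show ?thesis by (rule LIMSEQ_le_const[OF _ exI, OF _ allI, OF _ impI, rotated])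
  qed
  have SS: "S (S x) = x - T x" for x
  proof -
    \<comment> \<open>The double series converges absolutely. Summed by rows it is
      \<open>S (S x)\<close>; along the antidiagonals \<open>j + k = n\<close> it collapses by
      \<open>sqrt_coeff_convolution\<close> to \<open>x - T x\<close>.\<close>
    define a where "a p = (case p of (j, k) \<Rightarrow> (sqrt_coeff j * sqrt_coeff k) *\<^sub>R P (j + k) x)" for p
    have sc: "(\<lambda>k. norm (sqrt_coeff k)) summable_on UNIV"
      using summable_abs_sqrt_coeff by (simp add: summable_on_UNIV_nonneg_real_iff)
    have "(\<lambda>p. norm (case p of (j, k) \<Rightarrow> sqrt_coeff j * sqrt_coeff k * norm x)) summable_on (SIGMA j:UNIV. UNIV)"
    proof (rule Infinite_Sum.abs_summable_on_Sigma_iff[THEN iffD2], intro conjI ballI)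
      show "(\<lambda>k. norm (case (j, k) of (j, k) \<Rightarrow> sqrt_coeff j * sqrt_coeff k * norm x)) summable_on UNIV" for j
        using summable_on_cmult_right[OF sc, of "\<bar>sqrt_coeff j\<bar> * norm x"] by (simp add: abs_mult mult_ac)
      have "(\<Sum>\<^sub>\<infinity>k. norm (case (j, k) of (j, k) \<Rightarrow> sqrt_coeff j * sqrt_coeff k * norm x))
          = (norm x * (\<Sum>\<^sub>\<infinity>k. \<bar>sqrt_coeff k\<bar>)) * \<bar>sqrt_coeff j\<bar>" for j
        using infsum_cmult_right'[of "\<bar>sqrt_coeff j\<bar> * norm x" "\<lambda>k. \<bar>sqrt_coeff k\<bar>" UNIV]
        by (simp add: abs_mult mult_ac)
      then show "(\<lambda>j. norm (\<Sum>\<^sub>\<infinity>k. norm (case (j, k) of (j, k) \<Rightarrow> sqrt_coeff j * sqrt_coeff k * norm x))) summable_on UNIV"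
        using summable_on_cmult_right[OF sc, of "\<bar>norm x * (\<Sum>\<^sub>\<infinity>k. \<bar>sqrt_coeff k\<bar>)\<bar>"] by (simp add: abs_mult)
    qed
    then have "(\<lambda>p. norm (a p)) summable_on UNIV \<times> UNIV"
      by (rule Infinite_Sum.abs_summable_on_comparison_test)
        (auto simp: a_def abs_mult intro!: mult_left_mono Pn)
    then obtain s where s: "(a has_sum s) (UNIV \<times> UNIV)"
      using Infinite_Sum.abs_summable_summable summable_on_def by blast
    have "((\<lambda>k. a (j, k)) has_sum sqrt_coeff j *\<^sub>R P j (S x)) UNIV" for j
    proof -
      interpret Pj: bounded_linear "P j" by (rule Pbl)
      have "((\<lambda>k. sqrt_coeff k *\<^sub>R P k x) has_sum S x) UNIV"
        unfolding S_def by (intro norm_summable_imp_has_sum sumn summable_sums sumP)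
      from has_sum_bounded_linear[OF bounded_linear_compose[OF bounded_linear_scaleR_right[of "sqrt_coeff j"] Pbl[of j]] this]
      show ?thesis by (simp add: o_def a_def Pj.scaleR PP)
    qed
    from has_sum_SigmaD[OF s this] have "((\<lambda>j. sqrt_coeff j *\<^sub>R P j (S x)) has_sum s) UNIV" .
    moreover have "((\<lambda>j. sqrt_coeff j *\<^sub>R P j (S x)) has_sum S (S x)) UNIV"
      unfolding S_def[of "S x"] by (intro norm_summable_imp_has_sum sumn summable_sums sumP)
    ultimately have sS: "s = S (S x)" by (rule has_sum_unique)
    have "bij_betw (\<lambda>(n, i). (i, n - i)) (SIGMA n:UNIV. {..n}) (UNIV \<times> UNIV :: (nat \<times> nat) set)"
      by (rule bij_betwI[where g="\<lambda>(j, k). (j + k, j)"]) auto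
    from has_sum_reindex_bij_betw[OF this, of a s] s
    have s': "((\<lambda>p. a (case p of (n, i) \<Rightarrow> (i, n - i))) has_sum s) (SIGMA n:UNIV. {..n})"
      by blast
    have "((\<lambda>n. \<Sum>i\<le>n. a (i, n - i)) has_sum s) UNIV"
      by (rule has_sum_SigmaD[OF s']) (simp add: has_sum_finite)
    moreover have "(\<Sum>i\<le>n. a (i, n - i)) = (if n = 0 then 1 else if n = 1 then - 1 else 0) *\<^sub>R P n x" for n
      unfolding sqrt_coeff_convolution[symmetric] by (simp add: a_def scaleR_sum_left)
    ultimately have "((\<lambda>n. (if n = 0 then 1 else if n = 1 then - 1 else 0) *\<^sub>R P n x) has_sum s) UNIV"
      by (simp only:)
    moreover have "((\<lambda>n. (if n = 0 then 1 else if n = 1 then - 1 else 0) *\<^sub>R P n x) has_sum x - T x) UNIV"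
    proof -
      have "((\<lambda>n. (if n = 0 then 1 else if n = 1 then - 1 else 0) *\<^sub>R P n x) has_sum x - T x) {0,1}"
        by (rule has_sum_finiteI) (auto simp: P_def)
      moreover have "?this \<longleftrightarrow> ?thesis"
        by (rule has_sum_cong_neutral) auto
      ultimately show ?thesis by blast
    qed
    ultimately have "s = x - T x" by (rule has_sum_unique)
    with sS show ?thesis by simp
  qed
  show ?thesis
    by (rule that[OF Sbl SS Spos Ssym comm])
qed

section \<open>The Hilbert space of square-summable sequences\<close>

text \<open>\<open>H2\<close> is a mere set of functions, while \<open>real_inner\<close> and
  \<open>banach\<close> are classes of types. Coefficient sequences provide the type on which the
  operators live; \<open>hfun\<close> leads back to functions.\<close>

typedef ell2 = "{x :: nat \<Rightarrow> complex. summable (\<lambda>n. (norm (x n))\<^sup>2)}"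
  morphisms coord Abs_ell2
  by (rule exI[of _ "\<lambda>_. 0"]) simp

setup_lifting type_definition_ell2

lemma summable_coord: "summable (\<lambda>n. (norm (coord x n))\<^sup>2)"
  using coord[of x] by simp

lemma summable_norm_mult_l2:
  fixes x y :: "nat \<Rightarrow> 'a::real_normed_algebra"
  assumes "summable (\<lambda>n. (norm (x n))\<^sup>2)" "summable (\<lambda>n. (norm (y n))\<^sup>2)"
  shows "summable (\<lambda>n. norm (x n * y n))"
proof (rule summable_comparison_test')
  show "summable (\<lambda>n. (norm (x n))\<^sup>2 + (norm (y n))\<^sup>2)" using assms by (rule summable_add)
  fix n
  have "norm (x n * y n) \<le> norm (x n) * norm (y n)" by (rule norm_mult_ineq)
  also have "\<dots> \<le> (norm (x n))\<^sup>2 + (norm (y n))\<^sup>2"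
    using sum_squares_bound[of "norm (x n)" "norm (y n)"] mult_nonneg_nonneg[OF norm_ge_zero[of "x n"] norm_ge_zero[of "y n"]]
    by linarith
  finally show "norm (norm (x n * y n)) \<le> (norm (x n))\<^sup>2 + (norm (y n))\<^sup>2" by simp
qed

lemma summable_norm_add_l2:
  fixes x y :: "nat \<Rightarrow> 'a::real_normed_vector"
  assumes "summable (\<lambda>n. (norm (x n))\<^sup>2)" "summable (\<lambda>n. (norm (y n))\<^sup>2)"
  shows "summable (\<lambda>n. (norm (x n + y n))\<^sup>2)"
proof (rule summable_comparison_test')
  show "summable (\<lambda>n. 2 * ((norm (x n))\<^sup>2 + (norm (y n))\<^sup>2))" using assms by (intro summable_mult summable_add)
  fix n
  have "(norm (x n + y n))\<^sup>2 \<le> (norm (x n) + norm (y n))\<^sup>2" by (intro power_mono norm_triangle_ineq) auto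
  also have "\<dots> \<le> 2 * ((norm (x n))\<^sup>2 + (norm (y n))\<^sup>2)"
    using sum_squares_bound[of "norm (x n)" "norm (y n)"] by (simp add: power2_sum)
  finally show "norm ((norm (x n + y n))\<^sup>2) \<le> 2 * ((norm (x n))\<^sup>2 + (norm (y n))\<^sup>2)" by simp
qed

instantiation ell2 :: real_vector
begin

lift_definition zero_ell2 :: ell2 is "\<lambda>_. 0" by simp
lift_definition plus_ell2 :: "ell2 \<Rightarrow> ell2 \<Rightarrow> ell2" is "\<lambda>x y n. x n + y n"
  by (rule summable_norm_add_l2)
lift_definition uminus_ell2 :: "ell2 \<Rightarrow> ell2" is "\<lambda>x n. - x n" by simp
definition minus_ell2 :: "ell2 \<Rightarrow> ell2 \<Rightarrow> ell2" where "minus_ell2 x y = x + - y"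
lift_definition scaleR_ell2 :: "real \<Rightarrow> ell2 \<Rightarrow> ell2" is "\<lambda>r x n. r *\<^sub>R x n"
  by (simp add: power_mult_distrib)

instance
proof
  fix x y z :: ell2 and r s :: real
  show "x + y + z = x + (y + z)" "x + y = y + x" "0 + x = x" "- x + x = 0"
    "r *\<^sub>R (x + y) = r *\<^sub>R x + r *\<^sub>R y" "(r + s) *\<^sub>R x = r *\<^sub>R x + s *\<^sub>R x"
    "r *\<^sub>R s *\<^sub>R x = (r * s) *\<^sub>R x" "1 *\<^sub>R x = x"
    by (transfer, simp add: algebra_simps fun_eq_iff; fail)+
  show "x - y = x + - y" by (rule minus_ell2_def)
qed

end

instantiation ell2 :: real_inner
begin

text \<open>Only the real part of the Hermitian product, since \<open>real_inner\<close> is about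
  real spaces. \<open>cinner\<close> restores the imaginary part.\<close>

definition inner_ell2 :: "ell2 \<Rightarrow> ell2 \<Rightarrow> real" where
  "inner_ell2 x y = (\<Sum>n. Re (coord x n * cnj (coord y n)))"
definition norm_ell2 :: "ell2 \<Rightarrow> real" where "norm_ell2 x = sqrt (inner x x)"
definition sgn_ell2 :: "ell2 \<Rightarrow> ell2" where "sgn_ell2 x = x /\<^sub>R norm x"
definition dist_ell2 :: "ell2 \<Rightarrow> ell2 \<Rightarrow> real" where "dist_ell2 x y = norm (x - y)"
definition uniformity_ell2 :: "(ell2 \<times> ell2) filter" where
  "uniformity_ell2 = (INF e\<in>{0<..}. principal {(x, y). dist x y < e})"
definition open_ell2 :: "ell2 set \<Rightarrow> bool" where
  "open_ell2 U \<longleftrightarrow> (\<forall>x\<in>U. \<forall>\<^sub>F (x', y) in uniformity. x' = x \<longrightarrow> y \<in> U)"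

lemma summable_coord_mult: "summable (\<lambda>n. coord x n * cnj (coord y n))"
  by (rule summable_norm_cancel) (intro summable_norm_mult_l2, auto simp: summable_coord)

lemma summable_Re_coord_mult: "summable (\<lambda>n. Re (coord x n * cnj (coord y n)))"
  by (intro summable_Re summable_coord_mult)

instance
proof
  fix x y z :: ell2 and r s :: real
  show "dist x y = norm (x - y)" by (rule dist_ell2_def)
  show "sgn x = x /\<^sub>R norm x" by (rule sgn_ell2_def)
  show "uniformity = (INF e\<in>{0<..}. principal {(x, y :: ell2). dist x y < e})"
    by (rule uniformity_ell2_def)
  show "open U \<longleftrightarrow> (\<forall>x\<in>U. \<forall>\<^sub>F (x', y) in uniformity. x' = x \<longrightarrow> y \<in> U)" for U :: "ell2 set"
    by (rule open_ell2_def)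
  show "inner x y = inner y x" by (simp add: inner_ell2_def mult.commute)
  show "inner (x + y) z = inner x z + inner y z"
    unfolding inner_ell2_def
    by (subst suminf_add[OF summable_Re_coord_mult summable_Re_coord_mult]) (simp add: plus_ell2.rep_eq algebra_simps)
  show "inner (r *\<^sub>R x) y = r * inner x y"
    unfolding inner_ell2_def
    by (subst suminf_mult[OF summable_Re_coord_mult, symmetric]) (simp add: scaleR_ell2.rep_eq algebra_simps)
  have sq: "Re (coord x n * cnj (coord x n)) = (norm (coord x n))\<^sup>2" for n
    by (simp add: cmod_power2) (simp add: power2_eq_square)
  show "0 \<le> inner x x" unfolding inner_ell2_def sq by (rule suminf_nonneg[OF summable_coord]) simp
  show "inner x x = 0 \<longleftrightarrow> x = 0"
    unfolding inner_ell2_def sq suminf_eq_zero_iff[OF summable_coord zero_le_power2]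
    by transfer auto
  show "norm x = sqrt (inner x x)" by (rule norm_ell2_def)
qed

end

lemma coord_zero [simp]: "coord 0 n = 0" by transfer simp
lemma coord_add [simp]: "coord (x + y) n = coord x n + coord y n" by transfer simp
lemma coord_minus [simp]: "coord (- x) n = - coord x n" by transfer simp
lemma coord_diff [simp]: "coord (x - y) n = coord x n - coord y n" unfolding minus_ell2_def coord_add coord_minus by simp
lemma coord_scaleR [simp]: "coord (r *\<^sub>R x) n = r *\<^sub>R coord x n" by transfer simp

lemma ell2_eqI: "(\<And>n. coord x n = coord y n) \<Longrightarrow> x = y"
  by (simp add: coord_inject[symmetric] fun_eq_iff)

lemma norm_ell2_sq: "(norm x)\<^sup>2 = (\<Sum>n. (norm (coord x n))\<^sup>2)"
proof -
  have "Re (coord x n * cnj (coord x n)) = (norm (coord x n))\<^sup>2" for n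
    by (simp add: cmod_power2) (simp add: power2_eq_square)
  then show ?thesis by (simp only: power2_norm_eq_inner[of x] inner_ell2_def)
qed

lemma sum_coord_le: "(\<Sum>n<N. (norm (coord x n))\<^sup>2) \<le> (norm x)\<^sup>2"
  unfolding norm_ell2_sq by (rule sum_le_suminf[OF summable_coord]) auto

lemma norm_coord_le: "norm (coord x n) \<le> norm x"
proof -
  have "(norm (coord x n))\<^sup>2 \<le> (\<Sum>k<Suc n. (norm (coord x k))\<^sup>2)"
    by (rule member_le_sum) auto
  then have "(norm (coord x n))\<^sup>2 \<le> (norm x)\<^sup>2" using sum_coord_le[of x "Suc n"] by linarith
  then show ?thesis by (rule power2_le_imp_le) simp
qed

lemma l2_of_partial_sums:
  fixes c :: "nat \<Rightarrow> complex"
  assumes "\<And>N. (\<Sum>n<N. (norm (c n))\<^sup>2) \<le> B"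
  shows "summable (\<lambda>n. (norm (c n))\<^sup>2)" "(\<Sum>n. (norm (c n))\<^sup>2) \<le> B"
proof -
  show s: "summable (\<lambda>n. (norm (c n))\<^sup>2)"
    by (rule bounded_imp_summable[where B=B]) (use assms[of "Suc _"] in \<open>auto simp: lessThan_Suc_atMost\<close>)
  show "(\<Sum>n. (norm (c n))\<^sup>2) \<le> B" by (rule suminf_le_const[OF s assms])
qed

instance ell2 :: banach
proof
  fix X :: "nat \<Rightarrow> ell2" assume X: "Cauchy X"
  have "Cauchy (\<lambda>k. coord (X k) n)" for n
  proof (rule metric_CauchyI)
    fix e :: real assume "0 < e"
    then obtain M where M: "\<And>i j. M \<le> i \<Longrightarrow> M \<le> j \<Longrightarrow> dist (X i) (X j) < e"
      using metric_CauchyD[OF X] by blast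
    have "dist (coord (X i) n) (coord (X j) n) \<le> dist (X i) (X j)" for i j
      using norm_coord_le[of "X i - X j" n] by (simp add: dist_norm)
    with M show "\<exists>M. \<forall>i\<ge>M. \<forall>j\<ge>M. dist (coord (X i) n) (coord (X j) n) < e"
      by (meson le_less_trans)
  qed
  then have "\<exists>l. (\<lambda>k. coord (X k) n) \<longlonglongrightarrow> l" for n
    using Cauchy_convergent_iff convergent_def by blast
  then obtain c where c: "\<And>n. (\<lambda>k. coord (X k) n) \<longlonglongrightarrow> c n" by metis
  \<comment> \<open>For a fixed cut-off \<open>N\<close> the limit in \<open>j\<close> is taken
    termwise; the bound does not depend on \<open>N\<close>, so it survives for the whole
    series.\<close>
  have tail: "(\<Sum>n<N. (norm (coord (X i) n - c n))\<^sup>2) \<le> e\<^sup>2"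
    if "\<And>j. M \<le> j \<Longrightarrow> dist (X i) (X j) < e" for N i M e
  proof (rule LIMSEQ_le_const2)
    show "(\<lambda>j. \<Sum>n<N. (norm (coord (X i) n - coord (X j) n))\<^sup>2) \<longlonglongrightarrow> (\<Sum>n<N. (norm (coord (X i) n - c n))\<^sup>2)"
      by (intro tendsto_intros c)
    have "(\<Sum>n<N. (norm (coord (X i) n - coord (X j) n))\<^sup>2) \<le> e\<^sup>2" if "j \<ge> M" for j
    proof -
      have "(\<Sum>n<N. (norm (coord (X i) n - coord (X j) n))\<^sup>2) \<le> (norm (X i - X j))\<^sup>2"
        using sum_coord_le[of "X i - X j" N] by simp
      also have "\<dots> \<le> e\<^sup>2" using \<open>\<And>j. M \<le> j \<Longrightarrow> dist (X i) (X j) < e\<close>[OF that]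
        by (intro power_mono) (auto simp: dist_norm)
      finally show ?thesis .
    qed
    then show "\<exists>M. \<forall>j\<ge>M. (\<Sum>n<N. (norm (coord (X i) n - coord (X j) n))\<^sup>2) \<le> e\<^sup>2" by blast
  qed
  obtain M1 where "\<And>j. M1 \<le> j \<Longrightarrow> dist (X M1) (X j) < 1"
    using metric_CauchyD[OF X, of 1] by auto
  from tail[OF this] have "summable (\<lambda>n. (norm (coord (X M1) n - c n))\<^sup>2)" by (intro l2_of_partial_sums)
  \<comment> \<open>\<open>- X M1\<close> and \<open>X M1 - c\<close> add up to
    \<open>- c\<close>.\<close>
  from summable_norm_add_l2[OF summable_coord[of "- X M1"] this] have "summable (\<lambda>n. (norm (c n))\<^sup>2)"
    by (simp only: coord_minus) simp
  then obtain x where x: "coord x = c" using Abs_ell2_inverse by blast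
  have "X \<longlonglongrightarrow> x"
  proof (rule metric_LIMSEQ_I)
    fix e :: real assume e: "0 < e"
    then obtain M where M: "\<And>i j. M \<le> i \<Longrightarrow> M \<le> j \<Longrightarrow> dist (X i) (X j) < e/2"
      using metric_CauchyD[OF X, of "e/2"] by auto
    have "dist (X i) x < e" if "M \<le> i" for i
    proof -
      have "(norm (X i - x))\<^sup>2 \<le> (e/2)\<^sup>2"
        unfolding norm_ell2_sq using tail[OF M[OF that]] by (intro l2_of_partial_sums) (simp add: x)
      then have "norm (X i - x) \<le> e/2" by (rule power2_le_imp_le) (use e in simp)
      then show ?thesis using e by (simp add: dist_norm)
    qed
    then show "\<exists>M. \<forall>i\<ge>M. dist (X i) x < e" by blast
  qed
  then show "convergent X" by (rule convergentI)
qed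

section \<open>Complex scalars and the Hermitian product of \<open>ell2\<close>\<close>

lift_definition cscale :: "complex \<Rightarrow> ell2 \<Rightarrow> ell2" is "\<lambda>c x n. c * x n"
  by (simp add: norm_mult power_mult_distrib summable_mult)

lemma coord_cscale [simp]: "coord (cscale c x) n = c * coord x n" by transfer simp

lemma norm_cscale: "norm (cscale c x) = norm c * norm x"
proof -
  have "(norm (cscale c x))\<^sup>2 = (norm c * norm x)\<^sup>2"
    unfolding norm_ell2_sq power_mult_distrib
    by (simp add: norm_mult power_mult_distrib suminf_mult summable_coord)
  then show ?thesis by (rule power2_eq_imp_eq) auto
qed

lemma bounded_linear_cscale: "bounded_linear (cscale c)"
proof (rule bounded_linear_intro[where K="norm c"])
  show "cscale c (x + y) = cscale c x + cscale c y" for x y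
    by (rule ell2_eqI) (simp add: distrib_left)
  show "cscale c (r *\<^sub>R x) = r *\<^sub>R cscale c x" for r x
    by (rule ell2_eqI) simp
qed (simp add: norm_cscale mult.commute)

text \<open>Reduces complex linearity of a real linear operator to commutation with
  \<open>cscale \<i>\<close>.\<close>

lemma cscale_decomp: "cscale c x = Re c *\<^sub>R x + Im c *\<^sub>R cscale \<i> x"
  by (rule ell2_eqI) (simp, simp add: complex_eq_iff)

lemma inner_cscale_i: "inner (cscale \<i> x) y = - inner x (cscale \<i> y)"
proof -
  have "Re (coord (cscale \<i> x) n * cnj (coord y n)) = - Re (coord x n * cnj (coord (cscale \<i> y) n))" for n
    by simp
  then show ?thesis unfolding inner_ell2_def by (simp only: suminf_minus[OF summable_Re_coord_mult])
qed

definition cinner :: "ell2 \<Rightarrow> ell2 \<Rightarrow> complex" where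
  "cinner x y = (\<Sum>n. coord x n * cnj (coord y n))"

text \<open>A factor \<open>\<i>\<close> in the second argument multiplies the product by
  \<open>- \<i>\<close>, which turns its imaginary part into a real part. So identities for
  \<open>inner\<close> extend to \<open>cinner\<close> for operators that commute with
  \<open>cscale \<i>\<close>.\<close>

lemma cinner_eq: "cinner x y = Complex (inner x y) (inner x (cscale \<i> y))"
proof (rule complex_eqI)
  show "Re (cinner x y) = Re (Complex (inner x y) (inner x (cscale \<i> y)))"
    by (simp add: cinner_def inner_ell2_def Re_suminf[OF summable_coord_mult])
  have "Im (cinner x y) = (\<Sum>n. Im (coord x n * cnj (coord y n)))"
    by (simp add: cinner_def Im_suminf[OF summable_coord_mult])
  also have "\<dots> = inner x (cscale \<i> y)"
    unfolding inner_ell2_def by (intro arg_cong[where f=suminf] ext) (simp add: algebra_simps)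
  finally show "Im (cinner x y) = Im (Complex (inner x y) (inner x (cscale \<i> y)))" by simp
qed

section \<open>Square-integrable functions\<close>

definition sq_integrable :: "'a measure \<Rightarrow> ('a \<Rightarrow> complex) \<Rightarrow> bool" where
  "sq_integrable M F \<longleftrightarrow> F \<in> borel_measurable M \<and> integrable M (\<lambda>x. (norm (F x))\<^sup>2)"

lemma sq_integrable_measurable [measurable_dest]: "sq_integrable M F \<Longrightarrow> F \<in> borel_measurable M"
  by (simp add: sq_integrable_def)

lemma sq_integrable_integrable: "sq_integrable M F \<Longrightarrow> integrable M (\<lambda>x. (norm (F x))\<^sup>2)"
  by (simp add: sq_integrable_def)

lemma sq_integrable_add:
  assumes F: "sq_integrable M F" and G: "sq_integrable M G"
  shows "sq_integrable M (\<lambda>x. F x + G x)"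
proof -
  note [measurable] = sq_integrable_measurable[OF F] sq_integrable_measurable[OF G]
  have "integrable M (\<lambda>x. 2 * ((norm (F x))\<^sup>2 + (norm (G x))\<^sup>2))"
    using F G by (intro integrable_mult_right Bochner_Integration.integrable_add) (auto simp: sq_integrable_def)
  moreover have le: "(norm (F x + G x))\<^sup>2 \<le> 2 * ((norm (F x))\<^sup>2 + (norm (G x))\<^sup>2)" for x
  proof -
    have "(norm (F x + G x))\<^sup>2 \<le> (norm (F x) + norm (G x))\<^sup>2" by (intro power_mono norm_triangle_ineq) auto
    also have "\<dots> \<le> 2 * ((norm (F x))\<^sup>2 + (norm (G x))\<^sup>2)"
      using sum_squares_bound[of "norm (F x)" "norm (G x)"] by (simp add: power2_sum)
    finally show ?thesis .
  qed
  ultimately have "integrable M (\<lambda>x. (norm (F x + G x))\<^sup>2)"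
    by (elim Bochner_Integration.integrable_bound) (auto intro!: AE_I2 le)
  then show ?thesis by (simp add: sq_integrable_def)
qed

lemma sq_integrable_cmult: "sq_integrable M F \<Longrightarrow> sq_integrable M (\<lambda>x. c * F x)"
  unfolding sq_integrable_def by (auto simp: norm_mult power_mult_distrib)

lemma sq_integrable_diff:
  assumes F: "sq_integrable M F" and G: "sq_integrable M G"
  shows "sq_integrable M (\<lambda>x. F x - G x)"
  using sq_integrable_add[OF F sq_integrable_cmult[OF G, of "-1"]] by simp

lemma sq_integrable_cnj:
  assumes F: "sq_integrable M F"
  shows "sq_integrable M (\<lambda>x. cnj (F x))"
proof -
  note [measurable] = sq_integrable_measurable[OF F]
  have "(\<lambda>x. cnj (F x)) \<in> borel_measurable M" by (rule borel_measurable_continuous_onI[THEN measurable_compose[rotated]]) (auto intro: continuous_intros)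
  then show ?thesis using F by (simp add: sq_integrable_def)
qed

lemma integrable_norm_mult:
  assumes F: "sq_integrable M F" and G: "sq_integrable M G"
  shows "integrable M (\<lambda>x. norm (F x) * norm (G x))"
proof -
  note [measurable] = sq_integrable_measurable[OF F] sq_integrable_measurable[OF G]
  have "integrable M (\<lambda>x. (norm (F x))\<^sup>2 + (norm (G x))\<^sup>2)"
    using F G by (intro Bochner_Integration.integrable_add) (auto simp: sq_integrable_def)
  moreover have le: "norm (F x) * norm (G x) \<le> (norm (F x))\<^sup>2 + (norm (G x))\<^sup>2" for x
    using sum_squares_bound[of "norm (F x)" "norm (G x)"]
      mult_nonneg_nonneg[OF norm_ge_zero[of "F x"] norm_ge_zero[of "G x"]] by linarith
  ultimately show ?thesis
    by (elim Bochner_Integration.integrable_bound) (auto intro!: AE_I2 le simp: abs_mult)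
qed

lemma integrable_mult_sq_integrable:
  assumes F: "sq_integrable M F" and G: "sq_integrable M G"
  shows "integrable M (\<lambda>x. F x * G x)"
proof -
  note [measurable] = sq_integrable_measurable[OF F] sq_integrable_measurable[OF G]
  show ?thesis
    using integrable_norm_mult[OF F G] by (rule Bochner_Integration.integrable_bound) (auto simp: norm_mult)
qed

lemma Cauchy_Schwarz_integral:
  assumes F: "sq_integrable M F" and G: "sq_integrable M G"
  shows "(LINT x|M. norm (F x) * norm (G x)) \<le> sqrt (LINT x|M. (norm (F x))\<^sup>2) * sqrt (LINT x|M. (norm (G x))\<^sup>2)"
proof -
  note [measurable] = sq_integrable_measurable[OF F] sq_integrable_measurable[OF G]
  define a b c where "a = (LINT x|M. (norm (F x))\<^sup>2)" and "b = (LINT x|M. (norm (G x))\<^sup>2)"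
    and "c = (LINT x|M. norm (F x) * norm (G x))"
  have "(\<integral>\<^sup>+x. ennreal (norm (F x)) * ennreal (norm (G x)) \<partial>M)\<^sup>2
      \<le> (\<integral>\<^sup>+x. (ennreal (norm (F x)))\<^sup>2 \<partial>M) * (\<integral>\<^sup>+x. (ennreal (norm (G x)))\<^sup>2 \<partial>M)"
    by (rule Cauchy_Schwarz_nn_integral) auto
  also have "(\<integral>\<^sup>+x. ennreal (norm (F x)) * ennreal (norm (G x)) \<partial>M) = ennreal c"
    unfolding c_def by (subst nn_integral_eq_integral[OF integrable_norm_mult[OF F G], symmetric])
      (auto simp: ennreal_mult)
  also have "(\<integral>\<^sup>+x. (ennreal (norm (F x)))\<^sup>2 \<partial>M) = ennreal a"
    unfolding a_def by (subst nn_integral_eq_integral[OF sq_integrable_integrable[OF F], symmetric])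
      (auto simp: ennreal_power)
  also have "(\<integral>\<^sup>+x. (ennreal (norm (G x)))\<^sup>2 \<partial>M) = ennreal b"
    unfolding b_def by (subst nn_integral_eq_integral[OF sq_integrable_integrable[OF G], symmetric])
      (auto simp: ennreal_power)
  finally have le: "(ennreal c)\<^sup>2 \<le> ennreal a * ennreal b" .
  have nn: "0 \<le> a" "0 \<le> b" "0 \<le> c" unfolding a_def b_def c_def by (auto intro!: integral_nonneg_AE)
  have "c\<^sup>2 \<le> a * b" using le nn by (simp add: ennreal_power flip: ennreal_mult)
  then have "c \<le> sqrt (a * b)" by (rule real_le_rsqrt)
  then show ?thesis unfolding a_def b_def c_def by (simp add: real_sqrt_mult)
qed

text \<open>The difference of products is
  \<open>(F' - F) (G' - G) + (F' - F) G + F (G' - G)\<close>, and Cauchy--Schwarz bounds each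
  summand. With both \<open>G\<close> factors equal to 1 it turns L2 convergence into L1 convergence
  on the circle.\<close>

lemma tendsto_L1_mult:
  assumes F: "sq_integrable M F" and G: "sq_integrable M G"
    and FF: "\<forall>\<^sub>F i in \<F>. sq_integrable M (FF i)" and GG: "\<forall>\<^sub>F i in \<F>. sq_integrable M (GG i)"
    and limF: "((\<lambda>i. LINT x|M. (norm (FF i x - F x))\<^sup>2) \<longlongrightarrow> 0) \<F>"
    and limG: "((\<lambda>i. LINT x|M. (norm (GG i x - G x))\<^sup>2) \<longlongrightarrow> 0) \<F>"
  shows "((\<lambda>i. LINT x|M. norm (FF i x * GG i x - F x * G x)) \<longlongrightarrow> 0) \<F>"
proof -
  let ?a = "\<lambda>i. sqrt (LINT x|M. (norm (FF i x - F x))\<^sup>2)"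
  let ?b = "\<lambda>i. sqrt (LINT x|M. (norm (GG i x - G x))\<^sup>2)"
  let ?f = "sqrt (LINT x|M. (norm (F x))\<^sup>2)"
  let ?g = "sqrt (LINT x|M. (norm (G x))\<^sup>2)"
  have bnd: "(LINT x|M. norm (FF i x * GG i x - F x * G x)) \<le> ?a i * ?b i + ?a i * ?g + ?f * ?b i"
    if FFi: "sq_integrable M (FF i)" and GGi: "sq_integrable M (GG i)" for i
  proof -
    note dF = sq_integrable_diff[OF FFi F] and dG = sq_integrable_diff[OF GGi G]
    note i = integrable_norm_mult[OF dF dG] integrable_norm_mult[OF dF G] integrable_norm_mult[OF F dG]
    have "(LINT x|M. norm (FF i x * GG i x - F x * G x)) \<le>
        (LINT x|M. norm (FF i x - F x) * norm (GG i x - G x) + norm (FF i x - F x) * norm (G x) + norm (F x) * norm (GG i x - G x))"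
    proof (rule integral_mono)
      show "integrable M (\<lambda>x. norm (FF i x * GG i x - F x * G x))"
        by (intro integrable_norm Bochner_Integration.integrable_diff integrable_mult_sq_integrable FFi GGi F G)
      fix x
      have "FF i x * GG i x - F x * G x =
          (FF i x - F x) * (GG i x - G x) + (FF i x - F x) * G x + F x * (GG i x - G x)"
        by (simp add: algebra_simps)
      then show "norm (FF i x * GG i x - F x * G x) \<le> norm (FF i x - F x) * norm (GG i x - G x)
          + norm (FF i x - F x) * norm (G x) + norm (F x) * norm (GG i x - G x)"
        unfolding norm_mult[symmetric] by (metis (no_types, lifting) norm_triangle_mono norm_triangle_ineq order_refl)
    qed (intro Bochner_Integration.integrable_add i)
    also have "\<dots> = (LINT x|M. norm (FF i x - F x) * norm (GG i x - G x)) + (LINT x|M. norm (FF i x - F x) * norm (G x))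
        + (LINT x|M. norm (F x) * norm (GG i x - G x))"
      using i by (simp add: Bochner_Integration.integral_add)
    also have "\<dots> \<le> ?a i * ?b i + ?a i * ?g + ?f * ?b i"
      by (intro add_mono Cauchy_Schwarz_integral dF dG F G)
    finally show ?thesis .
  qed
  have "((\<lambda>i. ?a i * ?b i + ?a i * ?g + ?f * ?b i) \<longlongrightarrow> sqrt 0 * sqrt 0 + sqrt 0 * ?g + ?f * sqrt 0) \<F>"
    by (intro tendsto_intros limF limG)
  then have lim0: "((\<lambda>i. ?a i * ?b i + ?a i * ?g + ?f * ?b i) \<longlongrightarrow> 0) \<F>" by simp
  show ?thesis
  proof (rule tendsto_sandwich[OF _ _ tendsto_const lim0])
    show "\<forall>\<^sub>F i in \<F>. 0 \<le> (LINT x|M. norm (FF i x * GG i x - F x * G x))"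
      by (auto intro!: always_eventually integral_nonneg_AE)
    show "\<forall>\<^sub>F i in \<F>. (LINT x|M. norm (FF i x * GG i x - F x * G x)) \<le> ?a i * ?b i + ?a i * ?g + ?f * ?b i"
      using FF GG by eventually_elim (rule bnd)
  qed
qed

lemma tendsto_integral_of_L1:
  fixes F :: "'a \<Rightarrow> complex"
  assumes "\<forall>\<^sub>F i in \<F>. integrable M (FF i)" "integrable M F"
    and "((\<lambda>i. LINT x|M. norm (FF i x - F x)) \<longlongrightarrow> 0) \<F>"
  shows "((\<lambda>i. LINT x|M. FF i x) \<longlongrightarrow> (LINT x|M. F x)) \<F>"
proof (subst Lim_null, rule Lim_null_comparison[OF _ assms(3)])
  show "\<forall>\<^sub>F i in \<F>. norm ((LINT x|M. FF i x) - (LINT x|M. F x)) \<le> (LINT x|M. norm (FF i x - F x))"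
    using assms(1)
  proof eventually_elim
    case (elim i)
    have "(LINT x|M. FF i x) - (LINT x|M. F x) = (LINT x|M. FF i x - F x)"
      using elim assms(2) by simp
    then show ?case by (simp only: integral_norm_bound)
  qed
qed

lemma tendsto_L2_inner:
  assumes F: "sq_integrable M F" and G: "sq_integrable M G"
    and FF: "\<forall>\<^sub>F i in \<F>. sq_integrable M (FF i)" and GG: "\<forall>\<^sub>F i in \<F>. sq_integrable M (GG i)"
    and limF: "((\<lambda>i. LINT x|M. (norm (FF i x - F x))\<^sup>2) \<longlongrightarrow> 0) \<F>"
    and limG: "((\<lambda>i. LINT x|M. (norm (GG i x - G x))\<^sup>2) \<longlongrightarrow> 0) \<F>"
  shows "((\<lambda>i. LINT x|M. FF i x * cnj (GG i x)) \<longlongrightarrow> (LINT x|M. F x * cnj (G x))) \<F>"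
proof (rule tendsto_integral_of_L1)
  show "\<forall>\<^sub>F i in \<F>. integrable M (\<lambda>x. FF i x * cnj (GG i x))"
    using FF GG by eventually_elim (intro integrable_mult_sq_integrable sq_integrable_cnj)
  show "integrable M (\<lambda>x. F x * cnj (G x))"
    by (intro integrable_mult_sq_integrable sq_integrable_cnj F G)
  show "((\<lambda>i. LINT x|M. norm (FF i x * cnj (GG i x) - F x * cnj (G x))) \<longlongrightarrow> 0) \<F>"
  proof (rule tendsto_L1_mult[OF F sq_integrable_cnj[OF G] FF _ limF])
    show "\<forall>\<^sub>F i in \<F>. sq_integrable M (\<lambda>x. cnj (GG i x))"
      using GG by eventually_elim (rule sq_integrable_cnj)
    have "norm (cnj u - cnj v) = norm (u - v)" for u v by (metis complex_cnj_diff complex_mod_cnj)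
    then show "((\<lambda>i. LINT x|M. (norm (cnj (GG i x) - cnj (G x)))\<^sup>2) \<longlongrightarrow> 0) \<F>"
      using limG by (simp only:)
  qed
qed

text \<open>Boundary functions are chosen by \<open>SOME\<close>; this uniqueness of L1 limits is
  how they are identified.\<close>

lemma AE_eq_of_L1_limits:
  fixes F G :: "'a \<Rightarrow> complex"
  assumes "\<forall>\<^sub>F i in \<F>. integrable M (FF i)" and F: "integrable M F" and G: "integrable M G"
    and limF: "((\<lambda>i. LINT x|M. norm (FF i x - F x)) \<longlongrightarrow> 0) \<F>"
    and limG: "((\<lambda>i. LINT x|M. norm (FF i x - G x)) \<longlongrightarrow> 0) \<F>"
    and "\<F> \<noteq> bot"
  shows "AE x in M. F x = G x"
proof -
  have "(LINT x|M. norm (F x - G x)) \<le> 0"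
  proof (rule tendsto_lowerbound[OF _ _ \<open>\<F> \<noteq> bot\<close>])
    show "((\<lambda>i. (LINT x|M. norm (FF i x - F x)) + (LINT x|M. norm (FF i x - G x))) \<longlongrightarrow> 0) \<F>"
      using tendsto_add[OF limF limG] by simp
    show "\<forall>\<^sub>F i in \<F>. (LINT x|M. norm (F x - G x)) \<le> (LINT x|M. norm (FF i x - F x)) + (LINT x|M. norm (FF i x - G x))"
      using assms(1)
    proof eventually_elim
      case (elim i)
      have "(LINT x|M. norm (F x - G x)) \<le> (LINT x|M. norm (FF i x - F x) + norm (FF i x - G x))"
      proof (rule integral_mono)
        show "norm (F x - G x) \<le> norm (FF i x - F x) + norm (FF i x - G x)" for x
          using norm_triangle_ineq4[of "FF i x - G x" "FF i x - F x"] by simp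
      qed (use elim F G in auto)
      also have "\<dots> = (LINT x|M. norm (FF i x - F x)) + (LINT x|M. norm (FF i x - G x))"
        using elim F G by (intro Bochner_Integration.integral_add) auto
      finally show ?case .
    qed
  qed
  moreover have "0 \<le> (LINT x|M. norm (F x - G x))" by (rule integral_nonneg_AE) auto
  ultimately have "(LINT x|M. norm (F x - G x)) = 0" by simp
  then have "AE x in M. norm (F x - G x) = 0"
    by (subst (asm) integral_nonneg_eq_0_iff_AE) (use F G in auto)
  then show ?thesis by simp
qed

text \<open>Riesz--Fischer. A rapidly Cauchy subsequence has increments summable in L1, because the
  measure is finite, and so converges almost everywhere; Fatou's lemma then makes the pointwise
  limit an L2 limit of the full sequence.\<close>

lemma L2_complete:
  assumes M: "finite_measure M" and F: "\<And>n::nat. sq_integrable M (F n)"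
    and Cau: "\<And>e. e > 0 \<Longrightarrow> \<exists>N. \<forall>m\<ge>N. \<forall>n\<ge>N. (LINT x|M. (norm (F m x - F n x))\<^sup>2) \<le> e"
  obtains G where "sq_integrable M G" "(\<lambda>n. LINT x|M. (norm (F n x - G x))\<^sup>2) \<longlonglongrightarrow> 0"
proof -
  interpret finite_measure M by fact
  have [measurable]: "F n \<in> borel_measurable M" for n using F by (rule sq_integrable_measurable)
  have "\<exists>N. \<forall>m\<ge>N. \<forall>n\<ge>N. (LINT x|M. (norm (F m x - F n x))\<^sup>2) \<le> (1/4)^k" for k
    by (rule Cau) simp
  then obtain N where N: "\<And>k m n. m \<ge> N k \<Longrightarrow> n \<ge> N k \<Longrightarrow> (LINT x|M. (norm (F m x - F n x))\<^sup>2) \<le> (1/4)^k"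
    by metis
  \<comment> \<open>The sum makes both \<open>p k\<close> and \<open>p (Suc k)\<close> at least
    \<open>N k\<close> without choosing \<open>N\<close> monotone; the summand \<open>k\<close>
    sends \<open>p k\<close> to infinity.\<close>
  define p where "p k = k + (\<Sum>j\<le>k. N j)" for k
  have pN: "p k \<ge> N k" for k unfolding p_def using member_le_sum[of k "{..k}" N] by (simp add: trans_le_add2)
  have pSuc: "p (Suc k) \<ge> N k" for k
    unfolding p_def using member_le_sum[of k "{..Suc k}" N] by (simp add: trans_le_add2)
  have pk: "p k \<ge> k" for k by (simp add: p_def)
  define D where "D k x = F (p (Suc k)) x - F (p k) x" for k x
  have D2: "sq_integrable M (D k)" for k unfolding D_def by (intro sq_integrable_diff F)
  have [measurable]: "D k \<in> borel_measurable M" for k unfolding D_def by measurable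
  have one: "sq_integrable M (\<lambda>_. 1)" by (simp add: sq_integrable_def)
  have D1: "integrable M (\<lambda>x. norm (D k x))" for k
    using integrable_norm_mult[OF D2 one] by simp
  have Dle: "(LINT x|M. norm (D k x)) \<le> sqrt (measure M (space M)) * (1/2)^k" for k
  proof -
    have "(LINT x|M. norm (D k x)) \<le> sqrt (LINT x|M. (norm (D k x))\<^sup>2) * sqrt (measure M (space M))"
      using Cauchy_Schwarz_integral[OF D2 one] by simp
    also have "sqrt (LINT x|M. (norm (D k x))\<^sup>2) \<le> (1/2)^k"
    proof -
      have "(LINT x|M. (norm (D k x))\<^sup>2) \<le> ((1/2)^k)\<^sup>2"
        using N[OF pSuc pN, of k] unfolding D_def
        by (simp add: power2_eq_square[of "(1 / 2) ^ k"] flip: power_mult_distrib)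
      then show ?thesis by (intro real_le_lsqrt) auto
    qed
    finally show ?thesis by (simp add: mult.commute mult_right_mono)
  qed
  have "(\<integral>\<^sup>+x. (\<Sum>k. ennreal (norm (D k x))) \<partial>M) = (\<Sum>k. \<integral>\<^sup>+x. ennreal (norm (D k x)) \<partial>M)"
    by (rule nn_integral_suminf) measurable
  also have "\<dots> = (\<Sum>k. ennreal (LINT x|M. norm (D k x)))"
    by (subst nn_integral_eq_integral) (auto simp: D1)
  also have "\<dots> \<le> (\<Sum>k. ennreal (sqrt (measure M (space M)) * (1/2)^k))"
    by (intro suminf_le ennreal_leI Dle) auto
  also have "\<dots> = ennreal (\<Sum>k. sqrt (measure M (space M)) * (1/2)^k)"
    by (rule suminf_ennreal2) (auto intro!: summable_mult summable_geometric)
  also have "\<dots> < \<infinity>" by simp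
  finally have "(\<integral>\<^sup>+x. (\<Sum>k. ennreal (norm (D k x))) \<partial>M) \<noteq> \<infinity>" by simp
  then have "AE x in M. (\<Sum>k. ennreal (norm (D k x))) \<noteq> \<infinity>"
    by (intro nn_integral_PInf_AE) auto
  then have AEs: "AE x in M. summable (\<lambda>k. D k x)"
  proof eventually_elim
    case (elim x)
    then have "summable (\<lambda>k. norm (D k x))" by (intro summable_suminf_not_top) auto
    then show ?case by (rule summable_norm_cancel)
  qed
  \<comment> \<open>Where the series diverges, \<open>suminf\<close> has an unspecified value; this
    happens on a null set only.\<close>
  define G where "G x = F (p 0) x + (\<Sum>k. D k x)" for x
  have [measurable]: "G \<in> borel_measurable M" unfolding G_def by measurable
  have AEl: "AE x in M. (\<lambda>k. F (p k) x) \<longlonglongrightarrow> G x"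
    using AEs
  proof eventually_elim
    case (elim x)
    have "(\<lambda>n. F (p 0) x + (\<Sum>k<n. D k x)) \<longlonglongrightarrow> G x"
      unfolding G_def by (intro tendsto_intros summable_LIMSEQ elim)
    moreover have "F (p 0) x + (\<Sum>k<n. D k x) = F (p n) x" for n
      unfolding D_def by (subst sum_lessThan_telescope) simp
    ultimately show ?case by simp
  qed
  have fatou: "(\<integral>\<^sup>+x. ennreal ((norm (F m x - G x))\<^sup>2) \<partial>M) \<le> ennreal e"
    if e: "0 \<le> e" "\<And>n. n \<ge> K \<Longrightarrow> (LINT x|M. (norm (F m x - F n x))\<^sup>2) \<le> e" for m K e
  proof -
    have "(\<integral>\<^sup>+x. ennreal ((norm (F m x - G x))\<^sup>2) \<partial>M) =
        (\<integral>\<^sup>+x. liminf (\<lambda>k. ennreal ((norm (F m x - F (p k) x))\<^sup>2)) \<partial>M)"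
    proof (rule nn_integral_cong_AE, use AEl in eventually_elim)
      case (elim x)
      then have "(\<lambda>k. ennreal ((norm (F m x - F (p k) x))\<^sup>2)) \<longlonglongrightarrow> ennreal ((norm (F m x - G x))\<^sup>2)"
        by (intro tendsto_intros) auto
      then show ?case by (intro lim_imp_Liminf[symmetric]) auto
    qed
    also have "\<dots> \<le> liminf (\<lambda>k. \<integral>\<^sup>+x. ennreal ((norm (F m x - F (p k) x))\<^sup>2) \<partial>M)"
      by (rule nn_integral_liminf) measurable
    also have "\<dots> \<le> liminf (\<lambda>k. ennreal e)"
    proof (rule Liminf_mono)
      show "\<forall>\<^sub>F k in sequentially. (\<integral>\<^sup>+x. ennreal ((norm (F m x - F (p k) x))\<^sup>2) \<partial>M) \<le> ennreal e"
        using eventually_ge_at_top[of K]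
      proof eventually_elim
        case (elim k)
        have "(\<integral>\<^sup>+x. ennreal ((norm (F m x - F (p k) x))\<^sup>2) \<partial>M) = ennreal (LINT x|M. (norm (F m x - F (p k) x))\<^sup>2)"
          by (rule nn_integral_eq_integral[OF sq_integrable_integrable[OF sq_integrable_diff[OF F F]]]) simp
        also have "\<dots> \<le> ennreal e" using elim pk[of k] by (intro ennreal_leI e) simp
        finally show ?case .
      qed
    qed
    also have "\<dots> = ennreal e" by (simp add: Liminf_const)
    finally show ?thesis .
  qed
  have FG: "sq_integrable M (\<lambda>x. F (N 0) x - G x)"
  proof -
    have "(\<integral>\<^sup>+x. ennreal ((norm (F (N 0) x - G x))\<^sup>2) \<partial>M) \<le> ennreal 1"
      using fatou[of 1 "N 0" "N 0"] N[of 0 "N 0"] by simp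
    then have "integrable M (\<lambda>x. (norm (F (N 0) x - G x))\<^sup>2)"
      by (intro integrableI_bounded) (auto simp: less_top[symmetric] top_unique)
    then show ?thesis by (simp add: sq_integrable_def)
  qed
  have G: "sq_integrable M G" using sq_integrable_diff[OF F[of "N 0"] FG] by simp
  have "(\<lambda>n. LINT x|M. (norm (F n x - G x))\<^sup>2) \<longlonglongrightarrow> 0"
  proof (rule LIMSEQ_I)
    fix r :: real assume r: "0 < r"
    obtain K where K: "\<And>m n. m \<ge> K \<Longrightarrow> n \<ge> K \<Longrightarrow> (LINT x|M. (norm (F m x - F n x))\<^sup>2) \<le> r/2"
      using Cau[of "r/2"] r by auto
    have "norm ((LINT x|M. (norm (F n x - G x))\<^sup>2) - 0) < r" if "n \<ge> K" for n
    proof -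
      have "ennreal (LINT x|M. (norm (F n x - G x))\<^sup>2) = (\<integral>\<^sup>+x. ennreal ((norm (F n x - G x))\<^sup>2) \<partial>M)"
        by (rule nn_integral_eq_integral[symmetric, OF sq_integrable_integrable[OF sq_integrable_diff[OF F G]]]) simp
      also have "\<dots> \<le> ennreal (r/2)" using r K[OF that] by (intro fatou) auto
      finally have "(LINT x|M. (norm (F n x - G x))\<^sup>2) \<le> r/2" using r by (simp add: ennreal_le_iff)
      moreover have "0 \<le> (LINT x|M. (norm (F n x - G x))\<^sup>2)" by (rule integral_nonneg_AE) auto
      ultimately show ?thesis using r by simp
    qed
    then show "\<exists>no. \<forall>n\<ge>no. norm ((LINT x|M. (norm (F n x - G x))\<^sup>2) - 0) < r" by blast
  qed
  with G show ?thesis by (rule that)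
qed

section \<open>Fourier series on the circle\<close>

lemma L2_circle_iff: "F \<in> L2_circle \<longleftrightarrow> sq_integrable circle_measure F"
  by (simp add: L2_circle_def sq_integrable_def)

lemma space_circle_measure [simp]: "space circle_measure = sphere 0 1"
  by (simp add: circle_measure_def space_restrict_space)

lemma sets_circle_measure [simp]: "sets circle_measure = sets (restrict_space borel (sphere 0 1))"
  by (simp add: circle_measure_def)

lemma measurable_cis_circle [measurable]:
  "cis \<in> measurable (uniform_measure lborel {0..2 * pi}) (restrict_space borel (sphere 0 1))"
proof (rule measurable_restrict_space2)
  have "cis \<in> borel_measurable borel"
    by (intro borel_measurable_continuous_onI continuous_intros)
  then show "cis \<in> borel_measurable (uniform_measure lborel {0..2 * pi})" by simp
qed auto

lemma emeasure_circle_measure: "emeasure circle_measure (sphere 0 1) = 1"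
proof -
  have "emeasure circle_measure (sphere 0 1) = emeasure (uniform_measure lborel {0..2 * pi}) UNIV"
    unfolding circle_measure_def
    by (subst emeasure_distr[OF measurable_cis_circle])
      (auto simp: sets_restrict_space_iff intro!: arg_cong2[where f=emeasure] simp del: emeasure_uniform_measure)
  also have "\<dots> = 1"
    by (subst emeasure_uniform_measure) (auto simp: divide_eq_1_ennreal)
  finally show ?thesis .
qed

lemma finite_measure_circle: "finite_measure circle_measure"
  by (rule finite_measureI) (simp add: emeasure_circle_measure)

lemma measure_circle [simp]: "measure circle_measure (sphere 0 1) = 1"
  by (simp add: measure_def emeasure_circle_measure)

lemma measurable_circle:
  fixes F :: "complex \<Rightarrow> complex"
  assumes "continuous_on (sphere 0 1) F"
  shows "F \<in> borel_measurable circle_measure"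
  using borel_measurable_continuous_on_restrict[OF assms] by (simp cong: measurable_cong_sets)

lemma sq_integrable_circle:
  fixes F :: "complex \<Rightarrow> complex"
  assumes "continuous_on (sphere 0 1) F"
  shows "sq_integrable circle_measure F"
proof -
  interpret finite_measure circle_measure by (rule finite_measure_circle)
  note [measurable] = measurable_circle[OF assms]
  have "bounded (F ` sphere 0 1)"
    by (intro compact_imp_bounded compact_continuous_image assms) auto
  then obtain K where K: "\<And>z. z \<in> sphere 0 1 \<Longrightarrow> norm (F z) \<le> K"
    unfolding bounded_iff by blast
  have "integrable circle_measure (\<lambda>z. (norm (F z))\<^sup>2)"
    by (rule integrable_const_bound[where B="K\<^sup>2"]) (auto intro!: AE_I2 power_mono K)
  then show ?thesis by (simp add: sq_integrable_def)
qed

lemma circle_integral_cis: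
  fixes F :: "complex \<Rightarrow> complex"
  assumes "continuous_on (sphere 0 1) F"
  shows "(LINT \<zeta>|circle_measure. F \<zeta>) = (LINT t|lborel. indicator {0..2 * pi} t *\<^sub>R F (cis t)) / (2 * pi)"
proof -
  have [measurable]: "(\<lambda>t. F (cis t)) \<in> borel_measurable borel"
    by (intro borel_measurable_continuous_onI continuous_on_compose2[OF assms] continuous_intros) auto
  have "(LINT \<zeta>|circle_measure. F \<zeta>) = (LINT t|uniform_measure lborel {0..2 * pi}. F (cis t))"
    unfolding circle_measure_def
    by (rule integral_distr[OF measurable_cis_circle borel_measurable_continuous_on_restrict[OF assms]])
  also have "uniform_measure lborel {0..2 * pi} = density lborel (\<lambda>t. ennreal (indicator {0..2 * pi} t / (2 * pi)))"
    unfolding uniform_measure_def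
    by (intro density_cong) (auto simp: divide_ennreal[symmetric] ennreal_indicator)
  also have "(LINT t|\<dots>. F (cis t)) = (LINT t|lborel. (indicator {0..2 * pi} t / (2 * pi)) *\<^sub>R F (cis t))"
    by (rule integral_density) auto
  also have "\<dots> = (LINT t|lborel. (1 / (2 * pi)) *\<^sub>R (indicator {0..2 * pi} t *\<^sub>R F (cis t)))"
    by simp
  also have "\<dots> = (1 / (2 * pi)) *\<^sub>R (LINT t|lborel. indicator {0..2 * pi} t *\<^sub>R F (cis t))"
    by (rule integral_scaleR_right)
  finally show ?thesis by (simp add: scaleR_conv_of_real)
qed

lemma circle_integral_power:
  "(LINT \<zeta>|circle_measure. \<zeta> ^ m * cnj (\<zeta> ^ n)) = (if m = n then 1 else 0)"
proof -
  define k where "k = real m - real n"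
  have eq: "cis t ^ m * cnj (cis t ^ n) = cis (k * t)" for t
  proof -
    have "cis t ^ m * cnj (cis t ^ n) = cis (real m * t + real n * (- t))"
      by (simp only: Complex.DeMoivre complex_cnj_power cis_cnj cis_mult mult_minus_right)
    then show ?thesis by (simp add: k_def left_diff_distrib)
  qed
  have "(LINT \<zeta>|circle_measure. \<zeta> ^ m * cnj (\<zeta> ^ n))
      = (LINT t|lborel. indicator {0..2 * pi} t *\<^sub>R cis (k * t)) / (2 * pi)"
    by (subst circle_integral_cis) (auto intro!: continuous_intros simp only: eq)
  also have "(LINT t|lborel. indicator {0..2 * pi} t *\<^sub>R cis (k * t)) = (if m = n then 2 * pi else 0)"
  proof (cases "m = n")
    case True
    then show ?thesis by (simp add: k_def scaleR_conv_of_real)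
  next
    case False
    then have k: "k \<noteq> 0" by (simp add: k_def)
    have "(LINT t|lborel. indicator {0..2 * pi} t *\<^sub>R cis (k * t)) = cis (k * (2 * pi)) / (\<i> * k) - cis (k * 0) / (\<i> * k)"
    proof (rule integral_FTC_Icc)
      show "((\<lambda>t. cis (k * t) / (\<i> * k)) has_vector_derivative cis (k * t)) (at t within {0..2 * pi})" for t
        unfolding has_vector_derivative_def
        by (rule has_derivative_eq_rhs, (rule derivative_intros)+) (use k in \<open>auto simp: scaleR_conv_of_real field_simps\<close>)
    qed (auto intro!: continuous_intros)
    also have "cis (k * (2 * pi)) = 1"
    proof -
      have "cis (k * (2 * pi)) = cis (2 * pi * of_int (int m - int n))" by (simp add: k_def mult.commute)
      also have "\<dots> = 1" by (intro cis_multiple_2pi) auto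
      finally show ?thesis .
    qed
    finally show ?thesis using False by simp
  qed
  finally show ?thesis by simp
qed

definition circle_poly :: "nat \<Rightarrow> (nat \<Rightarrow> complex) \<Rightarrow> complex \<Rightarrow> complex" where
  "circle_poly N a \<zeta> = (\<Sum>n<N. a n * \<zeta> ^ n)"

lemma sq_integrable_circle_poly: "sq_integrable circle_measure (circle_poly N a)"
  unfolding circle_poly_def by (intro sq_integrable_circle continuous_intros)

lemma circle_poly_inner: "(LINT \<zeta>|circle_measure. circle_poly N a \<zeta> * cnj (circle_poly N b \<zeta>)) = (\<Sum>n<N. a n * cnj (b n))"
proof -
  have int: "integrable circle_measure (\<lambda>\<zeta>. (a m * cnj (b n)) * (\<zeta> ^ m * cnj (\<zeta> ^ n)))" for m n
    by (intro integrable_mult_right integrable_mult_sq_integrable sq_integrable_circle continuous_intros)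
  have "(LINT \<zeta>|circle_measure. circle_poly N a \<zeta> * cnj (circle_poly N b \<zeta>))
      = (LINT \<zeta>|circle_measure. (\<Sum>m<N. \<Sum>n<N. (a m * cnj (b n)) * (\<zeta> ^ m * cnj (\<zeta> ^ n))))"
    unfolding circle_poly_def by (simp add: sum_product mult_ac)
  also have "\<dots> = (\<Sum>m<N. \<Sum>n<N. (a m * cnj (b n)) * (LINT \<zeta>|circle_measure. \<zeta> ^ m * cnj (\<zeta> ^ n)))"
    using int by (simp add: Bochner_Integration.integral_sum del: complex_cnj_power)
  also have "\<dots> = (\<Sum>n<N. a n * cnj (b n))"
    by (simp add: circle_integral_power if_distrib[of "\<lambda>x. _ * x"] sum.delta cong: if_cong del: complex_cnj_power)
  finally show ?thesis .
qed

lemma integral_norm_sq: "(LINT x|M. (norm (F x))\<^sup>2) = Re (LINT x|M. F x * cnj (F x))"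
proof -
  have "F x * cnj (F x) = of_real ((norm (F x))\<^sup>2)" for x by (rule complex_norm_square[symmetric])
  then show ?thesis by (simp only: integral_complex_of_real Re_complex_of_real)
qed

lemma circle_poly_diff: "circle_poly N a \<zeta> - circle_poly N b \<zeta> = circle_poly N (\<lambda>n. a n - b n) \<zeta>"
  by (simp add: circle_poly_def sum_subtractf algebra_simps)

lemma circle_poly_norm: "(LINT \<zeta>|circle_measure. (norm (circle_poly N a \<zeta>))\<^sup>2) = (\<Sum>n<N. (norm (a n))\<^sup>2)"
  unfolding integral_norm_sq circle_poly_inner by (simp add: cmod_power2 flip: power2_eq_square)

lemma circle_poly_le: "M \<le> N \<Longrightarrow> circle_poly M a = circle_poly N (\<lambda>n. if n < M then a n else 0)"
  unfolding circle_poly_def fun_eq_iff by (intro allI sum.mono_neutral_cong_left) auto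

lemma circle_poly_diff_norm:
  assumes "M \<le> N"
  shows "(LINT \<zeta>|circle_measure. (norm (circle_poly M a \<zeta> - circle_poly N a \<zeta>))\<^sup>2) = (\<Sum>n\<in>{M..<N}. (norm (a n))\<^sup>2)"
  unfolding circle_poly_le[OF assms] circle_poly_diff circle_poly_norm
  by (rule sum.mono_neutral_cong_right) auto

text \<open>The squared norm of a difference of partial sums is a block of the series of squared
  coefficients, so the partial sums are Cauchy.\<close>

lemma circle_poly_converges:
  assumes a: "summable (\<lambda>n. (norm (a n))\<^sup>2)"
  shows "\<exists>G. sq_integrable circle_measure G \<and> (\<lambda>N. LINT \<zeta>|circle_measure. (norm (circle_poly N a \<zeta> - G \<zeta>))\<^sup>2) \<longlonglongrightarrow> 0"
proof (rule L2_complete[OF finite_measure_circle, of "\<lambda>N. circle_poly N a"])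
  fix e :: real assume e: "0 < e"
  obtain K where K: "\<And>m n. m \<ge> K \<Longrightarrow> norm (\<Sum>i\<in>{m..<n}. (norm (a i))\<^sup>2) < e"
    using a e unfolding summable_Cauchy by blast
  have le: "(LINT \<zeta>|circle_measure. (norm (circle_poly m a \<zeta> - circle_poly n a \<zeta>))\<^sup>2) \<le> e" if "m \<ge> K" "m \<le> n" for m n
    using K[OF that(1), of n] unfolding circle_poly_diff_norm[OF that(2)] by simp
  show "\<exists>K. \<forall>m\<ge>K. \<forall>n\<ge>K. (LINT \<zeta>|circle_measure. (norm (circle_poly m a \<zeta> - circle_poly n a \<zeta>))\<^sup>2) \<le> e"
  proof (intro exI allI impI)
    fix m n assume "K \<le> m" "K \<le> n"
    then show "(LINT \<zeta>|circle_measure. (norm (circle_poly m a \<zeta> - circle_poly n a \<zeta>))\<^sup>2) \<le> e"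
      using le[of m n] le[of n m] by (cases "m \<le> n") (auto simp: norm_minus_commute)
  qed
qed (auto intro: sq_integrable_circle_poly)

text \<open>The boundary function as an L2 limit of Taylor polynomials instead of dilates.
  Parseval's identity is then immediate, and \<open>boundary_fun_bdry\<close> reconciles the two
  descriptions.\<close>

definition bdry :: "ell2 \<Rightarrow> complex \<Rightarrow> complex" where
  "bdry x = (SOME G. sq_integrable circle_measure G \<and>
     (\<lambda>N. LINT \<zeta>|circle_measure. (norm (circle_poly N (coord x) \<zeta> - G \<zeta>))\<^sup>2) \<longlonglongrightarrow> 0)"

lemma bdry: "sq_integrable circle_measure (bdry x)"
    "(\<lambda>N. LINT \<zeta>|circle_measure. (norm (circle_poly N (coord x) \<zeta> - bdry x \<zeta>))\<^sup>2) \<longlonglongrightarrow> 0"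
  using someI_ex[OF circle_poly_converges[OF summable_coord[of x]]] unfolding bdry_def by auto

lemma bdry_inner: "(LINT \<zeta>|circle_measure. bdry x \<zeta> * cnj (bdry y \<zeta>)) = cinner x y"
proof (rule LIMSEQ_unique)
  show "(\<lambda>N. LINT \<zeta>|circle_measure. circle_poly N (coord x) \<zeta> * cnj (circle_poly N (coord y) \<zeta>))
      \<longlonglongrightarrow> (LINT \<zeta>|circle_measure. bdry x \<zeta> * cnj (bdry y \<zeta>))"
    by (intro tendsto_L2_inner bdry always_eventually allI sq_integrable_circle_poly)
  show "(\<lambda>N. LINT \<zeta>|circle_measure. circle_poly N (coord x) \<zeta> * cnj (circle_poly N (coord y) \<zeta>)) \<longlonglongrightarrow> cinner x y"
    unfolding circle_poly_inner cinner_def by (intro summable_LIMSEQ summable_coord_mult)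
qed

lemma bdry_dist: "(LINT \<zeta>|circle_measure. (norm (bdry x \<zeta> - bdry y \<zeta>))\<^sup>2) = (norm (x - y))\<^sup>2"
proof -
  have i: "integrable circle_measure (\<lambda>\<zeta>. bdry u \<zeta> * cnj (bdry v \<zeta>))" for u v
    by (intro integrable_mult_sq_integrable sq_integrable_cnj bdry)
  have "(LINT \<zeta>|circle_measure. (bdry x \<zeta> - bdry y \<zeta>) * cnj (bdry x \<zeta> - bdry y \<zeta>)) =
      (LINT \<zeta>|circle_measure. (bdry x \<zeta> * cnj (bdry x \<zeta>) - bdry x \<zeta> * cnj (bdry y \<zeta>)) - (bdry y \<zeta> * cnj (bdry x \<zeta>) - bdry y \<zeta> * cnj (bdry y \<zeta>)))"
    by (simp add: algebra_simps)
  also have "\<dots> = (cinner x x - cinner x y) - (cinner y x - cinner y y)"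
    unfolding bdry_inner[symmetric]
    by (simp only: Bochner_Integration.integral_diff Bochner_Integration.integrable_diff i)
  finally have "(LINT \<zeta>|circle_measure. (norm (bdry x \<zeta> - bdry y \<zeta>))\<^sup>2)
      = Re ((cinner x x - cinner x y) - (cinner y x - cinner y y))"
    unfolding integral_norm_sq by (rule arg_cong)
  then show ?thesis
    by (simp add: cinner_eq power2_norm_eq_inner inner_diff_left inner_diff_right algebra_simps)
qed

text \<open>Absolute summability makes the polynomials converge uniformly on the circle, and the
  uniform limit agrees almost everywhere with the L2 limit. This ties the chosen representative to
  actual values, in particular for dilates.\<close>

lemma bdry_eq_of_summable:
  assumes a: "summable (\<lambda>n. norm (coord x n))"
  shows "AE \<zeta> in circle_measure. bdry x \<zeta> = (\<Sum>n. coord x n * \<zeta> ^ n)"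
proof -
  define g where "g \<zeta> = (\<Sum>n. coord x n * \<zeta> ^ n)" for \<zeta>
  have unif: "uniform_limit (sphere 0 1) (\<lambda>N \<zeta>. circle_poly N (coord x) \<zeta>) g sequentially"
    unfolding circle_poly_def g_def by (rule Weierstrass_m_test[OF _ a]) (auto simp: norm_mult norm_power)
  have g: "sq_integrable circle_measure g"
    by (intro sq_integrable_circle uniform_limit_theorem[OF _ unif])
      (auto simp: circle_poly_def intro!: always_eventually continuous_intros)
  have limg: "(\<lambda>N. LINT \<zeta>|circle_measure. norm (circle_poly N (coord x) \<zeta> - g \<zeta>)) \<longlonglongrightarrow> 0"
  proof (rule LIMSEQ_I)
    fix r :: real assume r: "0 < r"
    interpret finite_measure circle_measure by (rule finite_measure_circle)
    have one: "sq_integrable circle_measure (\<lambda>_. 1)" by (intro sq_integrable_circle continuous_intros)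
    have "\<forall>\<^sub>F N in sequentially. \<forall>\<zeta>\<in>sphere 0 1. dist (circle_poly N (coord x) \<zeta>) (g \<zeta>) < r/2"
      using r by (intro uniform_limitD[OF unif]) simp
    then obtain K where K: "\<And>N \<zeta>. N \<ge> K \<Longrightarrow> \<zeta> \<in> sphere 0 1 \<Longrightarrow> dist (circle_poly N (coord x) \<zeta>) (g \<zeta>) < r/2"
      unfolding eventually_sequentially by blast
    have "norm ((LINT \<zeta>|circle_measure. norm (circle_poly N (coord x) \<zeta> - g \<zeta>)) - 0) < r" if "N \<ge> K" for N
    proof -
      have "(LINT \<zeta>|circle_measure. norm (circle_poly N (coord x) \<zeta> - g \<zeta>)) \<le> (LINT \<zeta>|circle_measure. r/2)"
      proof (rule integral_mono)
        show "integrable circle_measure (\<lambda>\<zeta>. norm (circle_poly N (coord x) \<zeta> - g \<zeta>))"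
          using integrable_norm_mult[OF sq_integrable_diff[OF sq_integrable_circle_poly g] one] by simp
      qed (use K[OF that] in \<open>auto simp: dist_norm less_imp_le\<close>)
      also have "\<dots> = r/2" by simp
      finally have "(LINT \<zeta>|circle_measure. norm (circle_poly N (coord x) \<zeta> - g \<zeta>)) \<le> r/2" .
      moreover have "0 \<le> (LINT \<zeta>|circle_measure. norm (circle_poly N (coord x) \<zeta> - g \<zeta>))" by (rule integral_nonneg_AE) auto
      ultimately show ?thesis using r by simp
    qed
    then show "\<exists>no. \<forall>N\<ge>no. norm ((LINT \<zeta>|circle_measure. norm (circle_poly N (coord x) \<zeta> - g \<zeta>)) - 0) < r" by blast
  qed
  have one: "sq_integrable circle_measure (\<lambda>_. 1)" by (intro sq_integrable_circle continuous_intros)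
  have limb: "(\<lambda>N. LINT \<zeta>|circle_measure. norm (circle_poly N (coord x) \<zeta> - bdry x \<zeta>)) \<longlonglongrightarrow> 0"
    using tendsto_L1_mult[OF bdry(1) one _ _ bdry(2), where GG="\<lambda>_ _. 1"] by (simp add: sq_integrable_circle_poly one)
  have i: "integrable circle_measure F" if "sq_integrable circle_measure F" for F
    using integrable_mult_sq_integrable[OF that one] by simp
  show ?thesis
    using AE_eq_of_L1_limits[OF _ i[OF bdry(1)] i[OF g] limb limg] by (simp add: i sq_integrable_circle_poly g_def)
qed

section \<open>Boundary functions of the Hardy space\<close>

lemma taylor_coeff_sums:
  assumes "\<And>z. norm z < 1 \<Longrightarrow> (\<lambda>n. a n * z ^ n) sums f z"
  shows "taylor_coeff f = a" "f holomorphic_on ball 0 1"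
proof -
  show "f holomorphic_on ball 0 1"
    using power_series_holomorphic[of 0 1 a f] assms by simp
  have "f has_fps_expansion Abs_fps a"
  proof (rule has_fps_expansionI)
    have "\<forall>\<^sub>F u in nhds 0. u \<in> ball (0::complex) 1" by (rule eventually_nhds_in_open) auto
    then show "\<forall>\<^sub>F u in nhds 0. (\<lambda>n. fps_nth (Abs_fps a) n * u ^ n) sums f u"
      by eventually_elim (simp add: assms)
  qed
  then show "taylor_coeff f = a"
    by (simp add: taylor_coeff_def fps_expansion_eqI fun_eq_iff)
qed

lemma sums_taylor_coeff:
  assumes "f holomorphic_on ball 0 1" "norm z < 1"
  shows "(\<lambda>n. taylor_coeff f n * z ^ n) sums f z"
  using holomorphic_power_series[OF assms(1), of z] assms(2)
  by (simp add: taylor_coeff_def fps_expansion_def)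

text \<open>The unitary map from \<open>ell2\<close> onto \<open>H2\<close>; the value 0 off the
  disk is the convention of \<open>H2\<close>.\<close>

definition hfun :: "ell2 \<Rightarrow> complex \<Rightarrow> complex" where
  "hfun x z = (if z \<in> ball 0 1 then \<Sum>n. coord x n * z ^ n else 0)"

lemma summable_norm_hfun:
  assumes "norm z < 1"
  shows "summable (\<lambda>n. norm (coord x n * z ^ n))"
proof (rule summable_norm_mult_l2[OF summable_coord])
  have "(norm (z ^ n))\<^sup>2 = ((norm z)\<^sup>2) ^ n" for n
    by (simp add: norm_power mult.commute flip: power_mult)
  moreover have "(norm z)\<^sup>2 < 1" using assms by (simp add: abs_square_less_1)
  ultimately show "summable (\<lambda>n. (norm (z ^ n))\<^sup>2)" by (simp add: summable_geometric)
qed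

lemma hfun_sums:
  assumes "norm z < 1"
  shows "(\<lambda>n. coord x n * z ^ n) sums hfun x z"
  using summable_sums[OF summable_norm_cancel[OF summable_norm_hfun[OF assms]]] assms
  by (simp add: hfun_def)

lemma hfun_outside [simp]: "\<not> norm z < 1 \<Longrightarrow> hfun x z = 0"
  by (simp add: hfun_def)

lemma hfun_add: "hfun (x + y) z = hfun x z + hfun y z"
proof (cases "norm z < 1")
  case True
  then show ?thesis
    using sums_unique2[OF hfun_sums[OF True, of "x + y"]] sums_add[OF hfun_sums[OF True, of x] hfun_sums[OF True, of y]]
    by (simp add: distrib_right)
qed simp

lemma hfun_cscale: "hfun (cscale c x) z = c * hfun x z"
proof (cases "norm z < 1")
  case True
  then show ?thesis
    using sums_unique2[OF hfun_sums[OF True, of "cscale c x"]] sums_mult[OF hfun_sums[OF True, of x], of c]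
    by (simp add: mult.assoc)
qed simp

lemma taylor_coeff_hfun [simp]: "taylor_coeff (hfun x) = coord x"
  and holomorphic_hfun: "hfun x holomorphic_on ball 0 1"
  using taylor_coeff_sums[OF hfun_sums] by auto

lemma hfun_inject: "hfun x = hfun y \<longleftrightarrow> x = y"
  by (metis taylor_coeff_hfun coord_inject)

lemma hfun_in_H2: "hfun x \<in> H2"
  by (simp add: H2_def holomorphic_hfun summable_coord)

lemma H2_hfun:
  assumes "f \<in> H2" obtains x where "f = hfun x"
proof -
  obtain x where x: "coord x = taylor_coeff f"
    using assms Abs_ell2_inverse[of "taylor_coeff f"] by (auto simp: H2_def)
  have "f z = hfun x z" for z
  proof (cases "norm z < 1")
    case True
    show ?thesis
      using sums_unique2[OF hfun_sums[OF True, of x]] sums_taylor_coeff[OF _ True, of f] assms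
      by (auto simp: H2_def x)
  qed (use assms in \<open>auto simp: H2_def\<close>)
  then show thesis using that by blast
qed

lemma H2_inner_hfun: "H2_inner (hfun x) (hfun y) = cinner x y"
  by (simp add: H2_inner_def cinner_def)

lemma H2_norm_hfun: "H2_norm (hfun x) = norm x"
  by (simp add: H2_norm_def flip: norm_ell2_sq)

text \<open>The coefficients of \<open>z \<mapsto> f (r z)\<close>. For \<open>r > 1\<close> the
  sequence need not be square-summable and \<open>Abs_ell2\<close> is then unspecified, whence the
  range assumed in \<open>coord_dilate\<close>.\<close>

definition dilate :: "real \<Rightarrow> ell2 \<Rightarrow> ell2" where
  "dilate r x = Abs_ell2 (\<lambda>n. of_real (r ^ n) * coord x n)"

lemma coord_dilate:
  assumes "0 \<le> r" "r \<le> 1"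
  shows "coord (dilate r x) n = of_real (r ^ n) * coord x n"
proof -
  have "summable (\<lambda>n. (norm (of_real (r ^ n) * coord x n))\<^sup>2)"
  proof (rule summable_comparison_test'[OF summable_coord[of x]])
    fix n
    show "norm ((norm (of_real (r ^ n) * coord x n))\<^sup>2) \<le> (norm (coord x n))\<^sup>2"
      using assms by (auto simp: norm_mult norm_power power_le_one intro!: power_mono mult_left_le_one_le)
  qed
  then show ?thesis unfolding dilate_def by (subst Abs_ell2_inverse) auto
qed

lemma norm_dilate_le:
  assumes "0 \<le> r" "r \<le> 1"
  shows "norm (dilate r x) \<le> norm x"
proof -
  have "(norm (dilate r x))\<^sup>2 \<le> (norm x)\<^sup>2"
    unfolding norm_ell2_sq
    by (rule suminf_le[OF _ summable_coord summable_coord])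
      (use assms in \<open>auto simp: coord_dilate norm_mult norm_power power_le_one intro!: power_mono mult_left_le_one_le\<close>)
  then show ?thesis by (rule power2_le_imp_le) simp
qed

lemma eventually_at_left_1: "\<forall>\<^sub>F r in at_left (1::real). 0 < r \<and> r < 1"
  using eventually_at_left_real[of 0 "1::real"] by simp

text \<open>Tannery's theorem, that is, dominated convergence for series:
  \<open>\<bar>r ^ k - 1\<bar> \<le> 1\<close> supplies the majorant.\<close>

lemma tendsto_dilate: "((\<lambda>r. dilate r x) \<longlongrightarrow> x) (at_left 1)"
proof -
  let ?a = "\<lambda>k r. (norm (of_real (r ^ k - 1) * coord x k))\<^sup>2"
  have "((\<lambda>r. \<Sum>k. ?a k r) \<longlongrightarrow> (\<Sum>k. 0)) (at_left (1::real))"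
  proof (rule tannerys_theorem[THEN conjunct2, THEN conjunct2, OF _ _ summable_coord[of x]])
    show "((\<lambda>r. ?a k r) \<longlongrightarrow> 0) (at_left 1)" for k
    proof -
      have "((\<lambda>r. ?a k r) \<longlongrightarrow> (norm (of_real (1 ^ k - 1) * coord x k))\<^sup>2) (at_left 1)"
        by (intro tendsto_intros)
      then show ?thesis by simp
    qed
    have "\<forall>\<^sub>F p in at_top \<times>\<^sub>F at_left (1::real). True \<and> (0 < snd p \<and> snd p < 1)"
      by (rule eventually_prodI[OF eventually_True eventually_at_left_1])
    then show "\<forall>\<^sub>F (k, r) in at_top \<times>\<^sub>F at_left 1. norm (?a k r) \<le> (norm (coord x k))\<^sup>2"
    proof eventually_elim
      case (elim p)
      obtain k r where p: "p = (k, r)" by (cases p)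
      have "\<bar>r ^ k - 1\<bar> \<le> 1" using elim by (simp add: p abs_le_iff power_le_one)
      then have "?a k r \<le> (norm (coord x k))\<^sup>2"
        by (intro power_mono) (auto simp: norm_mult mult_left_le_one_le simp del: of_real_diff of_real_power)
      then show ?case by (simp add: p)
    qed
  qed simp
  moreover have "\<forall>\<^sub>F r in at_left 1. (\<Sum>k. ?a k r) = (norm (dilate r x - x))\<^sup>2"
    using eventually_at_left_1 by eventually_elim (simp add: norm_ell2_sq coord_dilate left_diff_distrib)
  ultimately have "((\<lambda>r. (norm (dilate r x - x))\<^sup>2) \<longlongrightarrow> 0) (at_left 1)"
    by (simp add: tendsto_cong)
  from tendsto_real_sqrt[OF this] have "((\<lambda>r. norm (dilate r x - x)) \<longlongrightarrow> 0) (at_left 1)" by simp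
  then show ?thesis by (simp add: tendsto_norm_zero_iff Lim_null[of _ x])
qed

lemma bdry_dilate:
  assumes "0 \<le> r" "r < 1"
  shows "AE \<zeta> in circle_measure. hfun x (of_real r * \<zeta>) = bdry (dilate r x) \<zeta>"
proof -
  have eq: "coord (dilate r x) n * \<zeta> ^ n = coord x n * (of_real r * \<zeta>) ^ n" for n \<zeta>
    using assms by (simp add: coord_dilate power_mult_distrib)
  have "summable (\<lambda>n. norm (coord (dilate r x) n))"
    using summable_norm_hfun[of "of_real r" x] eq[of _ 1] assms by simp
  from bdry_eq_of_summable[OF this] AE_space[of circle_measure]
  show ?thesis
  proof eventually_elim
    case (elim \<zeta>)
    then have "norm (of_real r * \<zeta>) < 1" using assms by (simp add: norm_mult)
    then show ?case using elim by (simp add: eq hfun_def)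
  qed
qed

lemma sq_integrable_hfun_dilate:
  assumes "0 \<le> r" "r < 1"
  shows "sq_integrable circle_measure (\<lambda>\<zeta>. hfun x (of_real r * \<zeta>))"
  by (intro sq_integrable_circle continuous_on_compose2[OF holomorphic_on_imp_continuous_on[OF holomorphic_hfun]]
      continuous_intros) (use assms in \<open>auto simp: norm_mult\<close>)

text \<open>\<open>bdry\<close> is isometric and the dilate of \<open>hfun x\<close> agrees on the
  circle with \<open>bdry (dilate r x)\<close>, so the integral is the squared norm of
  \<open>dilate r x - x\<close>.\<close>

lemma hfun_dilate_tendsto_bdry:
  "((\<lambda>r. LINT \<zeta>|circle_measure. (norm (hfun x (of_real r * \<zeta>) - bdry x \<zeta>))\<^sup>2) \<longlongrightarrow> 0) (at_left 1)"
proof -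
  have "\<forall>\<^sub>F r in at_left 1. (LINT \<zeta>|circle_measure. (norm (hfun x (of_real r * \<zeta>) - bdry x \<zeta>))\<^sup>2) = (norm (dilate r x - x))\<^sup>2"
    using eventually_at_left_1
  proof eventually_elim
    case (elim r)
    then have r: "0 \<le> r" "r < 1" by auto
    note [measurable] = sq_integrable_measurable[OF bdry(1)[of x]] sq_integrable_measurable[OF bdry(1)[of "dilate r x"]]
      sq_integrable_measurable[OF sq_integrable_hfun_dilate[OF r, of x]]
    have "(LINT \<zeta>|circle_measure. (norm (hfun x (of_real r * \<zeta>) - bdry x \<zeta>))\<^sup>2)
        = (LINT \<zeta>|circle_measure. (norm (bdry (dilate r x) \<zeta> - bdry x \<zeta>))\<^sup>2)"
    proof (rule integral_cong_AE)
      show "AE \<zeta> in circle_measure. (norm (hfun x (of_real r * \<zeta>) - bdry x \<zeta>))\<^sup>2 = (norm (bdry (dilate r x) \<zeta> - bdry x \<zeta>))\<^sup>2"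
        using bdry_dilate[of r x] elim by (auto elim: AE_mp)
    qed measurable
    then show ?case by (simp add: bdry_dist)
  qed
  moreover have "((\<lambda>r. (norm (dilate r x - x))\<^sup>2) \<longlongrightarrow> (norm (x - x))\<^sup>2) (at_left 1)"
    by (intro tendsto_intros tendsto_dilate)
  ultimately show ?thesis by (simp add: tendsto_cong)
qed

text \<open>\<open>bdry x\<close> satisfies the property behind the \<open>SOME\<close>, so the
  chosen function does too, and both are limits of the same dilates. Only values in the disk are
  assumed, as a symbol may be arbitrary elsewhere.\<close>

lemma boundary_fun_bdry:
  assumes g: "\<And>z. norm z < 1 \<Longrightarrow> g z = hfun x z"
  shows "sq_integrable circle_measure (boundary_fun g)" "AE \<zeta> in circle_measure. boundary_fun g \<zeta> = bdry x \<zeta>"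
proof -
  let ?P = "\<lambda>G. G \<in> L2_circle \<and>
     ((\<lambda>r::real. LINT \<zeta>|circle_measure. (norm (g (of_real r * \<zeta>) - G \<zeta>))\<^sup>2) \<longlongrightarrow> 0) (at_left 1)"
  have ev: "\<forall>\<^sub>F r in at_left 1. (LINT \<zeta>|circle_measure. (norm (g (of_real r * \<zeta>) - G \<zeta>))\<^sup>2)
      = (LINT \<zeta>|circle_measure. (norm (hfun x (of_real r * \<zeta>) - G \<zeta>))\<^sup>2)" for G
    using eventually_at_left_1
  proof eventually_elim
    case (elim r)
    then show ?case by (intro Bochner_Integration.integral_cong) (auto simp: norm_mult g)
  qed
  have "?P (bdry x)"
    using hfun_dilate_tendsto_bdry[of x] by (simp add: L2_circle_iff bdry tendsto_cong[OF ev])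
  then have P: "?P (boundary_fun g)" unfolding boundary_fun_def by (rule someI[of ?P])
  then show sq: "sq_integrable circle_measure (boundary_fun g)" by (simp add: L2_circle_iff)
  have lim: "((\<lambda>r. LINT \<zeta>|circle_measure. (norm (hfun x (of_real r * \<zeta>) - boundary_fun g \<zeta>))\<^sup>2) \<longlongrightarrow> 0) (at_left 1)"
    using P by (simp add: tendsto_cong[OF ev])
  have one: "sq_integrable circle_measure (\<lambda>_. 1)" by (intro sq_integrable_circle continuous_intros)
  have i: "integrable circle_measure F" if "sq_integrable circle_measure F" for F
    using integrable_mult_sq_integrable[OF that one] by simp
  have evsq: "\<forall>\<^sub>F r in at_left 1. sq_integrable circle_measure (\<lambda>\<zeta>. hfun x (of_real r * \<zeta>))"
    using eventually_at_left_1 by eventually_elim (simp add: sq_integrable_hfun_dilate)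
  have L1: "((\<lambda>r. LINT \<zeta>|circle_measure. norm (hfun x (of_real r * \<zeta>) - G \<zeta>)) \<longlongrightarrow> 0) (at_left 1)"
    if "sq_integrable circle_measure G"
      "((\<lambda>r. LINT \<zeta>|circle_measure. (norm (hfun x (of_real r * \<zeta>) - G \<zeta>))\<^sup>2) \<longlongrightarrow> 0) (at_left 1)" for G
    using tendsto_L1_mult[OF that(1) one evsq _ that(2), where GG="\<lambda>_ _. 1"] by (simp add: one)
  show "AE \<zeta> in circle_measure. boundary_fun g \<zeta> = bdry x \<zeta>"
    by (rule AE_eq_of_L1_limits[OF _ i[OF sq] i[OF bdry(1)] L1[OF sq lim] L1[OF bdry(1) hfun_dilate_tendsto_bdry]])
      (use evsq in \<open>auto elim!: eventually_mono intro: i\<close>)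
qed

text \<open>Asking for integrability of the products avoids an essential bound on the boundary
  function of a symbol. Uniqueness holds because \<open>cinner\<close>, through its real part,
  separates vectors.\<close>

lemma P_plus_eqI:
  assumes int: "\<And>y. integrable circle_measure (\<lambda>\<zeta>. F \<zeta> * cnj (bdry y \<zeta>))"
    and F: "F \<in> borel_measurable circle_measure"
    and eq: "\<And>y. (LINT \<zeta>|circle_measure. F \<zeta> * cnj (bdry y \<zeta>)) = cinner h y"
  shows "P_plus F = hfun h"
  unfolding P_plus_def
proof (rule the_equality)
  have key: "L2_inner (\<lambda>\<zeta>. F \<zeta> - boundary_fun (hfun x) \<zeta>) (boundary_fun (hfun y)) = cinner h y - cinner x y" for x y
  proof -
    note [measurable] = F sq_integrable_measurable[OF bdry(1)]
      sq_integrable_measurable[OF boundary_fun_bdry(1)[of "hfun _", OF refl]]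
      sq_integrable_measurable[OF sq_integrable_cnj[OF boundary_fun_bdry(1)[of "hfun _", OF refl]]]
      sq_integrable_measurable[OF sq_integrable_cnj[OF bdry(1)]]
    have i: "integrable circle_measure (\<lambda>\<zeta>. bdry x \<zeta> * cnj (bdry y \<zeta>))"
      by (intro integrable_mult_sq_integrable sq_integrable_cnj bdry)
    have "L2_inner (\<lambda>\<zeta>. F \<zeta> - boundary_fun (hfun x) \<zeta>) (boundary_fun (hfun y))
        = (LINT \<zeta>|circle_measure. F \<zeta> * cnj (bdry y \<zeta>) - bdry x \<zeta> * cnj (bdry y \<zeta>))"
      unfolding L2_inner_def
    proof (rule integral_cong_AE)
      show "AE \<zeta> in circle_measure. (F \<zeta> - boundary_fun (hfun x) \<zeta>) * cnj (boundary_fun (hfun y) \<zeta>)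
          = F \<zeta> * cnj (bdry y \<zeta>) - bdry x \<zeta> * cnj (bdry y \<zeta>)"
        using boundary_fun_bdry(2)[of "hfun x", OF refl] boundary_fun_bdry(2)[of "hfun y", OF refl]
        by eventually_elim (simp add: left_diff_distrib)
    qed measurable
    also have "\<dots> = cinner h y - cinner x y"
      by (simp only: Bochner_Integration.integral_diff int i eq bdry_inner)
    finally show ?thesis .
  qed
  show "hfun h \<in> H2 \<and> (\<forall>k\<in>H2. L2_inner (\<lambda>\<zeta>. F \<zeta> - boundary_fun (hfun h) \<zeta>) (boundary_fun k) = 0)"
    by (auto simp: hfun_in_H2 key elim!: H2_hfun)
  fix g assume g: "g \<in> H2 \<and> (\<forall>k\<in>H2. L2_inner (\<lambda>\<zeta>. F \<zeta> - boundary_fun g \<zeta>) (boundary_fun k) = 0)"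
  then obtain x where x: "g = hfun x" using H2_hfun by blast
  have "cinner h y = cinner x y" for y
    using g hfun_in_H2[of y] key[of x y] by (simp add: x)
  then have "inner h y = inner x y" for y by (simp add: cinner_eq)
  then have "h = x" using vector_eq_rdot by blast
  then show "g = hfun h" by (simp add: x)
qed

section \<open>Multiplication and Toeplitz operators\<close>

lemma summable_norm_imp_l2:
  fixes a :: "nat \<Rightarrow> complex"
  assumes "summable (\<lambda>n. norm (a n))"
  shows "summable (\<lambda>n. (norm (a n))\<^sup>2)"
proof (rule summable_comparison_test_ev[OF _ assms])
  have "\<forall>\<^sub>F n in sequentially. norm (a n) < 1"
    using summable_LIMSEQ_zero[OF assms] by (rule order_tendstoD) simp
  then show "\<forall>\<^sub>F n in sequentially. norm ((norm (a n))\<^sup>2) \<le> norm (a n)"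
    by eventually_elim (simp add: power2_eq_square mult_left_le_one_le)
qed

lemma bdry_norm: "(LINT \<zeta>|circle_measure. (norm (bdry x \<zeta>))\<^sup>2) = (norm x)\<^sup>2"
  unfolding integral_norm_sq bdry_inner by (simp add: cinner_eq power2_norm_eq_inner)

text \<open>Parseval on the circle of radius \<open>r\<close> bounds the sum with weights
  \<open>r ^ (2 n)\<close>; as the sum is finite, \<open>r\<close> may tend to 1.\<close>

lemma taylor_coeff_l2_bound:
  assumes g: "g holomorphic_on ball 0 1"
    and B: "\<And>r. 0 < r \<Longrightarrow> r < 1 \<Longrightarrow> (LINT \<zeta>|circle_measure. (norm (g (of_real r * \<zeta>)))\<^sup>2) \<le> B"
  shows "(\<Sum>n<N. (norm (taylor_coeff g n))\<^sup>2) \<le> B"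
proof (rule tendsto_upperbound)
  let ?c = "taylor_coeff g"
  have "((\<lambda>r. \<Sum>n<N. (norm (of_real (r ^ n) * ?c n))\<^sup>2) \<longlongrightarrow> (\<Sum>n<N. (norm (of_real (1 ^ n) * ?c n))\<^sup>2)) (at_left 1)"
    by (intro tendsto_intros)
  then show "((\<lambda>r. \<Sum>n<N. (norm (of_real (r ^ n) * ?c n))\<^sup>2) \<longlongrightarrow> (\<Sum>n<N. (norm (?c n))\<^sup>2)) (at_left 1)"
    by simp
  show "\<forall>\<^sub>F r in at_left 1. (\<Sum>n<N. (norm (of_real (r ^ n) * ?c n))\<^sup>2) \<le> B"
    using eventually_at_left_1
  proof eventually_elim
    case (elim r)
    \<comment> \<open>Convergence at the larger radius \<open>s\<close> yields absolute convergence
      at \<open>r\<close>.\<close>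
    define s where "s = (1 + r) / 2"
    have s: "norm (of_real r :: complex) < norm (of_real s :: complex)" "norm (of_real s :: complex) < 1"
      unfolding norm_of_real using elim by (auto simp: s_def)
    have "summable (\<lambda>n. norm (?c n * of_real r ^ n))"
      by (rule powser_insidea[OF sums_summable[OF sums_taylor_coeff[OF g s(2)]] s(1)])
    then have sm: "summable (\<lambda>n. norm (of_real (r ^ n) * ?c n))" by (simp add: mult.commute)
    obtain y where y: "coord y = (\<lambda>n. of_real (r ^ n) * ?c n)"
      using Abs_ell2_inverse[of "\<lambda>n. of_real (r ^ n) * ?c n"] summable_norm_imp_l2[OF sm] by blast
    have AE: "AE \<zeta> in circle_measure. bdry y \<zeta> = g (of_real r * \<zeta>)"
      using bdry_eq_of_summable[of y, unfolded y, OF sm] AE_space[of circle_measure]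
    proof eventually_elim
      case (elim \<zeta>)
      have "norm (of_real r * \<zeta>) < 1" using elim \<open>0 < r \<and> r < 1\<close> by (simp add: norm_mult)
      from sums_taylor_coeff[OF g this] show ?case
        using elim by (simp add: sums_iff power_mult_distrib mult_ac)
    qed
    have [measurable]: "(\<lambda>\<zeta>. g (of_real r * \<zeta>)) \<in> borel_measurable circle_measure"
      by (intro measurable_circle continuous_on_compose2[OF holomorphic_on_imp_continuous_on[OF g]] continuous_intros)
        (use elim in \<open>auto simp: norm_mult\<close>)
    note [measurable] = sq_integrable_measurable[OF bdry(1)[of y]]
    have "(\<Sum>n<N. (norm (of_real (r ^ n) * ?c n))\<^sup>2) \<le> (norm y)\<^sup>2"
      using sum_coord_le[of y N] by (simp add: y)
    also have "\<dots> = (LINT \<zeta>|circle_measure. (norm (g (of_real r * \<zeta>)))\<^sup>2)"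
      unfolding bdry_norm[symmetric]
    proof (rule integral_cong_AE)
      show "AE \<zeta> in circle_measure. (norm (bdry y \<zeta>))\<^sup>2 = (norm (g (of_real r * \<zeta>)))\<^sup>2"
        using AE by eventually_elim simp
    qed measurable
    also have "\<dots> \<le> B" using elim by (intro B) auto
    finally show ?case .
  qed
qed simp

definition mult_op :: "(complex \<Rightarrow> complex) \<Rightarrow> ell2 \<Rightarrow> ell2" where
  "mult_op \<phi> x = Abs_ell2 (taylor_coeff (\<lambda>z. \<phi> z * hfun x z))"

text \<open>The choice is justified by \<open>adjoint_exists\<close> when
  \<open>mult_op \<phi>\<close> is bounded. The adjoint refers to the real inner product.\<close>

definition mult_op_adj :: "(complex \<Rightarrow> complex) \<Rightarrow> ell2 \<Rightarrow> ell2" where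
  "mult_op_adj \<phi> = (SOME W. bounded_linear W \<and> (\<forall>x y. inner (mult_op \<phi> x) y = inner x (W y)))"

lemma scaleR_eq_cscale: "r *\<^sub>R x = cscale (of_real r) x"
  by (rule ell2_eqI) (simp add: scaleR_conv_of_real)

lemma hfun_scaleR: "hfun (r *\<^sub>R x) z = of_real r * hfun x z"
  by (simp add: scaleR_eq_cscale hfun_cscale)

lemma hfun_diff: "hfun (x - y) z = hfun x z - hfun y z"
  using hfun_add[of "x - y" y z] by simp

lemma hfun_eqI: "(\<And>z. norm z < 1 \<Longrightarrow> hfun x z = hfun y z) \<Longrightarrow> x = y"
  by (metis hfun_inject ext hfun_outside)

lift_definition ebasis :: "nat \<Rightarrow> ell2" is "\<lambda>k n. if n = k then 1 else 0"
  by (rule summable_finite[of "{_}"]) auto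

lemma coord_ebasis [simp]: "coord (ebasis k) n = (if n = k then 1 else 0)"
  by transfer simp

lemma hfun_ebasis: "norm z < 1 \<Longrightarrow> hfun (ebasis k) z = z ^ k"
  using sums_unique2[OF hfun_sums[of z "ebasis k"] sums_finite[of "{k}" "\<lambda>n. coord (ebasis k) n * z ^ n"]]
  by simp

locale bounded_holomorphic =
  fixes \<phi> :: "complex \<Rightarrow> complex" and C :: real
  assumes hol: "\<phi> holomorphic_on ball 0 1"
    and bound: "\<And>z. norm z < 1 \<Longrightarrow> norm (\<phi> z) \<le> C"
begin

lemma C_nonneg: "0 \<le> C"
  using bound[of 0] norm_ge_zero[of "\<phi> 0"] by (simp del: norm_ge_zero)

lemma hol_mult: "(\<lambda>z. \<phi> z * hfun x z) holomorphic_on ball 0 1"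
  by (intro holomorphic_intros hol holomorphic_hfun)

lemma dilate_bound:
  assumes r: "0 < r" "r < 1"
  shows "(LINT \<zeta>|circle_measure. (norm (\<phi> (of_real r * \<zeta>) * hfun x (of_real r * \<zeta>)))\<^sup>2) \<le> (C * norm x)\<^sup>2"
proof -
  have r': "0 \<le> r" "r < 1" "r \<le> 1" using r by auto
  have sq: "sq_integrable circle_measure (\<lambda>\<zeta>. \<phi> (of_real r * \<zeta>) * hfun x (of_real r * \<zeta>))"
    by (intro sq_integrable_circle continuous_on_compose2[OF holomorphic_on_imp_continuous_on[OF hol_mult]]
      continuous_intros) (use r in \<open>auto simp: norm_mult\<close>)
  note [measurable] = sq_integrable_measurable[OF bdry(1)[of "dilate r x"]] sq_integrable_measurable[OF sq_integrable_hfun_dilate[OF r'(1,2)]]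
  have "(LINT \<zeta>|circle_measure. (norm (\<phi> (of_real r * \<zeta>) * hfun x (of_real r * \<zeta>)))\<^sup>2)
      \<le> (LINT \<zeta>|circle_measure. C\<^sup>2 * (norm (hfun x (of_real r * \<zeta>)))\<^sup>2)"
  proof (rule integral_mono)
    fix \<zeta> assume "\<zeta> \<in> space circle_measure"
    then have "norm (of_real r * \<zeta>) < 1" using r by (simp add: norm_mult)
    then show "(norm (\<phi> (of_real r * \<zeta>) * hfun x (of_real r * \<zeta>)))\<^sup>2 \<le> C\<^sup>2 * (norm (hfun x (of_real r * \<zeta>)))\<^sup>2"
      unfolding power_mult_distrib[symmetric] norm_mult
      by (intro power_mono mult_right_mono bound) (auto simp: norm_mult)
  qed (intro integrable_mult_right sq_integrable_integrable sq sq_integrable_hfun_dilate[OF r'(1,2)])+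
  also have "\<dots> = C\<^sup>2 * (LINT \<zeta>|circle_measure. (norm (hfun x (of_real r * \<zeta>)))\<^sup>2)" by simp
  also have "(LINT \<zeta>|circle_measure. (norm (hfun x (of_real r * \<zeta>)))\<^sup>2) = (norm (dilate r x))\<^sup>2"
    unfolding bdry_norm[symmetric]
  proof (rule integral_cong_AE)
    show "AE \<zeta> in circle_measure. (norm (hfun x (of_real r * \<zeta>)))\<^sup>2 = (norm (bdry (dilate r x) \<zeta>))\<^sup>2"
      using bdry_dilate[OF r'(1,2), of x] by eventually_elim simp
  qed measurable
  also have "\<dots> \<le> (norm x)\<^sup>2" by (intro power_mono norm_dilate_le r') auto
  finally show ?thesis by (simp add: power_mult_distrib mult_left_mono)
qed

lemma coord_mult: "coord (mult_op \<phi> x) = taylor_coeff (\<lambda>z. \<phi> z * hfun x z)"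
  unfolding mult_op_def
  by (rule Abs_ell2_inverse) (use l2_of_partial_sums(1)[OF taylor_coeff_l2_bound[OF hol_mult dilate_bound]] in blast)

lemma hfun_mult: "norm z < 1 \<Longrightarrow> hfun (mult_op \<phi> x) z = \<phi> z * hfun x z"
  using sums_unique2[OF hfun_sums[of z "mult_op \<phi> x"] sums_taylor_coeff[OF hol_mult, of z x, folded coord_mult]] .

lemma norm_mult_le: "norm (mult_op \<phi> x) \<le> C * norm x"
proof -
  have "(norm (mult_op \<phi> x))\<^sup>2 \<le> (C * norm x)\<^sup>2"
    unfolding norm_ell2_sq[of "mult_op \<phi> x"] coord_mult
    by (rule l2_of_partial_sums(2)[OF taylor_coeff_l2_bound[OF hol_mult dilate_bound]])
  then show ?thesis by (rule power2_le_imp_le) (simp add: C_nonneg)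
qed

lemma mult_cscale: "mult_op \<phi> (cscale c x) = cscale c (mult_op \<phi> x)"
  by (rule hfun_eqI) (simp add: hfun_mult hfun_cscale)

lemma bounded_linear_mult: "bounded_linear (mult_op \<phi>)"
proof (rule bounded_linear_intro[where K=C])
  show "mult_op \<phi> (x + y) = mult_op \<phi> x + mult_op \<phi> y" for x y
    by (rule hfun_eqI) (simp add: hfun_mult hfun_add distrib_left)
  show "mult_op \<phi> (r *\<^sub>R x) = r *\<^sub>R mult_op \<phi> x" for r x
    unfolding scaleR_eq_cscale by (rule mult_cscale)
  show "norm (mult_op \<phi> x) \<le> norm x * C" for x using norm_mult_le[of x] by (simp add: mult.commute)
qed

lemma bounded_linear_mult_adj: "bounded_linear (mult_op_adj \<phi>)"
  and inner_mult: "inner (mult_op \<phi> x) y = inner x (mult_op_adj \<phi> y)"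
proof -
  have *: "bounded_linear (mult_op_adj \<phi>) \<and> (\<forall>x y. inner (mult_op \<phi> x) y = inner x (mult_op_adj \<phi> y))"
    unfolding mult_op_adj_def by (rule someI_ex[OF adjoint_exists[OF bounded_linear_mult]])
  show "bounded_linear (mult_op_adj \<phi>)" by (rule conjunct1[OF *])
  show "inner (mult_op \<phi> x) y = inner x (mult_op_adj \<phi> y)" using conjunct2[OF *] by blast
qed

lemma inner_mult_adj: "inner (mult_op_adj \<phi> x) y = inner x (mult_op \<phi> y)"
  by (metis inner_mult inner_commute)

text \<open>The adjoint was built over the reals, so complex linearity needs proof:
  \<open>cscale \<i>\<close> is skew-adjoint and commutes with \<open>mult_op \<phi>\<close>, and
  the two signs cancel.\<close>

lemma mult_adj_cscale_i: "mult_op_adj \<phi> (cscale \<i> x) = cscale \<i> (mult_op_adj \<phi> x)"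
proof (rule vector_eq_ldot[THEN iffD1], rule allI)
  fix z
  have "inner z (mult_op_adj \<phi> (cscale \<i> x)) = - inner (cscale \<i> (mult_op \<phi> z)) x"
    by (simp add: inner_mult[symmetric] inner_cscale_i)
  also have "\<dots> = - inner (mult_op \<phi> (cscale \<i> z)) x" by (simp add: mult_cscale)
  also have "\<dots> = inner z (cscale \<i> (mult_op_adj \<phi> x))" by (simp add: inner_mult inner_cscale_i)
  finally show "inner z (mult_op_adj \<phi> (cscale \<i> x)) = inner z (cscale \<i> (mult_op_adj \<phi> x))" .
qed

lemma mult_adj_cscale: "mult_op_adj \<phi> (cscale c x) = cscale c (mult_op_adj \<phi> x)"
proof -
  interpret bounded_linear "mult_op_adj \<phi>" by (rule bounded_linear_mult_adj)
  show ?thesis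
    by (subst (1 2) cscale_decomp) (simp add: add scaleR mult_adj_cscale_i)
qed

lemma cinner_mult_adj: "cinner (mult_op_adj \<phi> x) y = cinner x (mult_op \<phi> y)"
  using inner_mult_adj[of x y] inner_mult_adj[of x "cscale \<i> y"] by (simp add: cinner_eq mult_cscale)

lemma norm_mult_adj_le: "norm (mult_op_adj \<phi> x) \<le> C * norm x"
proof (cases "norm (mult_op_adj \<phi> x) = 0")
  case False
  have "(norm (mult_op_adj \<phi> x))\<^sup>2 = inner (mult_op \<phi> (mult_op_adj \<phi> x)) x"
    by (simp add: power2_norm_eq_inner inner_mult)
  also have "\<dots> \<le> norm (mult_op \<phi> (mult_op_adj \<phi> x)) * norm x" by (rule norm_cauchy_schwarz)
  also have "\<dots> \<le> (C * norm (mult_op_adj \<phi> x)) * norm x" by (intro mult_right_mono norm_mult_le) auto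
  finally show ?thesis using False by (simp add: power2_eq_square mult_ac)
qed (simp add: C_nonneg)

lemma boundary_fun_symbol: "sq_integrable circle_measure (boundary_fun \<phi>)"
  and boundary_fun_symbol_bdry: "AE \<zeta> in circle_measure. boundary_fun \<phi> \<zeta> = bdry (mult_op \<phi> (ebasis 0)) \<zeta>"
  using boundary_fun_bdry[of \<phi> "mult_op \<phi> (ebasis 0)"] by (auto simp: hfun_mult hfun_ebasis)

text \<open>Both sides are L1 limits of the same products of dilates. The symbol enters as the
  \<open>H2\<close> function \<open>mult_op \<phi> (ebasis 0)\<close>, that is,
  \<open>\<phi>\<close> times the constant 1.\<close>

lemma bdry_mult: "AE \<zeta> in circle_measure. boundary_fun \<phi> \<zeta> * bdry x \<zeta> = bdry (mult_op \<phi> x) \<zeta>"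
proof -
  let ?b = "mult_op \<phi> (ebasis 0)"
  let ?F = "\<lambda>r \<zeta>. hfun ?b (of_real r * \<zeta>) * hfun x (of_real r * \<zeta>)"
  have evsq: "\<forall>\<^sub>F r in at_left 1. sq_integrable circle_measure (\<lambda>\<zeta>. hfun y (of_real r * \<zeta>))" for y
    using eventually_at_left_1 by eventually_elim (simp add: sq_integrable_hfun_dilate)
  have one: "sq_integrable circle_measure (\<lambda>_. 1)" by (intro sq_integrable_circle continuous_intros)
  have lim1: "((\<lambda>r. LINT \<zeta>|circle_measure. norm (?F r \<zeta> - bdry ?b \<zeta> * bdry x \<zeta>)) \<longlongrightarrow> 0) (at_left 1)"
    by (intro tendsto_L1_mult bdry evsq hfun_dilate_tendsto_bdry)
  have "((\<lambda>r. LINT \<zeta>|circle_measure. norm (hfun (mult_op \<phi> x) (of_real r * \<zeta>) - bdry (mult_op \<phi> x) \<zeta>)) \<longlongrightarrow> 0) (at_left 1)"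
    using tendsto_L1_mult[OF bdry(1) one evsq _ hfun_dilate_tendsto_bdry, where GG="\<lambda>_ _. 1"] by (simp add: one)
  moreover have "\<forall>\<^sub>F r in at_left 1. (LINT \<zeta>|circle_measure. norm (hfun (mult_op \<phi> x) (of_real r * \<zeta>) - bdry (mult_op \<phi> x) \<zeta>))
      = (LINT \<zeta>|circle_measure. norm (?F r \<zeta> - bdry (mult_op \<phi> x) \<zeta>))"
    using eventually_at_left_1
  proof eventually_elim
    case (elim r)
    then show ?case
      by (intro Bochner_Integration.integral_cong) (auto simp: norm_mult hfun_mult hfun_ebasis)
  qed
  ultimately have lim2: "((\<lambda>r. LINT \<zeta>|circle_measure. norm (?F r \<zeta> - bdry (mult_op \<phi> x) \<zeta>)) \<longlongrightarrow> 0) (at_left 1)"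
    by (simp add: tendsto_cong)
  have "AE \<zeta> in circle_measure. bdry ?b \<zeta> * bdry x \<zeta> = bdry (mult_op \<phi> x) \<zeta>"
  proof (rule AE_eq_of_L1_limits[OF _ _ _ lim1 lim2])
    show "\<forall>\<^sub>F r in at_left 1. integrable circle_measure (?F r)"
      using evsq[of ?b] evsq[of x] by eventually_elim (rule integrable_mult_sq_integrable)
    show "integrable circle_measure (\<lambda>\<zeta>. bdry ?b \<zeta> * bdry x \<zeta>)" by (intro integrable_mult_sq_integrable bdry)
    show "integrable circle_measure (bdry (mult_op \<phi> x))" using integrable_mult_sq_integrable[OF bdry(1) one] by simp
  qed simp
  then show ?thesis using boundary_fun_symbol_bdry by eventually_elim simp
qed

text \<open>By \<open>bdry_mult\<close> the product is already the boundary function of an element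
  of \<open>H2\<close>, so projecting changes nothing.\<close>

lemma toeplitz_analytic: "toeplitz (boundary_fun \<phi>) (hfun x) = hfun (mult_op \<phi> x)"
  unfolding toeplitz_def
proof (rule P_plus_eqI)
  note m = borel_measurable_times[OF sq_integrable_measurable[OF boundary_fun_symbol]
    sq_integrable_measurable[OF boundary_fun_bdry(1)[of "hfun x", OF refl]]]
  show "(\<lambda>\<zeta>. boundary_fun \<phi> \<zeta> * boundary_fun (hfun x) \<zeta>) \<in> borel_measurable circle_measure" by (rule m)
  note m1 = borel_measurable_times[OF m sq_integrable_measurable[OF sq_integrable_cnj[OF bdry(1)]]]
  note m2 = borel_measurable_times[OF sq_integrable_measurable[OF bdry(1)] sq_integrable_measurable[OF sq_integrable_cnj[OF bdry(1)]]]
  have AE: "AE \<zeta> in circle_measure. boundary_fun \<phi> \<zeta> * boundary_fun (hfun x) \<zeta> * cnj (bdry y \<zeta>)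
      = bdry (mult_op \<phi> x) \<zeta> * cnj (bdry y \<zeta>)" for y
    using bdry_mult[of x] boundary_fun_bdry(2)[of "hfun x", OF refl] by eventually_elim simp
  show "integrable circle_measure (\<lambda>\<zeta>. boundary_fun \<phi> \<zeta> * boundary_fun (hfun x) \<zeta> * cnj (bdry y \<zeta>))" for y
    unfolding integrable_cong_AE[OF m1 m2 AE]
    by (intro integrable_mult_sq_integrable sq_integrable_cnj bdry)
  show "(LINT \<zeta>|circle_measure. boundary_fun \<phi> \<zeta> * boundary_fun (hfun x) \<zeta> * cnj (bdry y \<zeta>)) = cinner (mult_op \<phi> x) y" for y
    unfolding integral_cong_AE[OF m1 m2 AE] by (rule bdry_inner)
qed

text \<open>Tested against \<open>y\<close>, the conjugated symbol moves to the other factor, where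
  \<open>bdry_mult\<close> applies; what remains is the Hermitian product of \<open>x\<close> with
  \<open>mult_op \<phi> y\<close>.\<close>

lemma toeplitz_coanalytic: "toeplitz (\<lambda>\<zeta>. cnj (boundary_fun \<phi> \<zeta>)) (hfun x) = hfun (mult_op_adj \<phi> x)"
  unfolding toeplitz_def
proof (rule P_plus_eqI)
  note m = borel_measurable_times[OF sq_integrable_measurable[OF sq_integrable_cnj[OF boundary_fun_symbol]]
    sq_integrable_measurable[OF boundary_fun_bdry(1)[of "hfun x", OF refl]]]
  show "(\<lambda>\<zeta>. cnj (boundary_fun \<phi> \<zeta>) * boundary_fun (hfun x) \<zeta>) \<in> borel_measurable circle_measure" by (rule m)
  note m1 = borel_measurable_times[OF m sq_integrable_measurable[OF sq_integrable_cnj[OF bdry(1)]]]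
  note m2 = borel_measurable_times[OF sq_integrable_measurable[OF bdry(1)] sq_integrable_measurable[OF sq_integrable_cnj[OF bdry(1)]]]
  have AE: "AE \<zeta> in circle_measure. cnj (boundary_fun \<phi> \<zeta>) * boundary_fun (hfun x) \<zeta> * cnj (bdry y \<zeta>)
      = bdry x \<zeta> * cnj (bdry (mult_op \<phi> y) \<zeta>)" for y
    using bdry_mult[of y] boundary_fun_bdry(2)[of "hfun x", OF refl]
    by eventually_elim (simp flip: complex_cnj_mult)
  show "integrable circle_measure (\<lambda>\<zeta>. cnj (boundary_fun \<phi> \<zeta>) * boundary_fun (hfun x) \<zeta> * cnj (bdry y \<zeta>))" for y
    unfolding integrable_cong_AE[OF m1 m2 AE]
    by (intro integrable_mult_sq_integrable sq_integrable_cnj bdry)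
  show "(LINT \<zeta>|circle_measure. cnj (boundary_fun \<phi> \<zeta>) * boundary_fun (hfun x) \<zeta> * cnj (bdry y \<zeta>)) = cinner (mult_op_adj \<phi> x) y" for y
    unfolding integral_cong_AE[OF m1 m2 AE] bdry_inner by (rule cinner_mult_adj[symmetric])
qed

end

section \<open>Norms in de Branges--Rovnyak spaces\<close>

lemma inv_hfun [simp]: "inv hfun (hfun x) = x"
  by (rule inv_f_f) (auto intro: injI simp: hfun_inject)

lemma hfun_zero: "hfun 0 = (\<lambda>z. 0)"
  by (rule ext) (simp add: hfun_def)

lemma cinner_in_nonneg_Reals_iff:
  "cinner y x \<in> \<real>\<^sub>\<ge>\<^sub>0 \<longleftrightarrow> 0 \<le> inner y x \<and> inner y (cscale \<i> x) = 0"
  by (simp add: cinner_eq complex_nonneg_Reals_iff)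

locale schur_function = bounded_holomorphic \<phi> 1 for \<phi>
begin

lemma defect_op:
  "(\<lambda>z. hfun x z - toeplitz (boundary_fun \<phi>) (toeplitz (\<lambda>\<zeta>. cnj (boundary_fun \<phi> \<zeta>)) (hfun x)) z)
    = hfun (x - mult_op \<phi> (mult_op_adj \<phi> x))"
  by (rule ext) (simp add: toeplitz_analytic toeplitz_coanalytic hfun_diff)

text \<open>Once some root is exhibited, \<open>SOME\<close> hands the whole predicate to
  \<open>dBR_op\<close>, and later arguments rest on that predicate. The root comes from
  \<open>positive_sqrt_exists\<close>, transported by \<open>hfun\<close>.\<close>

lemma positive_sqrt_op:
  "is_positive_sqrt
     (\<lambda>g z. g z - toeplitz (boundary_fun \<phi>) (toeplitz (\<lambda>\<zeta>. cnj (boundary_fun \<phi> \<zeta>)) g) z) (dBR_op \<phi>)"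
proof -
  let ?A = "\<lambda>g z. g z - toeplitz (boundary_fun \<phi>) (toeplitz (\<lambda>\<zeta>. cnj (boundary_fun \<phi> \<zeta>)) g) z"
  define T where "T x = mult_op \<phi> (mult_op_adj \<phi> x)" for x
  have T: "bounded_linear T"
    unfolding T_def by (rule bounded_linear_compose[OF bounded_linear_mult bounded_linear_mult_adj])
  have contr: "norm (T x) \<le> norm x" for x
    unfolding T_def using norm_mult_le[of "mult_op_adj \<phi> x"] norm_mult_adj_le[of x] by simp
  have symm: "inner (T x) y = inner x (T y)" for x y
    by (simp only: T_def inner_mult) (simp only: inner_mult_adj)
  obtain S where S: "bounded_linear S" and SS: "\<And>x. S (S x) = x - T x" and pos: "\<And>x. 0 \<le> inner (S x) x"
    and sym: "\<And>x y. inner (S x) y = inner x (S y)"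
    and comm: "\<And>R x. bounded_linear R \<Longrightarrow> \<forall>x. R (T x) = T (R x) \<Longrightarrow> R (S x) = S (R x)"
  proof (rule positive_sqrt_exists[OF T contr symm])
    fix S assume "bounded_linear S" "\<And>x. S (S x) = x - T x" "\<And>x. 0 \<le> inner (S x) x"
      "\<And>x y. inner (S x) y = inner x (S y)"
      and comm: "\<And>R x. bounded_linear R \<Longrightarrow> \<forall>x. R (T x) = T (R x) \<Longrightarrow> R (S x) = S (R x)"
    then show thesis by (rule that)
  qed
  interpret S: bounded_linear S by fact
  have Sc: "S (cscale c x) = cscale c (S x)" for c x
    by (rule comm[OF bounded_linear_cscale, symmetric]) (simp add: T_def mult_cscale mult_adj_cscale)
  \<comment> \<open>The predicate demands that the Hermitian product of \<open>S x\<close> and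
    \<open>x\<close> be real. Its imaginary part, by symmetry and complex linearity, equals its own
    negative.\<close>
  have im: "inner (S x) (cscale \<i> x) = 0" for x
  proof -
    have "inner (S x) (cscale \<i> x) = inner x (cscale \<i> (S x))" by (simp add: sym Sc)
    also have "\<dots> = - inner (S x) (cscale \<i> x)"
      using inner_cscale_i[of x "S x"] by (simp add: inner_commute)
    finally show ?thesis by simp
  qed
  have "is_positive_sqrt ?A (\<lambda>g. hfun (S (inv hfun g)))"
    unfolding is_positive_sqrt_def
  proof (intro conjI ballI allI)
    show "hfun (S (inv hfun g)) \<in> H2" for g by (rule hfun_in_H2)
    show "hfun (S (inv hfun (\<lambda>z. c * g z + d * h z))) = (\<lambda>z. c * hfun (S (inv hfun g)) z + d * hfun (S (inv hfun h)) z)"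
      if g: "g \<in> H2" and h: "h \<in> H2" for g h c d
    proof -
      obtain x y where x: "g = hfun x" "h = hfun y" using H2_hfun[OF g] H2_hfun[OF h] by metis
      have "(\<lambda>z. c * g z + d * h z) = hfun (cscale c x + cscale d y)"
        by (rule ext) (simp add: x hfun_add hfun_cscale)
      then show ?thesis
        by (intro ext) (simp add: x S.add Sc hfun_add hfun_cscale)
    qed
    obtain K where K: "\<And>x. norm (S x) \<le> norm x * K" using S.bounded by blast
    show "\<exists>C. \<forall>g\<in>H2. H2_norm (hfun (S (inv hfun g))) \<le> C * H2_norm g"
    proof (intro exI ballI)
      fix g assume "g \<in> H2"
      then obtain x where "g = hfun x" by (rule H2_hfun)
      then show "H2_norm (hfun (S (inv hfun g))) \<le> K * H2_norm g"
        using K[of x] by (simp add: H2_norm_hfun mult.commute)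
    qed
    show "H2_inner (hfun (S (inv hfun g))) g \<in> \<real>\<^sub>\<ge>\<^sub>0" if "g \<in> H2" for g
      using H2_hfun[OF that] by (metis H2_inner_hfun inv_hfun cinner_in_nonneg_Reals_iff pos im)
    show "hfun (S (inv hfun (hfun (S (inv hfun g))))) = ?A g" if g: "g \<in> H2" for g
    proof -
      obtain x where x: "g = hfun x" using H2_hfun[OF g] .
      show ?thesis unfolding x inv_hfun SS T_def defect_op ..
    qed
  qed
  then show ?thesis unfolding dBR_op_def positive_sqrt_def by (rule someI[of "is_positive_sqrt ?A"])
qed

text \<open>
  The hypotheses say that \<open>p\<close> is bounded with respect to the seminorm of the square root, so that
  Riesz representation on its range puts \<open>p\<close> into the range, and that the square root is injective.
\<close>

lemma dBR_norm_ge: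
  assumes p: "\<And>x. (inner x p)\<^sup>2 \<le> K * ((norm x)\<^sup>2 - (norm (mult_op_adj \<phi> x))\<^sup>2)"
    and inj: "\<And>x. norm (mult_op_adj \<phi> x) = norm x \<Longrightarrow> x = 0"
  shows "norm p \<le> dBR_norm \<phi> (hfun p)"
proof -
  define S where "S x = inv hfun (dBR_op \<phi> (hfun x))" for x
  note sq = positive_sqrt_op[unfolded is_positive_sqrt_def]
  have op: "dBR_op \<phi> (hfun x) = hfun (S x)" for x
  proof -
    have "dBR_op \<phi> (hfun x) \<in> H2" using sq hfun_in_H2 by blast
    then obtain y where "dBR_op \<phi> (hfun x) = hfun y" by (rule H2_hfun)
    then show ?thesis by (simp add: S_def)
  qed
  have lin: "S (cscale c x + cscale d y) = cscale c (S x) + cscale d (S y)" for c d x y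
  proof -
    have "dBR_op \<phi> (\<lambda>z. c * hfun x z + d * hfun y z) = (\<lambda>z. c * dBR_op \<phi> (hfun x) z + d * dBR_op \<phi> (hfun y) z)"
      using sq[THEN conjunct2, THEN conjunct1] hfun_in_H2[of x] hfun_in_H2[of y] by blast
    moreover have "(\<lambda>z. c * hfun x z + d * hfun y z) = hfun (cscale c x + cscale d y)"
      by (rule ext) (simp add: hfun_add hfun_cscale)
    moreover have "(\<lambda>z. c * hfun (S x) z + d * hfun (S y) z) = hfun (cscale c (S x) + cscale d (S y))"
      by (rule ext) (simp add: hfun_add hfun_cscale)
    ultimately show ?thesis by (simp add: op hfun_inject)
  qed
  have c1: "cscale 1 x = x" and c0: "cscale 0 x = 0" for x by (auto intro: ell2_eqI)
  have Sadd: "S (x + y) = S x + S y" for x y using lin[of 1 x 1 y] by (simp add: c1)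
  have Sc: "S (cscale c x) = cscale c (S x)" for c x using lin[of c x 0 x] by (simp add: c0)
  have S: "linear S" by (rule linearI) (simp_all add: Sadd Sc scaleR_eq_cscale)
  have "\<forall>g\<in>H2. H2_inner (dBR_op \<phi> g) g \<in> \<real>\<^sub>\<ge>\<^sub>0" using sq by blast
  then have im: "inner (S x) (cscale \<i> x) = 0" for x
    using hfun_in_H2[of x] by (auto simp: op H2_inner_hfun cinner_in_nonneg_Reals_iff dest!: bspec[of _ _ "hfun x"])
  have "\<forall>g\<in>H2. dBR_op \<phi> (dBR_op \<phi> g) = (\<lambda>z. g z - toeplitz (boundary_fun \<phi>) (toeplitz (\<lambda>\<zeta>. cnj (boundary_fun \<phi> \<zeta>)) g) z)"
    using sq by blast
  from this[rule_format, OF hfun_in_H2] have SS: "S (S x) = x - mult_op \<phi> (mult_op_adj \<phi> x)" for x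
    unfolding defect_op op hfun_inject .
  interpret cs: bounded_linear "cscale \<i>" by (rule bounded_linear_cscale)
  \<comment> \<open>Symmetry is not stated in the predicate and is recovered by polarization: the
    form \<open>inner (S x) (cscale \<i> y)\<close> vanishes on the diagonal, hence is
    antisymmetric, and replacing \<open>y\<close> by \<open>cscale \<i> y\<close> gives
    \<open>sym\<close>.\<close>
  have sk: "inner (S x) (cscale \<i> y) = - inner (S y) (cscale \<i> x)" for x y
    using im[of "x + y"] im[of x] im[of y] by (simp add: Sadd cs.add inner_add_left inner_add_right)
  have cc: "cscale \<i> (cscale \<i> x) = - x" for x by (rule ell2_eqI) simp
  have sym: "inner (S x) y = inner x (S y)" for x y
    using sk[of x "cscale \<i> y"] inner_cscale_i[of "S y" "cscale \<i> x"]
    by (simp add: cc Sc inner_commute)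
  have nS: "(norm (S x))\<^sup>2 = (norm x)\<^sup>2 - (norm (mult_op_adj \<phi> x))\<^sup>2" for x
  proof -
    have "(norm (S x))\<^sup>2 = inner x (S (S x))" by (simp add: power2_norm_eq_inner sym)
    also have "\<dots> = (norm x)\<^sup>2 - (norm (mult_op_adj \<phi> x))\<^sup>2"
      by (simp add: SS inner_diff_right power2_norm_eq_inner inner_mult_adj)
    finally show ?thesis .
  qed
  have "\<exists>h. \<forall>x. inner (S x) h = inner x p"
  proof (rule riesz_range[OF S, of _ "sqrt K"])
    show "linear (\<lambda>x. inner x p)" by (rule linearI) (simp_all add: inner_add_left)
    show "\<bar>inner x p\<bar> \<le> sqrt K * norm (S x)" for x
    proof -
      have "(inner x p)\<^sup>2 \<le> K * (norm (S x))\<^sup>2" using p[of x] by (simp add: nS)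
      then have "sqrt ((inner x p)\<^sup>2) \<le> sqrt (K * (norm (S x))\<^sup>2)" by (rule real_sqrt_le_mono)
      then show ?thesis by (simp add: real_sqrt_mult)
    qed
  qed
  then obtain h where h: "\<And>x. inner (S x) h = inner x p" by blast
  have Sh: "S h = p"
    by (rule vector_eq_ldot[THEN iffD1]) (simp add: h flip: sym)
  have Sinj: "x = 0" if "S x = 0" for x
  proof (rule inj)
    have "(norm (mult_op_adj \<phi> x))\<^sup>2 = (norm x)\<^sup>2" using nS[of x] that by simp
    then show "norm (mult_op_adj \<phi> x) = norm x" by (rule power2_eq_imp_eq) auto
  qed
  \<comment> \<open>With the kernel trivial, the orthogonality clause holds for every vector and
    \<open>h\<close> is the only preimage of \<open>p\<close>.\<close>
  have "dBR_norm \<phi> (hfun p) = norm h"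
    unfolding dBR_norm_def
  proof (rule the_equality)
    show "\<exists>g\<in>H2. (\<forall>k\<in>H2. dBR_op \<phi> k = (\<lambda>z. 0) \<longrightarrow> H2_inner g k = 0) \<and> dBR_op \<phi> g = hfun p \<and> norm h = H2_norm g"
    proof (rule bexI[OF _ hfun_in_H2[of h]], intro conjI ballI impI)
      fix k assume "k \<in> H2" and k: "dBR_op \<phi> k = (\<lambda>z. 0)"
      then obtain x where x: "k = hfun x" using H2_hfun by blast
      have "hfun (S x) = hfun 0" using k by (simp only: x op hfun_zero)
      then have "S x = 0" by (simp only: hfun_inject)
      then have "x = 0" by (rule Sinj)
      then show "H2_inner (hfun h) k = 0" by (simp add: x H2_inner_hfun cinner_def)
    qed (simp_all add: op Sh H2_norm_hfun)
    fix r assume "\<exists>g\<in>H2. (\<forall>k\<in>H2. dBR_op \<phi> k = (\<lambda>z. 0) \<longrightarrow> H2_inner g k = 0) \<and> dBR_op \<phi> g = hfun p \<and> r = H2_norm g"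
    then obtain g where g: "g \<in> H2" "dBR_op \<phi> g = hfun p" "r = H2_norm g" by blast
    obtain x where x: "g = hfun x" using H2_hfun[OF g(1)] .
    have "S x = S h" using g(2) by (simp add: x op hfun_inject Sh)
    then have "S (x - h) = 0" using linear_diff[OF S, of x h] by simp
    from Sinj[OF this] show "r = norm h" by (simp add: g(3) x H2_norm_hfun)
  qed
  moreover have "(norm (S h))\<^sup>2 \<le> (norm h)\<^sup>2" by (simp add: nS)
  then have "norm (S h) \<le> norm h" by (rule power2_le_imp_le) simp
  ultimately show ?thesis by (simp add: Sh)
qed

end

section \<open>The defect of a rational symbol\<close>

lemma cinner_ebasis: "cinner x (ebasis k) = coord x k"
proof -
  have "(\<Sum>n. coord x n * cnj (coord (ebasis k) n)) = (\<Sum>n\<in>{k}. coord x n * cnj (coord (ebasis k) n))"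
    by (rule suminf_finite) auto
  then show ?thesis by (simp add: cinner_def)
qed

lemma bounded_holomorphic_id: "bounded_holomorphic (\<lambda>z. z) 1"
  by unfold_locales (auto intro: holomorphic_intros)

lemma mult_mult:
  assumes "bounded_holomorphic \<phi> C" "bounded_holomorphic \<psi> D" "bounded_holomorphic \<rho> E"
    and "\<And>z. norm z < 1 \<Longrightarrow> \<rho> z = \<phi> z * \<psi> z"
  shows "mult_op \<rho> x = mult_op \<phi> (mult_op \<psi> x)"
  by (rule hfun_eqI) (simp add: assms bounded_holomorphic.hfun_mult[OF assms(1)]
      bounded_holomorphic.hfun_mult[OF assms(2)] bounded_holomorphic.hfun_mult[OF assms(3)])

lemma mult_adj_mult:
  assumes "bounded_holomorphic \<phi> C" "bounded_holomorphic \<psi> D" "bounded_holomorphic \<rho> E"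
    and "\<And>z. norm z < 1 \<Longrightarrow> \<rho> z = \<phi> z * \<psi> z"
  shows "mult_op_adj \<rho> x = mult_op_adj \<psi> (mult_op_adj \<phi> x)"
  by (rule vector_eq_rdot[THEN iffD1])
    (simp add: mult_mult[OF assms] bounded_holomorphic.inner_mult_adj[OF assms(1)]
      bounded_holomorphic.inner_mult_adj[OF assms(2)] bounded_holomorphic.inner_mult_adj[OF assms(3)])

abbreviation bshift :: "ell2 \<Rightarrow> ell2" where "bshift \<equiv> mult_op_adj (\<lambda>z. z)"

text \<open>Multiplication by \<open>z\<close> shifts the basis upwards; pairing with
  \<open>ebasis n\<close> reads off the coordinates of its adjoint.\<close>

lemma coord_bshift: "coord (bshift x) n = coord x (Suc n)"
proof -
  interpret bounded_holomorphic "\<lambda>z. z" 1 by (rule bounded_holomorphic_id)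
  have "mult_op (\<lambda>z. z) (ebasis n) = ebasis (Suc n)"
    by (rule hfun_eqI) (simp add: hfun_mult hfun_ebasis)
  then show ?thesis
    using cinner_mult_adj[of x "ebasis n"] by (simp add: cinner_ebasis)
qed

lemma norm_bshift: "(norm (bshift x))\<^sup>2 = (norm x)\<^sup>2 - (norm (coord x 0))\<^sup>2"
  using suminf_split_head[OF summable_coord[of x]] by (simp add: norm_ell2_sq coord_bshift)

lemma inner_finite:
  assumes "\<And>k. k \<ge> N \<Longrightarrow> coord p k = 0"
  shows "inner x p = (\<Sum>k<N. Re (coord x k * cnj (coord p k)))"
  unfolding inner_ell2_def by (rule suminf_finite) (auto simp: assms not_less)

locale golden_section =
  fixes \<tau> :: real
  assumes \<tau>: "\<tau> = (sqrt 5 - 1) / 2"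
begin

lemma tau_sq: "\<tau>\<^sup>2 = 1 - \<tau>"
  by (simp add: \<tau> power2_eq_square field_simps)

lemma tau_pos: "0 < \<tau>" and tau_less: "\<tau> < 1"
proof -
  have "1 < sqrt 5" "sqrt 5 < 3" by (rule real_less_rsqrt, simp) (rule real_less_lsqrt, simp_all)
  then show "0 < \<tau>" "\<tau> < 1" by (auto simp: \<tau>)
qed

definition c :: "complex \<Rightarrow> complex" where "c z = 1 / (1 - of_real (\<tau>\<^sup>2) * z)"

definition \<beta> :: "complex \<Rightarrow> complex" where "\<beta> z = of_real \<tau> * z / (1 - of_real (\<tau>\<^sup>2) * z)"

text \<open>Since \<open>1 - \<tau>^2 = \<tau>\<close>, the bound is just large enough to dominate
  the numerator of \<open>\<beta>\<close>.\<close>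

lemma denom_ge:
  fixes z :: complex
  assumes z: "norm z < 1"
  shows "\<tau> \<le> norm (1 - of_real (\<tau>\<^sup>2) * z)"
proof -
  have "norm (of_real (\<tau>\<^sup>2) * z) \<le> \<tau>\<^sup>2" using z by (simp add: norm_mult mult_left_le del: of_real_power)
  then show ?thesis using norm_triangle_ineq2[of 1 "of_real (\<tau>\<^sup>2) * z"] tau_sq by simp
qed

lemma denom_nz: "norm (z :: complex) < 1 \<Longrightarrow> 1 - of_real (\<tau>\<^sup>2) * z \<noteq> 0"
  using denom_ge[of z] tau_pos by force

lemma bounded_c: "bounded_holomorphic c (1 / \<tau>)"
proof
  show "c holomorphic_on ball 0 1"
    unfolding c_def by (intro holomorphic_intros) (use denom_nz in auto)
  show "norm (c z) \<le> 1 / \<tau>" if "norm z < 1" for z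
    using denom_ge[OF that] tau_pos by (simp add: c_def norm_divide frac_le del: of_real_power)
qed

lemma bounded_zc: "bounded_holomorphic (\<lambda>z. z * c z) (1 / \<tau>)"
proof
  interpret c: bounded_holomorphic c "1 / \<tau>" by (rule bounded_c)
  show "(\<lambda>z. z * c z) holomorphic_on ball 0 1" by (intro holomorphic_intros c.hol)
  show "norm (z * c z) \<le> 1 / \<tau>" if "norm z < 1" for z
    using mult_mono[OF less_imp_le[OF that] c.bound[OF that]] by (simp add: norm_mult)
qed

lemma bounded_beta: "bounded_holomorphic \<beta> 1"
proof
  show "\<beta> holomorphic_on ball 0 1"
    unfolding \<beta>_def by (intro holomorphic_intros) (use denom_nz in auto)
  show "norm (\<beta> z) \<le> 1" if z: "norm z < 1" for z
  proof -
    have "norm (of_real \<tau> * z) \<le> \<tau>" using z tau_pos by (simp add: norm_mult mult_left_le)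
    then have "norm (of_real \<tau> * z) \<le> norm (1 - of_real (\<tau>\<^sup>2) * z)" using denom_ge[OF z] by linarith
    moreover have "0 < norm (1 - of_real (\<tau>\<^sup>2) * z)" using denom_ge[OF z] tau_pos by linarith
    ultimately show ?thesis unfolding \<beta>_def norm_divide by (simp only: divide_le_eq_1) simp
  qed
qed

text \<open>
  With \<open>y = mult_op_adj c x\<close> one has \<open>x = y - \<tau>\<^sup>2 *\<^sub>R bshift y\<close> and \<open>mult_op_adj \<beta> x = \<tau> *\<^sub>R bshift y\<close>;
  the identity then follows by expanding the squares, since \<open>\<tau>\<^sup>2 = 1 - \<tau>\<close>.
\<close>

lemma beta_defect:
  "(norm x)\<^sup>2 - (norm (mult_op_adj \<beta> x))\<^sup>2 =
     \<tau>\<^sup>2 * (norm (mult_op_adj c x - bshift (mult_op_adj c x)))\<^sup>2 + \<tau> * (norm (coord (mult_op_adj c x) 0))\<^sup>2"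
  and mult_adj_c_inverse: "x = mult_op_adj c x - \<tau>\<^sup>2 *\<^sub>R bshift (mult_op_adj c x)"
proof -
  define y where "y = mult_op_adj c x"
  interpret c: bounded_holomorphic c "1 / \<tau>" by (rule bounded_c)
  interpret zc: bounded_holomorphic "\<lambda>z. z * c z" "1 / \<tau>" by (rule bounded_zc)
  interpret b: bounded_holomorphic \<beta> 1 by (rule bounded_beta)
  have Ly: "mult_op_adj (\<lambda>z. z * c z) x = bshift y"
    unfolding y_def by (rule mult_adj_mult[OF bounded_c bounded_holomorphic_id bounded_zc]) simp
  have u: "mult_op_adj \<beta> x = \<tau> *\<^sub>R bshift y"
  proof (rule vector_eq_rdot[THEN iffD1], rule allI)
    fix v
    have "mult_op \<beta> v = \<tau> *\<^sub>R mult_op (\<lambda>z. z * c z) v"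
      by (rule hfun_eqI) (simp add: b.hfun_mult zc.hfun_mult hfun_scaleR, simp add: \<beta>_def c_def)
    then show "inner (mult_op_adj \<beta> x) v = inner (\<tau> *\<^sub>R bshift y) v"
      by (simp add: b.inner_mult_adj zc.inner_mult_adj flip: Ly)
  qed
  have x: "x = y - \<tau>\<^sup>2 *\<^sub>R bshift y"
  proof (rule vector_eq_rdot[THEN iffD1], rule allI)
    fix v
    \<comment> \<open>The dual of the claim is the identity
      \<open>(1 - \<tau>^2 z) c = 1\<close>.\<close>
    have "v = mult_op c v - \<tau>\<^sup>2 *\<^sub>R mult_op (\<lambda>z. z * c z) v"
    proof (rule hfun_eqI)
      fix z :: complex assume z: "norm z < 1"
      have "c z * hfun v z - of_real (\<tau>\<^sup>2) * (z * c z * hfun v z) = (1 - of_real (\<tau>\<^sup>2) * z) * c z * hfun v z"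
        by (simp add: algebra_simps del: of_real_power)
      also have "(1 - of_real (\<tau>\<^sup>2) * z) * c z = 1" using denom_nz[OF z] by (simp add: c_def)
      finally show "hfun v z = hfun (mult_op c v - \<tau>\<^sup>2 *\<^sub>R mult_op (\<lambda>z. z * c z) v) z"
        using z by (simp add: hfun_diff hfun_scaleR c.hfun_mult zc.hfun_mult)
    qed
    then have "inner x v = inner x (mult_op c v) - \<tau>\<^sup>2 * inner x (mult_op (\<lambda>z. z * c z) v)"
      by (metis inner_diff_right inner_scaleR_right)
    then show "inner x v = inner (y - \<tau>\<^sup>2 *\<^sub>R bshift y) v"
      by (simp add: inner_diff_left y_def c.inner_mult_adj zc.inner_mult_adj flip: Ly[unfolded y_def])
  qed
  show "x = mult_op_adj c x - \<tau>\<^sup>2 *\<^sub>R bshift (mult_op_adj c x)" using x by (simp only: y_def)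
  \<comment> \<open>After expansion the mixed terms agree at once; \<open>tau1\<close> matches the
    coefficients of the squared norm of \<open>y\<close>, and \<open>tau4\<close> those of the
    squared norm of \<open>bshift y\<close>.\<close>
  have tau4: "\<tau>\<^sup>2 * \<tau>\<^sup>2 - \<tau>\<^sup>2 = \<tau>\<^sup>2 - \<tau>" and tau1: "\<tau>\<^sup>2 + \<tau> = 1"
    unfolding tau_sq using tau_sq by (simp_all add: algebra_simps power2_eq_square)
  have "(norm x)\<^sup>2 = (norm y)\<^sup>2 - 2 * \<tau>\<^sup>2 * inner y (bshift y) + \<tau>\<^sup>2 * \<tau>\<^sup>2 * (norm (bshift y))\<^sup>2"
    by (subst x) (simp add: power2_norm_eq_inner inner_diff_left inner_diff_right inner_commute algebra_simps)
  moreover have "(norm (mult_op_adj \<beta> x))\<^sup>2 = \<tau>\<^sup>2 * (norm (bshift y))\<^sup>2"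
    by (simp add: u power_mult_distrib)
  moreover have "(norm (y - bshift y))\<^sup>2 = (norm y)\<^sup>2 - 2 * inner y (bshift y) + (norm (bshift y))\<^sup>2"
    by (simp add: power2_norm_eq_inner inner_diff_left inner_diff_right inner_commute algebra_simps)
  moreover have "(norm (coord y 0))\<^sup>2 = (norm y)\<^sup>2 - (norm (bshift y))\<^sup>2"
    by (simp add: norm_bshift)
  moreover have "P - 2 * \<tau>\<^sup>2 * Q + \<tau>\<^sup>2 * \<tau>\<^sup>2 * R - \<tau>\<^sup>2 * R = \<tau>\<^sup>2 * (P - 2 * Q + R) + \<tau> * (P - R)" for P Q R
  proof -
    have "P - 2 * \<tau>\<^sup>2 * Q + \<tau>\<^sup>2 * \<tau>\<^sup>2 * R - \<tau>\<^sup>2 * R = 1 * P - 2 * \<tau>\<^sup>2 * Q + (\<tau>\<^sup>2 * \<tau>\<^sup>2 - \<tau>\<^sup>2) * R"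
      by (simp add: algebra_simps)
    also have "\<dots> = \<tau>\<^sup>2 * (P - 2 * Q + R) + \<tau> * (P - R)"
      unfolding tau4 tau1[symmetric] by (simp add: algebra_simps)
    finally show ?thesis .
  qed
  ultimately have "(norm x)\<^sup>2 - (norm (mult_op_adj \<beta> x))\<^sup>2 = \<tau>\<^sup>2 * (norm (y - bshift y))\<^sup>2 + \<tau> * (norm (coord y 0))\<^sup>2"
    by (simp only:)
  then show "(norm x)\<^sup>2 - (norm (mult_op_adj \<beta> x))\<^sup>2 =
     \<tau>\<^sup>2 * (norm (mult_op_adj c x - bshift (mult_op_adj c x)))\<^sup>2 + \<tau> * (norm (coord (mult_op_adj c x) 0))\<^sup>2"
    by (simp only: y_def)
qed

text \<open>The defect bounds \<open>y_0\<close> and all increments \<open>y_k - y_(k+1)\<close>, so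
  summing from 0 bounds \<open>y_k\<close> with factor \<open>k + 1\<close>. The coordinate
  \<open>x_k\<close> involves \<open>y_k\<close> and \<open>y_(k+1)\<close>, hence
  \<open>(k + 1) + (k + 2) = 2 k + 3\<close>.\<close>

lemma norm_coord_le_defect:
  "\<tau> * norm (coord x k) \<le> (2 * real k + 3) * sqrt ((norm x)\<^sup>2 - (norm (mult_op_adj \<beta> x))\<^sup>2)"
proof -
  define y where "y = mult_op_adj c x"
  define Q where "Q = (norm x)\<^sup>2 - (norm (mult_op_adj \<beta> x))\<^sup>2"
  have Q: "Q = \<tau>\<^sup>2 * (norm (y - bshift y))\<^sup>2 + \<tau> * (norm (coord y 0))\<^sup>2"
    unfolding Q_def y_def by (rule beta_defect)
  have y0: "\<tau> * norm (coord y 0) \<le> sqrt Q"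
  proof (rule real_le_rsqrt)
    \<comment> \<open>Passing from \<open>\<tau>^2\<close> to the larger \<open>\<tau>\<close> gives
      the start of the sum the same constant as the increments.\<close>
    have "(\<tau> * norm (coord y 0))\<^sup>2 = \<tau> * (\<tau> * (norm (coord y 0))\<^sup>2)"
      by (simp add: power2_eq_square mult_ac)
    also have "\<dots> \<le> \<tau> * (norm (coord y 0))\<^sup>2"
      using tau_pos tau_less by (intro mult_left_le_one_le) auto
    also have "\<dots> \<le> Q" unfolding Q by simp
    finally show "(\<tau> * norm (coord y 0))\<^sup>2 \<le> Q" .
  qed
  have step: "\<tau> * norm (coord y k - coord y (Suc k)) \<le> sqrt Q" for k
  proof (rule real_le_rsqrt)
    have "norm (coord y k - coord y (Suc k)) \<le> norm (y - bshift y)"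
      using norm_coord_le[of "y - bshift y" k] by (simp add: coord_bshift)
    then have "(\<tau> * norm (coord y k - coord y (Suc k)))\<^sup>2 \<le> \<tau>\<^sup>2 * (norm (y - bshift y))\<^sup>2"
      unfolding power_mult_distrib by (intro mult_left_mono power_mono) auto
    also have "\<dots> \<le> Q" unfolding Q using tau_pos by simp
    finally show "(\<tau> * norm (coord y k - coord y (Suc k)))\<^sup>2 \<le> Q" .
  qed
  have yk: "\<tau> * norm (coord y k) \<le> (real k + 1) * sqrt Q" for k
  proof (induction k)
    case (Suc k)
    have "norm (coord y (Suc k)) \<le> norm (coord y k) + norm (coord y k - coord y (Suc k))"
      by (metis norm_triangle_sub norm_minus_commute)
    then have "\<tau> * norm (coord y (Suc k)) \<le> \<tau> * norm (coord y k) + \<tau> * norm (coord y k - coord y (Suc k))"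
      using tau_pos by (simp flip: distrib_left)
    then show ?case using Suc step[of k] by (simp add: algebra_simps)
  qed (use y0 in simp)
  have "coord x k = coord y k - \<tau>\<^sup>2 *\<^sub>R coord y (Suc k)"
    using arg_cong[OF mult_adj_c_inverse[of x], of "\<lambda>v. coord v k"] by (simp add: y_def coord_bshift)
  then have "norm (coord x k) \<le> norm (coord y k) + norm (\<tau>\<^sup>2 *\<^sub>R coord y (Suc k))"
    by (simp only: norm_triangle_ineq4)
  also have "norm (\<tau>\<^sup>2 *\<^sub>R coord y (Suc k)) \<le> norm (coord y (Suc k))"
    using tau_pos tau_less by (simp add: mult_left_le_one_le power_le_one)
  finally have "\<tau> * norm (coord x k) \<le> \<tau> * norm (coord y k) + \<tau> * norm (coord y (Suc k))"
    using tau_pos by (simp flip: distrib_left)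
  also have "\<dots> \<le> (real k + 1) * sqrt Q + (real (Suc k) + 1) * sqrt Q"
    by (intro add_mono yk)
  also have "\<dots> = (2 * real k + 3) * sqrt Q" by (simp add: algebra_simps)
  finally show ?thesis by (simp add: Q_def)
qed

end

section \<open>Blaschke products and Taylor polynomials\<close>

lemma norm_blaschke_factor_le:
  fixes w :: real and z :: complex
  assumes "\<bar>w\<bar> \<le> 1" "norm z < 1"
  shows "norm ((of_real w - z) / (1 - of_real w * z)) \<le> 1"
proof -
  have "(norm (1 - of_real w * z))\<^sup>2 - (norm (of_real w - z))\<^sup>2 = (1 - w\<^sup>2) * (1 - (norm z)\<^sup>2)"
    unfolding cmod_power2 by (simp add: power2_eq_square algebra_simps)
  also have "\<dots> \<ge> 0" using assms by (intro mult_nonneg_nonneg) (auto simp: abs_square_le_1)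
  finally have "norm (of_real w - z) \<le> norm (1 - of_real w * z)"
    by (intro power2_le_imp_le[of "norm (of_real w - z)"]) auto
  then show ?thesis by (auto simp: norm_divide divide_le_eq_1)
qed

lemma blaschke_denom_ge:
  fixes w :: real and z :: complex
  assumes "\<bar>w\<bar> \<le> 1" "norm z \<le> r"
  shows "1 - r \<le> norm (1 - of_real w * z)"
proof -
  have "norm (of_real w * z) \<le> 1 * r" unfolding norm_mult using assms by (intro mult_mono) auto
  then show ?thesis using norm_triangle_ineq2[of 1 "of_real w * z"] by simp
qed

text \<open>The factors differ from 1 by a multiple of \<open>1 - w n\<close>, uniformly on smaller
  disks, so the product converges locally uniformly; the limit inherits holomorphy and the bound
  1.\<close>

lemma blaschke_product:
  fixes w :: "nat \<Rightarrow> real"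
  assumes w: "\<And>n. \<bar>w n\<bar> \<le> 1" and sm: "summable (\<lambda>n. 1 - w n)"
    and B: "\<And>z. norm z < 1 \<Longrightarrow> B z = (\<Prod>n. (of_real (w n) - z) / (1 - of_real (w n) * z))"
  shows "bounded_holomorphic B 1"
proof -
  define a where "a n z = (of_real (w n) - z) / (1 - of_real (w n) * z)" for n and z :: complex
  have nz: "1 - of_real (w n) * z \<noteq> 0" if "norm z < 1" for n and z :: complex
    using blaschke_denom_ge[OF w[of n] order_refl[of "norm z"]] that by force
  have a_le: "norm (a n z) \<le> 1" if "norm z < 1" for n z
    unfolding a_def by (rule norm_blaschke_factor_le[OF w that])
  have a1: "norm (a n z - 1) \<le> (1 - w n) * (2 / (1 - r))" if r: "norm z \<le> r" "r < 1" for n z r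
  proof -
    have "a n z - 1 = - (of_real (1 - w n) * (1 + z) / (1 - of_real (w n) * z))"
      unfolding a_def using nz[of z n] r by (simp add: field_simps)
    then have "norm (a n z - 1) = (1 - w n) * norm (1 + z) / norm (1 - of_real (w n) * z)"
      using w[of n] by (simp add: norm_mult norm_divide del: of_real_diff of_real_1)
    also have "\<dots> \<le> (1 - w n) * 2 / (1 - r)"
    proof (rule frac_le)
      have "norm (1 + z) \<le> 2" using norm_triangle_ineq[of 1 z] r by simp
      then show "(1 - w n) * norm (1 + z) \<le> (1 - w n) * 2" using w[of n] by (intro mult_left_mono) auto
    qed (use w[of n] r blaschke_denom_ge[OF w[of n] r(1)] in auto)
    finally show ?thesis by simp
  qed
  have conv: "(\<lambda>N. \<Prod>n<N. a n z) \<longlonglongrightarrow> B z" if z: "norm z < 1" for z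
  proof -
    have "summable (\<lambda>n. norm (a n z - 1))"
      by (rule summable_comparison_test'[OF summable_mult2[OF sm, of "2 / (1 - norm z)"]])
        (use a1[OF order_refl z] in \<open>simp only: real_norm_def abs_norm_cancel\<close>)
    then have "convergent_prod (\<lambda>n. a n z)"
      by (intro abs_convergent_prod_imp_convergent_prod summable_imp_abs_convergent_prod)
    from convergent_prod_LIMSEQ[OF this] have "(\<lambda>N. \<Prod>n<Suc N. a n z) \<longlonglongrightarrow> B z"
      by (simp add: B[OF z] a_def lessThan_Suc_atMost)
    then show ?thesis by (rule LIMSEQ_imp_Suc)
  qed
  have unif: "uniform_limit (cball 0 r) (\<lambda>N z. \<Prod>n<N. a n z) B sequentially" if r: "r < 1" for r
  proof -
    have "uniformly_convergent_on (cball 0 r) (\<lambda>N z. \<Sum>n<N. norm (a n z - 1))"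
      by (rule Weierstrass_m_test'[OF _ summable_mult2[OF sm, of "2 / (1 - r)"]])
        (use a1[OF _ r] in \<open>simp only: real_norm_def abs_norm_cancel mem_cball_0\<close>)
    moreover have "continuous_on (cball 0 r) (a n)" for n
      unfolding a_def by (intro continuous_intros) (use nz r in auto)
    ultimately have "uniformly_convergent_on (cball 0 r) (\<lambda>N z. \<Prod>n<N. a n z)"
      by (intro uniformly_convergent_on_prod') auto
    then obtain g where g: "uniform_limit (cball 0 r) (\<lambda>N z. \<Prod>n<N. a n z) g sequentially"
      by (auto simp: uniformly_convergent_on_def)
    have gB: "g z = B z" if "z \<in> cball 0 r" for z
      using tendsto_uniform_limitI[OF g that] conv[of z] that r by (intro LIMSEQ_unique) auto
    have "uniform_limit (cball 0 r) (\<lambda>N z. \<Prod>n<N. a n z) g sequentially \<longleftrightarrow> ?thesis"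
      by (rule uniform_limit_cong') (simp_all only: gB)
    with g show ?thesis by blast
  qed
  show ?thesis
  proof
    show "B holomorphic_on ball 0 1"
    proof (rule holomorphic_uniform_sequence[of _ "\<lambda>N z. \<Prod>n<N. a n z"])
      show "(\<lambda>z. \<Prod>n<N. a n z) holomorphic_on ball 0 1" for N
        unfolding a_def by (intro holomorphic_intros) (use nz in auto)
      fix x :: complex assume x: "x \<in> ball 0 1"
      define d where "d = (1 - norm x) / 2"
      have sub: "cball x d \<subseteq> cball 0 (norm x + d)"
        by (auto simp: dist_norm norm_minus_commute) (metis add_left_mono norm_triangle_sub order_trans)
      have d: "norm x + d < 1" "0 < d" using x by (auto simp: d_def field_simps)
      then have "cball 0 (norm x + d) \<subseteq> ball (0::complex) 1" by auto
      with sub have "cball x d \<subseteq> ball 0 1" by (rule order_trans)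
      moreover have "uniform_limit (cball x d) (\<lambda>N z. \<Prod>n<N. a n z) B sequentially"
        by (rule uniform_limit_on_subset[OF unif[OF d(1)] sub])
      ultimately show "\<exists>d>0. cball x d \<subseteq> ball 0 1 \<and> uniform_limit (cball x d) (\<lambda>N z. \<Prod>n<N. a n z) B sequentially"
        using d(2) by blast
    qed auto
    show "norm (B z) \<le> 1" if z: "norm z < 1" for z
    proof (rule LIMSEQ_le_const2[OF tendsto_norm[OF conv[OF z]]])
      show "\<exists>N. \<forall>n\<ge>N. norm (\<Prod>n<n. a n z) \<le> 1"
        using a_le[OF z] by (auto simp: prod_norm[symmetric] intro!: prod_le_1)
    qed
  qed
qed

text \<open>The adjoint for \<open>b\<close> is that for \<open>\<beta>\<close> followed by the
  contraction belonging to \<open>\<theta>\<close>. So the defect of \<open>b\<close> is at least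
  that of \<open>\<beta>\<close>, and the bounds on single coordinates persist.\<close>

lemma (in golden_section) dBR_norm_ge_of_finite:
  assumes b: "bounded_holomorphic b 1" and \<theta>: "bounded_holomorphic \<theta> 1"
    and eq: "\<And>z. norm z < 1 \<Longrightarrow> b z = \<beta> z * \<theta> z"
    and p: "\<And>k. k \<ge> N \<Longrightarrow> coord p k = 0"
  shows "norm p \<le> dBR_norm b (hfun p)"
proof -
  interpret \<theta>: bounded_holomorphic \<theta> 1 by fact
  interpret schur_function b unfolding schur_function_def by fact
  let ?D = "\<lambda>x. (norm x)\<^sup>2 - (norm (mult_op_adj b x))\<^sup>2"
  have "mult_op_adj b x = mult_op_adj \<theta> (mult_op_adj \<beta> x)" for x
    by (rule mult_adj_mult[OF bounded_beta \<theta> b]) (rule eq)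
  then have "norm (mult_op_adj b x) \<le> norm (mult_op_adj \<beta> x)" for x
    using \<theta>.norm_mult_adj_le[of "mult_op_adj \<beta> x"] by simp
  then have le: "(norm x)\<^sup>2 - (norm (mult_op_adj \<beta> x))\<^sup>2 \<le> ?D x" for x
    by (simp add: power_mono)
  have coord: "norm (coord x k) \<le> (2 * real k + 3) / \<tau> * sqrt (?D x)" for x k
  proof -
    have "\<tau> * norm (coord x k) \<le> (2 * real k + 3) * sqrt ((norm x)\<^sup>2 - (norm (mult_op_adj \<beta> x))\<^sup>2)"
      by (rule norm_coord_le_defect)
    also have "\<dots> \<le> (2 * real k + 3) * sqrt (?D x)"
      by (intro mult_left_mono real_sqrt_le_mono le) auto
    finally show ?thesis using tau_pos by (simp add: field_simps)
  qed
  show ?thesis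
  proof (rule dBR_norm_ge)
    \<comment> \<open>The constants of the coordinate bounds, weighted with the coefficients of
      \<open>p\<close>.\<close>
    define K where "K = (\<Sum>k<N. (2 * real k + 3) / \<tau> * norm (coord p k))"
    show "(inner x p)\<^sup>2 \<le> K\<^sup>2 * ?D x" for x
    proof -
      have nn: "0 \<le> ?D x" using norm_mult_adj_le[of x] by (simp add: power_mono)
      have "\<bar>inner x p\<bar> \<le> (\<Sum>k<N. \<bar>Re (coord x k * cnj (coord p k))\<bar>)"
        by (subst inner_finite[of N p x]) (rule p, assumption, rule sum_abs)
      also have "\<dots> \<le> (\<Sum>k<N. (2 * real k + 3) / \<tau> * norm (coord p k) * sqrt (?D x))"
      proof (rule sum_mono)
        fix k
        have "\<bar>Re (coord x k * cnj (coord p k))\<bar> \<le> norm (coord x k) * norm (coord p k)"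
          using abs_Re_le_cmod[of "coord x k * cnj (coord p k)"] by (simp only: norm_mult complex_mod_cnj)
        also have "\<dots> \<le> ((2 * real k + 3) / \<tau> * sqrt (?D x)) * norm (coord p k)"
          by (intro mult_right_mono coord) auto
        finally show "\<bar>Re (coord x k * cnj (coord p k))\<bar> \<le> (2 * real k + 3) / \<tau> * norm (coord p k) * sqrt (?D x)"
          by (simp only: mult_ac)
      qed
      also have "\<dots> = K * sqrt (?D x)" unfolding K_def by (rule sum_distrib_right[symmetric])
      finally have "\<bar>inner x p\<bar>\<^sup>2 \<le> (K * sqrt (?D x))\<^sup>2" by (rule power_mono) simp
      then show ?thesis using nn by (simp add: power_mult_distrib)
    qed
    \<comment> \<open>The same bounds give injectivity: with zero defect every coordinate
      vanishes.\<close>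
    show "x = 0" if "norm (mult_op_adj b x) = norm x" for x
    proof (rule ell2_eqI)
      show "coord x k = coord 0 k" for k using coord[of x k] that by simp
    qed
  qed
qed

section \<open>Taylor polynomials, Cesaro means and the coefficients of \<open>f\<close>\<close>

lemma hfun_sum: "hfun (\<Sum>i\<in>I. x i) z = (\<Sum>i\<in>I. hfun (x i) z)"
  by (induction I rule: infinite_finite_induct) (simp_all add: hfun_add hfun_zero)

lemma coord_sum: "coord (\<Sum>i\<in>I. x i) n = (\<Sum>i\<in>I. coord (x i) n)"
  by (induction I rule: infinite_finite_induct) simp_all

definition taylor_poly :: "nat \<Rightarrow> (complex \<Rightarrow> complex) \<Rightarrow> ell2" where
  "taylor_poly n f = (\<Sum>k\<le>n. cscale (taylor_coeff f k) (ebasis k))"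

lemma coord_taylor_poly: "coord (taylor_poly n f) k = (if k \<le> n then taylor_coeff f k else 0)"
  by (simp add: taylor_poly_def coord_sum if_distrib[of "\<lambda>x. _ * x"] sum.delta cong: if_cong)

lemma partial_sum_eq: "partial_sum n f = hfun (taylor_poly n f)"
proof (rule ext)
  fix z
  show "partial_sum n f z = hfun (taylor_poly n f) z"
    by (cases "norm z < 1") (simp_all add: partial_sum_def taylor_poly_def hfun_sum hfun_cscale hfun_ebasis)
qed

lemma cesaro_mean_eq: "cesaro_mean n f = hfun ((1 / real (n + 1)) *\<^sub>R (\<Sum>k\<le>n. taylor_poly k f))"
  by (rule ext) (simp add: cesaro_mean_def partial_sum_eq hfun_scaleR hfun_sum)

text \<open>The coefficient of index \<open>k\<close> is present in the partial sums of index
  \<open>k\<close> to \<open>n\<close>, which are \<open>n + 1 - k\<close> in number.\<close>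

lemma coord_cesaro:
  assumes "k \<le> n"
  shows "coord ((1 / real (n + 1)) *\<^sub>R (\<Sum>j\<le>n. taylor_poly j f)) k = of_real (real (n + 1 - k) / real (n + 1)) * taylor_coeff f k"
proof -
  have "(\<Sum>j\<le>n. coord (taylor_poly j f) k) = (\<Sum>j\<in>{k..n}. taylor_coeff f k)"
    unfolding coord_taylor_poly by (rule sum.mono_neutral_cong_right) auto
  also have "\<dots> = of_nat (n + 1 - k) * taylor_coeff f k" using assms by simp
  finally show ?thesis using assms by (simp add: coord_sum scaleR_conv_of_real)
qed

text \<open>Each kernel is expanded into a geometric series and the order of summation exchanged,
  which the majorant \<open>|z|^k / 2^(n+1)\<close> permits. Indices start at 0, hence
  \<open>Suc n\<close> in the weights.\<close>

lemma taylor_coeff_kernel_sum: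
  fixes w :: "nat \<Rightarrow> real"
  assumes w: "\<And>n. \<bar>w n\<bar> \<le> 1"
    and f: "\<And>z. norm z < 1 \<Longrightarrow> f z = (\<Sum>n. (1 / 2 ^ Suc n) / (1 - of_real (w n) * z))"
  shows "taylor_coeff f = (\<lambda>k. of_real (\<Sum>n. (1 / 2 ^ Suc n) * w n ^ k))"
proof (rule taylor_coeff_sums)
  fix z :: complex assume z: "norm z < 1"
  define F where "F k = (\<Sum>n. (1 / 2 ^ Suc n) * w n ^ k)" for k
  have half: "summable (\<lambda>n. (1 / 2 ^ Suc n) :: real)"
    using summable_mult[OF summable_geometric[of "1/2 :: real"], of "1/2"] by (simp add: power_one_over)
  have geo: "summable (\<lambda>k. norm z ^ k)" using z by (simp add: summable_geometric)
  define d where "d p = (case p of (n, k) \<Rightarrow> (1 / 2 ^ Suc n) * (of_real (w n) * z) ^ k)" for p :: "nat \<times> nat"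
  define e where "e p = (case p of (n, k) \<Rightarrow> (1 / 2 ^ Suc n) * norm z ^ k)" for p :: "nat \<times> nat"
  have d_le: "norm (d p) \<le> norm (e p)" for p
  proof (cases p)
    case (Pair n k)
    have "\<bar>w n\<bar> ^ k * norm z ^ k \<le> 1 * norm z ^ k"
      using w[of n] by (intro mult_right_mono power_le_one) auto
    then show ?thesis
      by (simp add: Pair d_def e_def norm_mult norm_power norm_divide power_mult_distrib divide_right_mono)
  qed
  have "(\<lambda>p. norm (e p)) summable_on (SIGMA n:UNIV. UNIV)"
  proof (rule Infinite_Sum.abs_summable_on_Sigma_iff[THEN iffD2], intro conjI ballI)
    show "(\<lambda>k. norm (e (n, k))) summable_on UNIV" for n
      using geo by (subst summable_on_UNIV_nonneg_real_iff) (auto simp: e_def abs_mult summable_divide)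
    have "(\<Sum>\<^sub>\<infinity>k. norm (e (n, k))) = (1 / 2 ^ Suc n) * (\<Sum>\<^sub>\<infinity>k. norm z ^ k)" for n
      unfolding e_def by (subst infsum_cmult_right'[symmetric]) (simp add: abs_mult)
    then have eq: "norm (\<Sum>\<^sub>\<infinity>k. norm (e (n, k))) = (1 / 2 ^ Suc n) * \<bar>\<Sum>\<^sub>\<infinity>k. norm z ^ k\<bar>" for n
      by (simp add: abs_mult)
    show "(\<lambda>n. norm (\<Sum>\<^sub>\<infinity>k. norm (e (n, k)))) summable_on UNIV"
      unfolding eq using summable_mult2[OF half] by (subst summable_on_UNIV_nonneg_real_iff) auto
  qed
  then have "(\<lambda>p. norm (d p)) summable_on UNIV \<times> UNIV"
    by (rule Infinite_Sum.abs_summable_on_comparison_test) (rule d_le)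
  then obtain s where s: "(d has_sum s) (UNIV \<times> UNIV)"
    using Infinite_Sum.abs_summable_summable summable_on_def by blast
  have wz: "norm (of_real (w n) * z) < 1" for n
    using z mult_right_mono[OF w[of n] norm_ge_zero[of z]] by (simp add: norm_mult)
  have "((\<lambda>k. d (n, k)) has_sum (1 / 2 ^ Suc n) / (1 - of_real (w n) * z)) UNIV" for n
  proof (rule norm_summable_imp_has_sum)
    have "summable (\<lambda>k. norm ((of_real (w n) * z) ^ k))"
      using wz[of n] by (simp add: norm_power summable_geometric del: norm_mult)
    from summable_mult[OF this, of "norm (1 / 2 ^ Suc n :: complex)"]
    show "summable (\<lambda>k. norm (d (n, k)))" by (simp only: d_def norm_mult prod.case)
    show "(\<lambda>k. d (n, k)) sums ((1 / 2 ^ Suc n) / (1 - of_real (w n) * z))"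
      using sums_mult[OF geometric_sums[OF wz[of n]], of "1 / 2 ^ Suc n"] by (simp add: d_def)
  qed
  from has_sum_imp_sums[OF has_sum_SigmaD[OF s this]] have fs: "f z = s"
    by (simp add: f[OF z] sums_iff)
  have inner_sum: "((\<lambda>n. d (n, k)) has_sum of_real (F k) * z ^ k) UNIV" for k
  proof (rule norm_summable_imp_has_sum)
    have le: "norm ((1 / 2 ^ Suc n) * w n ^ k) \<le> 1 / 2 ^ Suc n" for n
      using w[of n] by (simp add: norm_mult power_abs power_le_one divide_right_mono)
    have sw: "summable (\<lambda>n. norm ((1 / 2 ^ Suc n) * w n ^ k))"
      by (rule summable_comparison_test'[OF half]) (use le in simp)
    have eq: "d (n, k) = of_real ((1 / 2 ^ Suc n) * w n ^ k) * z ^ k" for n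
      by (simp add: d_def power_mult_distrib)
    show "summable (\<lambda>n. norm (d (n, k)))"
      unfolding eq norm_mult[of _ "z ^ k"] norm_of_real using sw by (intro summable_mult2) simp
    show "(\<lambda>n. d (n, k)) sums (of_real (F k) * z ^ k)"
      unfolding eq F_def
      by (intro sums_mult2 sums_of_real summable_sums summable_norm_cancel[OF sw])
  qed
  have "((\<lambda>k. of_real (F k) * z ^ k) has_sum s) UNIV"
  proof (rule has_sum_SigmaD)
    show "((\<lambda>(k, n). d (n, k)) has_sum s) (UNIV \<times> UNIV)" using s by (subst (asm) has_sum_swap)
    show "((\<lambda>n. case (k, n) of (k, n) \<Rightarrow> d (n, k)) has_sum of_real (F k) * z ^ k) UNIV" for k
      using inner_sum[of k] by simp
  qed
  from has_sum_imp_sums[OF this]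
  show "(\<lambda>k. of_real (\<Sum>n. (1 / 2 ^ Suc n) * w n ^ k) * z ^ k) sums f z"
    by (simp only: fs F_def)
qed

text \<open>On the block \<open>4 ^ n \<le> k < 2 * 4 ^ n\<close> a single term of the series gives
  \<open>F k \<ge> 1 / 2 ^ (n + 2)\<close>. Each block thus contributes at least
  \<open>4 ^ n / 4 ^ (n + 2) = 1/16\<close>, and the series of squares cannot be Cauchy.\<close>

lemma kernel_sum_coeffs_not_l2:
  fixes w :: "nat \<Rightarrow> real"
  assumes w: "\<And>n. w n = 1 - 1 / 4 ^ Suc n"
  defines "F \<equiv> \<lambda>k. (\<Sum>n. (1 / 2 ^ Suc n) * w n ^ k)"
  shows "\<exists>N. R < (\<Sum>k<N. (F k)\<^sup>2)"
proof (rule ccontr)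
  assume "\<not> (\<exists>N. R < (\<Sum>k<N. (F k)\<^sup>2))"
  then have bnd: "(\<Sum>k<N. (F k)\<^sup>2) \<le> R" for N by (simp add: not_less)
  have half: "summable (\<lambda>n. (1 / 2 ^ Suc n) :: real)"
    using summable_mult[OF summable_geometric[of "1/2 :: real"], of "1/2"] by (simp add: power_one_over)
  have w01: "0 \<le> w n" "w n \<le> 1" for n
    using one_le_power[of "4::real" "Suc n"] by (simp_all add: w)
  have sw: "summable (\<lambda>n. (1 / 2 ^ Suc n) * w n ^ k)" for k
    by (rule summable_comparison_test'[OF half])
      (use w01 in \<open>auto simp: abs_mult power_le_one divide_right_mono\<close>)
  have F_ge: "1 / 2 ^ (n + 2) \<le> F k" if k: "k \<le> 2 * 4 ^ n" for n k
  proof -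
    have "real k \<le> 2 * 4 ^ n" using k by (metis of_nat_le_iff of_nat_mult of_nat_numeral of_nat_power)
    \<comment> \<open>Here \<open>k (1 - w n) \<le> 2 * 4 ^ n / 4 ^ (n + 1) = 1/2\<close>;
      Bernoulli's inequality then keeps \<open>w n ^ k\<close> at least 1/2.\<close>
    then have "1 / 2 \<le> 1 + real k * (w n - 1)" by (simp add: w field_simps)
    also have "\<dots> \<le> (1 + (w n - 1)) ^ k" by (rule Bernoulli_inequality) (use w01 in simp)
    finally have "(1 / 2 ^ Suc n) * (1 / 2) \<le> (1 / 2 ^ Suc n) * w n ^ k" by (intro mult_left_mono) auto
    also have "\<dots> \<le> F k"
      using sum_le_suminf[OF sw[of k], of "{n}"] w01 by (simp add: F_def)
    finally show ?thesis by simp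
  qed
  have "summable (\<lambda>k. (F k)\<^sup>2)"
    by (rule bounded_imp_summable[where B=R]) (use bnd[of "Suc _"] in \<open>auto simp: lessThan_Suc_atMost\<close>)
  then obtain M where M: "\<And>m n. m \<ge> M \<Longrightarrow> norm (\<Sum>k\<in>{m..<n}. (F k)\<^sup>2) < 1 / 16"
    unfolding summable_Cauchy by (metis zero_less_divide_1_iff zero_less_numeral)
  \<comment> \<open>This places the block of index \<open>M\<close> beyond the Cauchy
    threshold.\<close>
  have "M \<le> 4 ^ M" by (simp add: less_imp_le)
  from M[OF this, of "2 * 4 ^ M"] have "(\<Sum>k\<in>{4 ^ M..<2 * 4 ^ M}. (F k)\<^sup>2) < 1 / 16" by simp
  moreover have "(\<Sum>k\<in>{4 ^ M..<2 * 4 ^ M :: nat}. (1 / 2 ^ (M + 2))\<^sup>2) \<le> (\<Sum>k\<in>{4 ^ M..<2 * 4 ^ M}. (F k)\<^sup>2)"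
    by (intro sum_mono power_mono F_ge) auto
  moreover have "(\<Sum>k\<in>{4 ^ M..<2 * 4 ^ M :: nat}. (1 / 2 ^ (M + 2))\<^sup>2) = (1 / 16 :: real)"
  proof -
    have "((2::real) ^ M)\<^sup>2 = 4 ^ M" by (simp add: power2_eq_square flip: power_mult_distrib)
    then show ?thesis by (simp add: power_divide power_add power_mult_distrib)
  qed
  ultimately show False by simp
qed

theorem corollary3p4:
  fixes \<tau> :: real and w :: "nat \<Rightarrow> real" and b0 B b f :: "complex \<Rightarrow> complex"
  assumes "\<tau> = (sqrt 5 - 1) / 2"
    and "\<And>z. z \<in> ball 0 1 \<Longrightarrow> b0 z = of_real \<tau> * z / (1 - of_real (\<tau>\<^sup>2) * z)"
    and "\<And>n. n \<ge> 1 \<Longrightarrow> w n = 1 - 1 / 4 ^ n"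
    and "\<And>z. z \<in> ball 0 1 \<Longrightarrow>
           B z = (\<Prod>n. (of_real (w (Suc n)) - z) / (1 - of_real (w (Suc n)) * z))"
    and "\<And>z. z \<in> ball 0 1 \<Longrightarrow> b z = b0 z * (B z)\<^sup>2"
    and "\<And>z. z \<in> ball 0 1 \<Longrightarrow>
           f z = (\<Sum>n. (1 / 2 ^ Suc n) / (1 - of_real (w (Suc n)) * z))"
  shows "limsup (\<lambda>n. ereal (dBR_norm b (partial_sum n f))) = \<infinity> \<and>
         limsup (\<lambda>n. ereal (dBR_norm b (cesaro_mean n f))) = \<infinity>"
proof -
  interpret golden_section \<tau> by unfold_locales (rule assms(1))
  have wS: "w (Suc n) = 1 - 1 / 4 ^ Suc n" for n using assms(3)[of "Suc n"] by simp
  have w_le: "\<bar>w (Suc n)\<bar> \<le> 1" for n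
  proof -
    have "1 / 4 ^ Suc n \<le> (1::real)" using one_le_power[of "4::real" "Suc n"] by simp
    moreover have "0 \<le> 1 / (4::real) ^ Suc n" by simp
    ultimately show ?thesis unfolding wS by linarith
  qed
  have "summable (\<lambda>n. 1 - w (Suc n))"
    using summable_mult[OF summable_geometric[of "1/4 :: real"], of "1/4"] by (simp add: wS power_one_over)
  then have B: "bounded_holomorphic B 1"
    using assms(4) by (intro blaschke_product[of "\<lambda>n. w (Suc n)"] w_le) auto
  interpret B: bounded_holomorphic B 1 by fact
  interpret \<beta>: bounded_holomorphic \<beta> 1 by (rule bounded_beta)
  have B2: "bounded_holomorphic (\<lambda>z. (B z)\<^sup>2) 1"
    by unfold_locales (auto intro!: holomorphic_intros B.hol power_le_one B.bound simp: norm_power)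
  interpret B2: bounded_holomorphic "\<lambda>z. (B z)\<^sup>2" 1 by fact
  have eq: "b z = \<beta> z * (B z)\<^sup>2" if "norm z < 1" for z
    using that assms(2,5)[of z] by (simp add: \<beta>_def)
  have b: "bounded_holomorphic b 1"
  proof
    have "(\<lambda>z. \<beta> z * (B z)\<^sup>2) holomorphic_on ball 0 1" by (intro holomorphic_intros \<beta>.hol B.hol)
    then show "b holomorphic_on ball 0 1" by (rule holomorphic_transform) (simp add: eq)
    show "norm (b z) \<le> 1" if "norm z < 1" for z
      using mult_mono[OF \<beta>.bound[OF that] B2.bound[OF that]] by (simp add: eq[OF that] norm_mult)
  qed
  note ge = dBR_norm_ge_of_finite[OF b B2 eq]
  define F where "F k = (\<Sum>n. (1 / 2 ^ Suc n) * w (Suc n) ^ k)" for k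
  have tc: "taylor_coeff f = (\<lambda>k. of_real (F k))"
    unfolding F_def using assms(6) by (intro taylor_coeff_kernel_sum[of "\<lambda>n. w (Suc n)"] w_le) auto
  have unbounded: "\<exists>N. R < (\<Sum>k<N. (F k)\<^sup>2)" for R
    unfolding F_def by (rule kernel_sum_coeffs_not_l2) (rule wS)
  \<comment> \<open>Serves partial sums and Cesaro means alike: for \<open>2 * k \<le> n\<close> the
    Cesaro weight \<open>(n + 1 - k) / (n + 1)\<close> is at least 1/2.\<close>
  have lim: "limsup (\<lambda>n. ereal (dBR_norm b (hfun (p n)))) = \<infinity>"
    if supp: "\<And>n k. k > n \<Longrightarrow> coord (p n) k = 0"
      and lower: "\<And>n k. 2 * k \<le> n \<Longrightarrow> \<bar>F k\<bar> / 2 \<le> norm (coord (p n) k)" for p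
  proof -
    have "\<forall>\<^sub>F n in sequentially. ereal r < ereal (dBR_norm b (hfun (p n)))" for r
    proof -
      \<comment> \<open>The factor 4 offsets the halved coefficients after squaring.\<close>
      obtain N where N: "4 * r\<^sup>2 < (\<Sum>k<N. (F k)\<^sup>2)" using unbounded by blast
      have "r < dBR_norm b (hfun (p n))" if n: "n \<ge> 2 * N" for n
      proof -
        have "(\<Sum>k<N. (\<bar>F k\<bar> / 2)\<^sup>2) \<le> (\<Sum>k<N. (norm (coord (p n) k))\<^sup>2)"
          using n by (intro sum_mono power_mono lower) auto
        also have "\<dots> \<le> (norm (p n))\<^sup>2" by (rule sum_coord_le)
        also have "(\<Sum>k<N. (\<bar>F k\<bar> / 2)\<^sup>2) = (\<Sum>k<N. (F k)\<^sup>2) / 4"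
          by (simp add: power_divide sum_divide_distrib)
        finally have "r\<^sup>2 < (norm (p n))\<^sup>2" using N by linarith
        then have "r < norm (p n)" by (rule power2_less_imp_less) simp
        also have "norm (p n) \<le> dBR_norm b (hfun (p n))"
          by (rule ge[of "Suc n"]) (use supp in auto)
        finally show ?thesis .
      qed
      then show ?thesis by (auto simp: eventually_sequentially)
    qed
    then have "(\<lambda>n. ereal (dBR_norm b (hfun (p n)))) \<longlonglongrightarrow> \<infinity>" unfolding tendsto_PInfty by blast
    from lim_imp_Limsup[OF _ this] show ?thesis by simp
  qed
  show ?thesis
  proof
    show "limsup (\<lambda>n. ereal (dBR_norm b (partial_sum n f))) = \<infinity>"
      unfolding partial_sum_eq by (rule lim) (auto simp: coord_taylor_poly tc)
    show "limsup (\<lambda>n. ereal (dBR_norm b (cesaro_mean n f))) = \<infinity>"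
      unfolding cesaro_mean_eq
    proof (rule lim)
      show "coord ((1 / real (n + 1)) *\<^sub>R (\<Sum>j\<le>n. taylor_poly j f)) k = 0" if "k > n" for n k
        using that by (simp add: coord_sum coord_taylor_poly)
      show "\<bar>F k\<bar> / 2 \<le> norm (coord ((1 / real (n + 1)) *\<^sub>R (\<Sum>j\<le>n. taylor_poly j f)) k)" if k: "2 * k \<le> n" for n k
      proof -
        have "1 / 2 \<le> real (n + 1 - k) / real (n + 1)" using k by (simp add: field_simps of_nat_diff)
        then have "1 / 2 * \<bar>F k\<bar> \<le> real (n + 1 - k) / real (n + 1) * \<bar>F k\<bar>" by (rule mult_right_mono) simp
        moreover have "norm (coord ((1 / real (n + 1)) *\<^sub>R (\<Sum>j\<le>n. taylor_poly j f)) k) = real (n + 1 - k) / real (n + 1) * \<bar>F k\<bar>"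
          using k by (subst coord_cesaro) (simp_all only: tc norm_mult norm_of_real, auto)
        ultimately show ?thesis by simp
      qed
    qed
  qed
qed

end
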